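(* Let $\sigma_1 = A^\perp$ and $\sigma_2 = B^\perp$ be co-oriented hyperplanes in $\mathcal{P}(n)$, with $A,B\in Sym_n(\mathbb{R})$, and suppose that the matrix pencil $(A,B)$ is regular. (1) Suppose that the set of generalized eigenvalues of $(A,B)$ contains nonreal numbers, denoted by $\lambda_1,\dots,\lambda_k$ and $\lambda_1^*,\dots,\lambda_k^*$ (complex conjugates). The following serves as an invariant angle function (on the set of all such pairs $(\sigma_1,\sigma_2)$): $$\theta(\sigma_1,\sigma_2)=\frac1k\sum_{i=1}^k|\arg(\lambda_i)|.$$ (2) Suppose that all distinct generalized eigenvalues of $(A,B)$ are real or infinity, ordered as $\lambda_k>\dots>\lambda_1$, where $k\ge 3$. The following serves as an invariant angle function (on the set of all such pairs $(\sigma_1,\sigma_2)$), where indices are taken modulo $k$ (so $\lambda_{k+1}=\lambda_1$) and where the formula is to be read as its limit as $\lambda_k\to\infty$ if $\infty$ is a generalized eigenvalue: $$\theta(\sigma_1,\sigma_2)=\arccos\frac{\sum_{i=1}^k\frac{\lambda_{i+1}+\lambda_i}{\lambda_{i+1}-\lambda_i}}{\sqrt{\left(\sum_{i=1}^k\frac{1}{\lambda_{i+1}-\lambda_i}\right)\left(\sum_{i=1}^k\frac{(\lambda_{i+1}+\lambda_i)^2}{\lambda_{i+1}-\lambda_i}\right)}}.$$ (3) If $(A,B)$ has at most $2$ distinct generalized eigenvalues and all of these are real, then $(\sigma_1,\sigma_2)$ is not in the domain of any invariant angle function.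
   Context: $Sym_n(\mathbb{R})$ is the space of real symmetric $n\times n$ matrices. $\mathcal{P}(n)=\{X\in Sym_n(\mathbb{R}) : \det X=1,\ X>0\}$ ($X>0$ means positive definite), with the action of $SL(n,\mathbb{R})$ given by $g.X=g^{T}Xg$. For nonzero $A\in Sym_n(\mathbb{R})$, $A^\perp=\{X\in\mathcal{P}(n): \mathrm{tr}(XA)=0\}$; it is a hyperplane whenever non-empty, and $A$ is called a normal vector of it. A co-oriented hyperplane is a (non-empty) hyperplane together with a normal vector, where normal vectors differing by a positive multiple give the same co-oriented hyperplane; $-\sigma=(-A)^\perp$ is the co-oriented hyperplane opposite to $\sigma=A^\perp$. For $g\in SL(n,\mathbb{R})$, $g.\sigma$ is the co-oriented hyperplane with normal vector $g^{-1}A(g^{-1})^{T}$. A co-oriented hyperplane $\sigma$ lies between $A^\perp$ and $B^\perp$ if its normal vector is a positive linear combination of $A$ and $B$. The pencil $(A,B)$ is regular if $\det(A-\lambda B)\neq0$ for at least one $\lambda\in\mathbb{C}$. A generalized eigenvalue of $(A,B)$ is a $\lambda_0\in\mathbb{C}$ with $A-\lambda_0B$ singular; by convention $\infty$ is a generalized eigenvalue if $B$ is singular. The argument is taken in $(-\pi,\pi]$. An invariant angle function is a function $\theta$ defined on a set (its domain) of ordered pairs of co-oriented hyperplanes in $\mathcal{P}(n)$, where the domain contains, along with $(\sigma_1,\sigma_2)$, the pairs $(g.\sigma_1,g.\sigma_2)$ for $g\in SL(n,\mathbb{R})$, $(\sigma_2,\sigma_1)$, $(-\sigma_1,\sigma_2)$,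 and $(\sigma_1,\sigma_3)$, $(\sigma_3,\sigma_2)$ for every $\sigma_3$ lying between $\sigma_1$ and $\sigma_2$, and which satisfies on its domain: (i) $0\le\theta(\sigma_1,\sigma_2)\le\pi$; $\theta(\sigma_1,\sigma_2)=0$ if and only if $\sigma_1=\sigma_2$; $\theta(\sigma_1,\sigma_2)=\pi$ if and only if $\sigma_1=-\sigma_2$. (ii) $\theta(g.\sigma_1,g.\sigma_2)=\theta(\sigma_1,\sigma_2)$ for every $g\in SL(n,\mathbb{R})$. (iii) $\theta(\sigma_2,\sigma_1)=\theta(\sigma_1,\sigma_2)$ and $\theta(-\sigma_1,\sigma_2)=\pi-\theta(\sigma_1,\sigma_2)$. (iv) if $\sigma_2$ lies between $\sigma_1$ and $\sigma_3$, then $\theta(\sigma_1,\sigma_2)+\theta(\sigma_2,\sigma_3)=\theta(\sigma_1,\sigma_3)$.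
   Formalization: Part (3) is proved for σ₁ ≠ σ₂ and σ₁ ≠ −σ₂; without this it is false: the pairs (σ,σ), (σ,−σ) with θ = 0, π form an invariant angle function, and e.g. A = B = diag(1,−1) is regular with the single real generalized eigenvalue 1. *)

theory Defs
  imports "HOL-Analysis.Analysis"
begin

section \<open>The space P(n) and its co-oriented hyperplanes\<close>

text \<open>The dimension n is \<open>CARD('n)\<close>.\<close>

definition Sym :: "(real^'n^'n) set" where
  "Sym = {X. transpose X = X}"

definition SL :: "(real^'n^'n) set" where
  "SL = {g. det g = 1}"

definition PD :: "(real^'n^'n) set" where
  "PD = {X \<in> Sym. det X = 1 \<and> (\<forall>v. v \<noteq> 0 \<longrightarrow> v \<bullet> (X *v v) > 0)}"

definition perp :: "real^'n^'n \<Rightarrow> (real^'n^'n) set" where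
  "perp A = {X \<in> PD. trace (X ** A) = 0}"

text \<open>\<open>A\<close> is the normal vector of a (non-empty) hyperplane.\<close>

definition is_normal :: "real^'n^'n \<Rightarrow> bool" where
  "is_normal A \<longleftrightarrow> A \<in> Sym \<and> A \<noteq> 0 \<and> perp A \<noteq> {}"

text \<open>A co-oriented hyperplane is a pair of a hyperplane and a class of normal vectors
  modulo positive multiples, the class being given as an open ray.\<close>

type_synonym 'n cohyp = "(real^'n^'n) set \<times> (real^'n^'n) set"

definition cohyp :: "real^'n^('n::finite) \<Rightarrow> 'n cohyp" where
  "cohyp A = (perp A, {c *\<^sub>R A | c. c > 0})"

definition cohyps :: "('n::finite) cohyp set" where
  "cohyps = {cohyp A | A. is_normal A}"

definition normals :: "('n::finite) cohyp \<Rightarrow> (real^'n^'n) set" where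
  "normals \<sigma> = snd \<sigma>"

definition opp :: "('n::finite) cohyp \<Rightarrow> 'n cohyp" where
  "opp \<sigma> = (fst \<sigma>, uminus ` normals \<sigma>)"

text \<open>The action \<open>X \<mapsto> g\<^sup>T X g\<close> on points and the corresponding one on normal vectors.\<close>

definition act_normal :: "real^'n^'n \<Rightarrow> real^'n^'n \<Rightarrow> real^'n^'n" where
  "act_normal g A = matrix_inv g ** A ** transpose (matrix_inv g)"

definition act :: "real^'n^('n::finite) \<Rightarrow> 'n cohyp \<Rightarrow> 'n cohyp" where
  "act g \<sigma> = ((\<lambda>X. transpose g ** X ** g) ` fst \<sigma>, act_normal g ` normals \<sigma>)"

definition lies_between :: "('n::finite) cohyp \<Rightarrow> 'n cohyp \<Rightarrow> 'n cohyp \<Rightarrow> bool" where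
  "lies_between \<sigma> \<sigma>\<^sub>1 \<sigma>\<^sub>2 \<longleftrightarrow> \<sigma> \<in> cohyps \<and>
     (\<exists>A\<in>normals \<sigma>\<^sub>1. \<exists>B\<in>normals \<sigma>\<^sub>2. \<exists>a>0. \<exists>b>0. a *\<^sub>R A + b *\<^sub>R B \<in> normals \<sigma>)"

section \<open>Invariant angle functions\<close>

definition invariant_angle_function ::
  "(('n::finite) cohyp \<times> 'n cohyp) set \<Rightarrow> ('n cohyp \<Rightarrow> 'n cohyp \<Rightarrow> real) \<Rightarrow> bool" where
  "invariant_angle_function D \<theta> \<longleftrightarrow>
     D \<subseteq> cohyps \<times> cohyps \<and>
     (\<forall>(\<sigma>\<^sub>1, \<sigma>\<^sub>2) \<in> D.
        (\<forall>g\<in>SL. (act g \<sigma>\<^sub>1, act g \<sigma>\<^sub>2) \<in> D) \<and>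
        (\<sigma>\<^sub>2, \<sigma>\<^sub>1) \<in> D \<and>
        (opp \<sigma>\<^sub>1, \<sigma>\<^sub>2) \<in> D \<and>
        (\<forall>\<sigma>\<^sub>3. lies_between \<sigma>\<^sub>3 \<sigma>\<^sub>1 \<sigma>\<^sub>2 \<longrightarrow> (\<sigma>\<^sub>1, \<sigma>\<^sub>3) \<in> D \<and> (\<sigma>\<^sub>3, \<sigma>\<^sub>2) \<in> D)) \<and>
     (\<forall>(\<sigma>\<^sub>1, \<sigma>\<^sub>2) \<in> D.
        0 \<le> \<theta> \<sigma>\<^sub>1 \<sigma>\<^sub>2 \<and> \<theta> \<sigma>\<^sub>1 \<sigma>\<^sub>2 \<le> pi \<and>
        (\<theta> \<sigma>\<^sub>1 \<sigma>\<^sub>2 = 0 \<longleftrightarrow> \<sigma>\<^sub>1 = \<sigma>\<^sub>2) \<and>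
        (\<theta> \<sigma>\<^sub>1 \<sigma>\<^sub>2 = pi \<longleftrightarrow> \<sigma>\<^sub>1 = opp \<sigma>\<^sub>2)) \<and>
     (\<forall>(\<sigma>\<^sub>1, \<sigma>\<^sub>2) \<in> D. \<forall>g\<in>SL. \<theta> (act g \<sigma>\<^sub>1) (act g \<sigma>\<^sub>2) = \<theta> \<sigma>\<^sub>1 \<sigma>\<^sub>2) \<and>
     (\<forall>(\<sigma>\<^sub>1, \<sigma>\<^sub>2) \<in> D. \<theta> \<sigma>\<^sub>2 \<sigma>\<^sub>1 = \<theta> \<sigma>\<^sub>1 \<sigma>\<^sub>2 \<and> \<theta> (opp \<sigma>\<^sub>1) \<sigma>\<^sub>2 = pi - \<theta> \<sigma>\<^sub>1 \<sigma>\<^sub>2) \<and>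
     (\<forall>(\<sigma>\<^sub>1, \<sigma>\<^sub>3) \<in> D. \<forall>\<sigma>\<^sub>2. lies_between \<sigma>\<^sub>2 \<sigma>\<^sub>1 \<sigma>\<^sub>3 \<longrightarrow>
        \<theta> \<sigma>\<^sub>1 \<sigma>\<^sub>2 + \<theta> \<sigma>\<^sub>2 \<sigma>\<^sub>3 = \<theta> \<sigma>\<^sub>1 \<sigma>\<^sub>3)"

section \<open>Pencils and generalized eigenvalues\<close>

definition pencil :: "real^'n^'n \<Rightarrow> real^'n^'n \<Rightarrow> complex \<Rightarrow> complex^'n^'n" where
  "pencil A B z = (\<chi> i j. complex_of_real (A $ i $ j) - z * complex_of_real (B $ i $ j))"

definition regular_pencil :: "real^'n^'n \<Rightarrow> real^'n^'n \<Rightarrow> bool" where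
  "regular_pencil A B \<longleftrightarrow> (\<exists>z. det (pencil A B z) \<noteq> 0)"

datatype geneig = Fin complex | Infty

definition gen_eigenvalues :: "real^'n^'n \<Rightarrow> real^'n^'n \<Rightarrow> geneig set" where
  "gen_eigenvalues A B =
     {Fin z | z. \<not> invertible (pencil A B z)} \<union> (if invertible B then {} else {Infty})"

definition real_eigs :: "geneig set" where
  "real_eigs = {Fin (complex_of_real x) | x. True}"

definition nonreal_eigenvalues :: "real^'n^'n \<Rightarrow> real^'n^'n \<Rightarrow> complex set" where
  "nonreal_eigenvalues A B = {z. Fin z \<in> gen_eigenvalues A B \<and> z \<notin> \<real>}"

section \<open>The pairs and the angle formulas\<close>

definition regular_normals :: "real^'n^'n \<Rightarrow> real^'n^'n \<Rightarrow> bool" where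
  "regular_normals A B \<longleftrightarrow> is_normal A \<and> is_normal B \<and> regular_pencil A B"

definition nonreal_case :: "real^'n^'n \<Rightarrow> real^'n^'n \<Rightarrow> bool" where
  "nonreal_case A B \<longleftrightarrow> regular_normals A B \<and> nonreal_eigenvalues A B \<noteq> {}"

text \<open>Regular pencils have finitely many generalized eigenvalues, so \<open>card\<close> is meaningful.\<close>

definition real_case :: "real^'n^'n \<Rightarrow> real^'n^'n \<Rightarrow> bool" where
  "real_case A B \<longleftrightarrow> regular_normals A B \<and>
     gen_eigenvalues A B \<subseteq> insert Infty real_eigs \<and> card (gen_eigenvalues A B) \<ge> 3"

text \<open>\<open>\<lambda>\<^sub>1, \<dots>, \<lambda>\<^sub>k\<close> and their conjugates are the distinct nonreal generalized eigenvalues.\<close>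

definition enumerates_nonreal ::
  "real^'n^'n \<Rightarrow> real^'n^'n \<Rightarrow> nat \<Rightarrow> (nat \<Rightarrow> complex) \<Rightarrow> bool" where
  "enumerates_nonreal A B k l \<longleftrightarrow>
     inj_on l {1..k} \<and> l ` {1..k} \<inter> cnj ` l ` {1..k} = {} \<and>
     l ` {1..k} \<union> cnj ` l ` {1..k} = nonreal_eigenvalues A B"

text \<open>Indices are cyclic: \<open>nx i\<close> is \<open>\<lambda>\<^sub>i\<^sub>+\<^sub>1\<close>, with \<open>\<lambda>\<^sub>k\<^sub>+\<^sub>1 = \<lambda>\<^sub>1\<close>.  If \<open>\<lambda>\<^sub>k = \<infinity>\<close>, the angle is the limit as the
  \<open>k\<close>-th entry of \<open>l\<close> tends to infinity.\<close>

definition cos_formula :: "nat \<Rightarrow> (nat \<Rightarrow> real) \<Rightarrow> real" where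
  "cos_formula k l =
     (let nx = (\<lambda>i. if i = k then l 1 else l (i + 1)) in
      (\<Sum>i=1..k. (nx i + l i) / (nx i - l i)) /
      sqrt ((\<Sum>i=1..k. 1 / (nx i - l i)) * (\<Sum>i=1..k. (nx i + l i)^2 / (nx i - l i))))"

section \<open>Consistency of the encoding\<close>

lemma SL_inv: 
  assumes "g \<in> SL" shows "g ** matrix_inv g = mat 1" "matrix_inv g ** g = mat 1"
proof -
  have "invertible g" using assms by (simp add: SL_def invertible_det_nz)
  then show "g ** matrix_inv g = mat 1" "matrix_inv g ** g = mat 1"
    unfolding atomize_conj invertible_def matrix_inv_def by (rule someI_ex)
qed

lemma SL_matrix_inv: "g \<in> SL \<Longrightarrow> matrix_inv g \<in> SL"
  using SL_inv(1)[of g] det_mul[of g "matrix_inv g"] by (simp add: SL_def)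

lemma act_normal_scaleR: "act_normal g (c *\<^sub>R A) = c *\<^sub>R act_normal g A"
  by (simp add: act_normal_def matrix_scalar_ac scalar_matrix_assoc)

lemma PD_congruence:
  assumes "g \<in> SL" "X \<in> PD" shows "transpose g ** X ** g \<in> PD"
proof -
  have "v \<bullet> ((transpose g ** X ** g) *v v) = (g *v v) \<bullet> (X *v (g *v v))" for v
    by (simp only: matrix_vector_mul_assoc[symmetric] dot_lmul_matrix[symmetric]
        vector_transpose_matrix)
  moreover have "g *v v \<noteq> 0" if "v \<noteq> 0" for v
    using that SL_inv(2)[OF assms(1)]
    by (metis matrix_vector_mul_assoc matrix_vector_mul_lid matrix_vector_mult_0_right)
  ultimately show ?thesis using assms
    by (auto simp: PD_def Sym_def SL_def matrix_transpose_mul det_mul matrix_mul_assoc)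
qed

lemma trace_act:
  assumes "g \<in> SL"
  shows "trace ((transpose g ** X ** g) ** act_normal g A) = trace (X ** A)"
proof -
  have 1: "g ** (matrix_inv g ** M) = M" for M
    by (metis SL_inv(1)[OF assms] matrix_mul_assoc matrix_mul_lid)
  have "trace ((transpose g ** X ** g) ** act_normal g A)
      = trace (transpose g ** (X ** (A ** transpose (matrix_inv g))))"
    by (simp add: act_normal_def matrix_mul_assoc[symmetric] 1)
  also have "\<dots> = trace (X ** A ** (transpose (matrix_inv g) ** transpose g))"
    by (subst trace_mul_sym) (simp add: matrix_mul_assoc)
  also have "transpose (matrix_inv g) ** transpose g = mat 1"
    using SL_inv[OF assms] by (metis matrix_transpose_mul transpose_mat)
  finally show ?thesis by simp
qed

text \<open>\<open>g.\<sigma>\<close> is the co-oriented hyperplane with normal vector \<open>g\<^sup>-\<^sup>1 A (g\<^sup>-\<^sup>1)\<^sup>T\<close>, and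
  \<open>-\<sigma> = (-A)\<^sup>\<bottom>\<close>.\<close>

lemma act_cohyp:
  assumes "g \<in> SL" shows "act g (cohyp A) = cohyp (act_normal g A)"
proof -
  define h where "h = matrix_inv g"
  have h: "h \<in> SL" and gh: "g ** h = mat 1" "h ** g = mat 1"
    using SL_matrix_inv SL_inv assms by (auto simp: h_def)
  have "(\<lambda>X. transpose g ** X ** g) ` perp A = perp (act_normal g A)"
  proof (intro equalityI subsetI)
    fix Y assume "Y \<in> (\<lambda>X. transpose g ** X ** g) ` perp A"
    then show "Y \<in> perp (act_normal g A)"
      using assms by (auto simp: perp_def PD_congruence trace_act)
  next
    fix Y assume Y: "Y \<in> perp (act_normal g A)"
    define X where "X = transpose h ** Y ** h"
    have "transpose g ** X ** g = (transpose g ** transpose h) ** Y ** (h ** g)"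
      by (simp add: X_def matrix_mul_assoc)
    also have "transpose g ** transpose h = mat 1"
      by (metis gh(2) matrix_transpose_mul transpose_mat)
    finally have XY: "Y = transpose g ** X ** g" by (simp add: gh)
    have "X \<in> PD"
      using Y PD_congruence[OF h] by (simp add: perp_def X_def)
    moreover have "trace (X ** A) = 0"
      using Y unfolding trace_act[OF assms, of X A, symmetric] XY[symmetric]
      by (simp add: perp_def)
    ultimately have "X \<in> perp A" by (simp add: perp_def)
    with XY show "Y \<in> (\<lambda>X. transpose g ** X ** g) ` perp A" by blast
  qed
  moreover have "act_normal g ` {c *\<^sub>R A | c. c > 0} = {c *\<^sub>R act_normal g A | c. c > 0}"
    unfolding setcompr_eq_image image_image act_normal_scaleR by (rule refl)
  ultimately show ?thesis
    by (simp add: act_def cohyp_def normals_def)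
qed

lemma opp_cohyp:
  fixes A :: "real^'n^'n"
  shows "opp (cohyp A) = cohyp (- A)"
proof -
  have "trace (X ** - A) = - trace (X ** A)" for X :: "real^'n^'n"
    by (simp add: trace_def matrix_matrix_mult_def sum_negf)
  then show ?thesis by (auto simp: opp_def cohyp_def normals_def perp_def image_iff)
qed

lemma opp_opp: "opp (opp \<sigma>) = \<sigma>"
  by (cases \<sigma>) (simp add: opp_def normals_def image_image)

lemma cohyp_eqD:
  assumes "cohyp A = cohyp B" shows "\<exists>c>0. A = c *\<^sub>R B"
proof -
  have "A \<in> {c *\<^sub>R A | c. c > 0}" by (rule CollectI, rule exI[of _ 1]) simp
  with assms show ?thesis by (auto simp: cohyp_def)
qed

lemma opp_neq:
  assumes "\<sigma> \<in> cohyps" shows "opp \<sigma> \<noteq> \<sigma>"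
proof
  assume eq: "opp \<sigma> = \<sigma>"
  obtain A where A: "\<sigma> = cohyp A" "A \<noteq> 0" using assms by (auto simp: cohyps_def is_normal_def)
  then have "cohyp A = cohyp (- A)" using eq by (simp add: opp_cohyp)
  then obtain c where "c > 0" "A = c *\<^sub>R (- A)" using cohyp_eqD by blast
  have "(1 + c) *\<^sub>R A = A - c *\<^sub>R (- A)" by (simp add: scaleR_add_left)
  also have "\<dots> = 0" using \<open>A = c *\<^sub>R (- A)\<close> by (metis diff_self)
  finally have "(1 + c) *\<^sub>R A = 0" .
  with A \<open>c > 0\<close> show False by simp
qed

lemma opp_act: "opp (act g \<sigma>) = act g (opp \<sigma>)"
  using act_normal_scaleR[of g "-1"]
  by (simp add: act_def opp_def normals_def image_image)


lemma perp_uminus: "perp (- A) = perp (A :: real^'n^'n)"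
  using arg_cong[OF opp_cohyp[of A], of fst] by (simp add: opp_def cohyp_def)

lemma opp_in: "\<sigma> \<in> cohyps \<Longrightarrow> opp \<sigma> \<in> cohyps"
proof -
  assume "\<sigma> \<in> cohyps"
  then obtain A where A: "\<sigma> = cohyp A" "is_normal A" by (auto simp: cohyps_def)
  have "is_normal (- A)"
    using A(2) by (simp add: is_normal_def perp_uminus Sym_def transpose_def vec_eq_iff)
  then show ?thesis unfolding A(1) opp_cohyp cohyps_def by blast
qed

lemma act_in: "\<sigma> \<in> cohyps \<Longrightarrow> g \<in> SL \<Longrightarrow> act g \<sigma> \<in> cohyps"
proof -
  assume "\<sigma> \<in> cohyps" and g: "g \<in> SL"
  then obtain A where A: "\<sigma> = cohyp A" "is_normal A" by (auto simp: cohyps_def)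
  have "transpose (act_normal g A) = act_normal g A"
    using A(2) by (simp add: is_normal_def Sym_def act_normal_def matrix_transpose_mul matrix_mul_assoc)
  moreover have "perp (act_normal g A) \<noteq> {}"
    using A(2) arg_cong[OF act_cohyp[OF g, of A], of fst]
    by (auto simp: is_normal_def act_def cohyp_def)
  moreover have "act_normal g A \<noteq> 0"
  proof
    assume 0: "act_normal g A = 0"
    have 1: "transpose (matrix_inv g) ** transpose g = mat 1"
      using SL_inv[OF g] by (metis matrix_transpose_mul transpose_mat)
    have "A = (g ** matrix_inv g) ** A ** (transpose (matrix_inv g) ** transpose g)"
      by (simp add: SL_inv[OF g] 1)
    also have "\<dots> = g ** act_normal g A ** transpose g"
      by (simp add: act_normal_def matrix_mul_assoc)
    also have "\<dots> = 0" by (simp add: 0)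
    finally show False using A(2) by (simp add: is_normal_def)
  qed
  ultimately have "is_normal (act_normal g A)" by (simp add: is_normal_def Sym_def)
  then show ?thesis unfolding A(1) act_cohyp[OF g] cohyps_def by blast
qed

lemma cohyp_scale:
  fixes A :: "real^'n^'n" assumes "c > 0" shows "cohyp (c *\<^sub>R A) = cohyp A"
proof -
  have "perp (c *\<^sub>R A) = perp A"
    using assms by (auto simp: perp_def matrix_scalar_ac scalar_matrix_assoc[symmetric] trace_def sum_distrib_left[symmetric])
  moreover have "{d *\<^sub>R c *\<^sub>R A | d. d > 0} = {d *\<^sub>R A | d. d > 0}"
  proof (intro equalityI subsetI)
    fix X assume "X \<in> {d *\<^sub>R A | d. d > 0}"
    then obtain d where "X = d *\<^sub>R A" "d > 0" by blast
    then have "X = (d / c) *\<^sub>R c *\<^sub>R A" "d / c > 0" using assms by auto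
    then show "X \<in> {d *\<^sub>R c *\<^sub>R A | d. d > 0}" by blast
  qed (use assms mult_pos_pos in force)
  ultimately show ?thesis by (simp add: cohyp_def)
qed

lemma between_parallel:
  assumes s: "\<sigma> \<in> cohyps" and b: "lies_between \<tau> \<sigma> \<sigma>'" and o: "\<sigma>' = \<sigma> \<or> \<sigma>' = opp \<sigma>"
  shows "\<tau> = \<sigma> \<or> (\<sigma>' = opp \<sigma> \<and> \<tau> = opp \<sigma>)"
proof -
  obtain A where A: "\<sigma> = cohyp A" using s by (auto simp: cohyps_def)
  obtain C where C: "\<tau> = cohyp C" "C \<noteq> 0" using b by (auto simp: lies_between_def cohyps_def is_normal_def)
  obtain X Y a b where *: "X \<in> normals \<sigma>" "Y \<in> normals \<sigma>'" "a > 0" "b > 0"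
    "a *\<^sub>R X + b *\<^sub>R Y \<in> normals \<tau>" using b by (auto simp: lies_between_def)
  obtain x where x: "X = x *\<^sub>R A" "x > 0" using *(1) by (auto simp: A normals_def cohyp_def)
  obtain z where z: "a *\<^sub>R X + b *\<^sub>R Y = z *\<^sub>R C" "z > 0" using *(5) by (auto simp: C normals_def cohyp_def)
  obtain y where y: "Y = y *\<^sub>R A" "y > 0 \<or> (\<sigma>' = opp \<sigma>)"
  proof (cases "\<sigma>' = opp \<sigma>")
    case True
    then have "Y \<in> normals (cohyp (- A))" using *(2) by (simp add: A opp_cohyp)
    then obtain y where "Y = y *\<^sub>R - A" by (auto simp: normals_def cohyp_def)
    then have "Y = (- y) *\<^sub>R A" by simp
    with True that show ?thesis by blast
  next
    case False
    with o *(2) that show ?thesis by (auto simp: A normals_def cohyp_def)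
  qed
  define r where "r = (a * x + b * y) / z"
  have "z *\<^sub>R C = (a * x + b * y) *\<^sub>R A" using z x y by (simp add: scaleR_add_left)
  then have "inverse z *\<^sub>R (z *\<^sub>R C) = inverse z *\<^sub>R ((a * x + b * y) *\<^sub>R A)" by (rule arg_cong)
  then have "inverse z *\<^sub>R (z *\<^sub>R C) = inverse z *\<^sub>R ((a * x + b * y) *\<^sub>R A)" by (rule arg_cong)
  then have "inverse z *\<^sub>R (z *\<^sub>R C) = inverse z *\<^sub>R ((a * x + b * y) *\<^sub>R A)" by (rule arg_cong)
  then have "inverse z *\<^sub>R (z *\<^sub>R C) = inverse z *\<^sub>R ((a * x + b * y) *\<^sub>R A)" by (rule arg_cong)
  then have "inverse z *\<^sub>R (z *\<^sub>R C) = inverse z *\<^sub>R ((a * x + b * y) *\<^sub>R A)" by (rule arg_cong)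
  then have "inverse z *\<^sub>R (z *\<^sub>R C) = inverse z *\<^sub>R ((a * x + b * y) *\<^sub>R A)" by (rule arg_cong)
  then have "inverse z *\<^sub>R (z *\<^sub>R C) = inverse z *\<^sub>R ((a * x + b * y) *\<^sub>R A)" by (rule arg_cong)
  then have Cr: "C = r *\<^sub>R A" using z(2) by (simp add: r_def divide_inverse mult.commute)
  consider "r > 0" | "r = 0" | "r < 0" by linarith
  then show ?thesis
  proof cases
    case 1 then show ?thesis by (simp add: C Cr A cohyp_scale)
  next
    case 2 then show ?thesis using C Cr by simp
  next
    case 3
    have "\<sigma>' = opp \<sigma>"
    proof (rule ccontr)
      assume "\<sigma>' \<noteq> opp \<sigma>"
      then have "r > 0" using y(2) x z *(3,4) by (simp add: r_def add_pos_pos)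
      with 3 show False by simp
    qed
    moreover have "C = (- r) *\<^sub>R (- A)" using Cr by simp
    ultimately show ?thesis using 3 by (simp add: C(1) A opp_cohyp cohyp_scale del: scaleR_minus_left scaleR_minus_right)
  qed
qed

text \<open>Pairs with \<open>\<sigma>\<^sub>2 = \<plusminus>\<sigma>\<^sub>1\<close> always lie in the domain of some invariant angle function, whatever
  their generalized eigenvalues are; such a pair has a single generalized eigenvalue, which is real,
  if its normal vectors are nonsingular.  Hence the nonexistence result for at most two real
  generalized eigenvalues only makes sense for \<open>\<sigma>\<^sub>1 \<noteq> \<plusminus>\<sigma>\<^sub>2\<close>.\<close>

lemma parallel_pairs:
  "invariant_angle_function {(\<sigma>, \<tau>). \<sigma> \<in> cohyps \<and> (\<tau> = \<sigma> \<or> \<tau> = opp \<sigma>)}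
     (\<lambda>\<sigma> \<tau> :: ('n::finite) cohyp. if \<sigma> = \<tau> then 0 else pi)" (is "invariant_angle_function ?D _")
proof -
  have ne: "opp \<sigma> \<noteq> \<sigma>" "\<sigma> \<noteq> opp \<sigma>" if "\<sigma> \<in> cohyps" for \<sigma> :: "'n cohyp"
    using opp_neq[OF that] by auto
  have a: "act g (opp \<sigma>) = opp (act g \<sigma>)" for g and \<sigma> :: "'n cohyp"
    by (simp add: opp_act)
  have b1: "\<tau> = \<sigma>" if "\<sigma> \<in> cohyps" "lies_between \<tau> \<sigma> \<sigma>" for \<sigma> \<tau> :: "'n cohyp"
    using between_parallel[OF that] opp_neq[OF that(1)] by auto
  have b2: "\<tau> = \<sigma> \<or> \<tau> = opp \<sigma>" if "\<sigma> \<in> cohyps" "lies_between \<tau> \<sigma> (opp \<sigma>)"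
    for \<sigma> \<tau> :: "'n cohyp"
    using between_parallel[OF that] by auto
  have add: "(if \<sigma>\<^sub>1 = \<sigma>\<^sub>2 then 0 else pi) + (if \<sigma>\<^sub>2 = \<sigma>\<^sub>3 then 0 else pi) =
        (if \<sigma>\<^sub>1 = \<sigma>\<^sub>3 then 0 else pi)"
    if s: "\<sigma>\<^sub>1 \<in> cohyps" and o: "\<sigma>\<^sub>3 = \<sigma>\<^sub>1 \<or> \<sigma>\<^sub>3 = opp \<sigma>\<^sub>1" and l: "lies_between \<sigma>\<^sub>2 \<sigma>\<^sub>1 \<sigma>\<^sub>3"
    for \<sigma>\<^sub>1 \<sigma>\<^sub>2 \<sigma>\<^sub>3 :: "'n cohyp"
    using between_parallel[OF s l o] o ne[OF s] by auto
  have bc: "(\<sigma>\<^sub>2 = \<sigma>\<^sub>1 \<or> \<sigma>\<^sub>2 = opp \<sigma>\<^sub>1) \<and> \<sigma>\<^sub>2 \<in> cohyps \<and> (\<sigma>\<^sub>3 = \<sigma>\<^sub>2 \<or> \<sigma>\<^sub>3 = opp \<sigma>\<^sub>2)"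
    if s: "\<sigma>\<^sub>1 \<in> cohyps" and o: "\<sigma>\<^sub>3 = \<sigma>\<^sub>1 \<or> \<sigma>\<^sub>3 = opp \<sigma>\<^sub>1" and l: "lies_between \<sigma>\<^sub>2 \<sigma>\<^sub>1 \<sigma>\<^sub>3"
    for \<sigma>\<^sub>1 \<sigma>\<^sub>2 \<sigma>\<^sub>3 :: "'n cohyp"
    using between_parallel[OF s l o] o opp_in[OF s] s by (auto simp: opp_opp)
  have cl: "(\<forall>g\<in>SL. (act g \<sigma>\<^sub>1, act g \<sigma>\<^sub>2) \<in> ?D) \<and> (\<sigma>\<^sub>2, \<sigma>\<^sub>1) \<in> ?D \<and> (opp \<sigma>\<^sub>1, \<sigma>\<^sub>2) \<in> ?D \<and>
      (\<forall>\<sigma>\<^sub>3. lies_between \<sigma>\<^sub>3 \<sigma>\<^sub>1 \<sigma>\<^sub>2 \<longrightarrow> (\<sigma>\<^sub>1, \<sigma>\<^sub>3) \<in> ?D \<and> (\<sigma>\<^sub>3, \<sigma>\<^sub>2) \<in> ?D)"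
    if s: "\<sigma>\<^sub>1 \<in> cohyps" and o: "\<sigma>\<^sub>2 = \<sigma>\<^sub>1 \<or> \<sigma>\<^sub>2 = opp \<sigma>\<^sub>1" for \<sigma>\<^sub>1 \<sigma>\<^sub>2 :: "'n cohyp"
  proof (intro conjI)
    show "\<forall>\<sigma>\<^sub>3. lies_between \<sigma>\<^sub>3 \<sigma>\<^sub>1 \<sigma>\<^sub>2 \<longrightarrow> (\<sigma>\<^sub>1, \<sigma>\<^sub>3) \<in> ?D \<and> (\<sigma>\<^sub>3, \<sigma>\<^sub>2) \<in> ?D"
      using bc[OF s o] s by blast
  qed (use s o in \<open>auto simp: opp_in act_in a opp_opp\<close>)
  show ?thesis
    unfolding invariant_angle_function_def
  proof (intro conjI)
    show "\<forall>(\<sigma>\<^sub>1, \<sigma>\<^sub>3)\<in>{(\<sigma>, \<tau>). \<sigma> \<in> cohyps \<and> (\<tau> = \<sigma> \<or> \<tau> = opp \<sigma>)}. \<forall>\<sigma>\<^sub>2. lies_between \<sigma>\<^sub>2 \<sigma>\<^sub>1 \<sigma>\<^sub>3 \<longrightarrow>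
        (if \<sigma>\<^sub>1 = \<sigma>\<^sub>2 then 0 else pi) + (if \<sigma>\<^sub>2 = \<sigma>\<^sub>3 then 0 else pi) =
        (if \<sigma>\<^sub>1 = (\<sigma>\<^sub>3 :: 'n cohyp) then 0 else pi)"
      using add by (simp only: Ball_def split_paired_All mem_Collect_eq prod.case) iprover
  next
    show "\<forall>(\<sigma>\<^sub>1, \<sigma>\<^sub>2)\<in>?D.
        (\<forall>g\<in>SL. (act g \<sigma>\<^sub>1, act g \<sigma>\<^sub>2) \<in> ?D) \<and> (\<sigma>\<^sub>2, \<sigma>\<^sub>1) \<in> ?D \<and> (opp \<sigma>\<^sub>1, \<sigma>\<^sub>2) \<in> ?D \<and>
        (\<forall>\<sigma>\<^sub>3. lies_between \<sigma>\<^sub>3 \<sigma>\<^sub>1 \<sigma>\<^sub>2 \<longrightarrow> (\<sigma>\<^sub>1, \<sigma>\<^sub>3) \<in> ?D \<and> (\<sigma>\<^sub>3, \<sigma>\<^sub>2) \<in> ?D)"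
    proof (rule ballI)
      fix p assume "p \<in> ?D"
      then obtain s t where p: "p = (s, t)" "s \<in> cohyps" "t = s \<or> t = opp s" by blast
      show "case p of (\<sigma>\<^sub>1, \<sigma>\<^sub>2) \<Rightarrow>
        (\<forall>g\<in>SL. (act g \<sigma>\<^sub>1, act g \<sigma>\<^sub>2) \<in> ?D) \<and> (\<sigma>\<^sub>2, \<sigma>\<^sub>1) \<in> ?D \<and> (opp \<sigma>\<^sub>1, \<sigma>\<^sub>2) \<in> ?D \<and>
        (\<forall>\<sigma>\<^sub>3. lies_between \<sigma>\<^sub>3 \<sigma>\<^sub>1 \<sigma>\<^sub>2 \<longrightarrow> (\<sigma>\<^sub>1, \<sigma>\<^sub>3) \<in> ?D \<and> (\<sigma>\<^sub>3, \<sigma>\<^sub>2) \<in> ?D)"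
        unfolding p(1) prod.case by (rule cl[OF p(2,3)])
    qed
  qed (auto simp: opp_in act_in a opp_opp ne dest: b1 b2)
qed
end

(*
Parts (1) and (2). Suppose that to each pair (A, B) is attached a finite nonempty set Z of nonreal
numbers that is SL-invariant and moves by Moebius maps when (A, B) is replaced by another basis of
its span. Then the mean of |arg z| over Z is an invariant angle function, because
|arg (z / (a z + b))| + |arg (a z + b)| = |arg z| for a, b > 0. In part (1), Z is the set of
nonreal eigenvalues. In part (2), Z is the set of roots of the binary quadratic form
  Q(x) = sum_i (x - l_i) (x - l_(i+1)) / (l_(i+1) - l_i),
which is positive definite for k >= 3; the paper's formula is the cosine of the argument of a root.

Part (3). Let M = B^-1 A have at most two eigenvalues a, b, both real. Then R = (M - a)(M - b) is
nilpotent, so tr (R Z) = 0 whenever Z commutes with M, that is, R is orthogonal to the centralizer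
of M for the trace form, and hence R is a commutator [M, S]. From S one obtains a one-parameter group
of congruences that scales A - a B and A - b B by different factors. It acts on the rays of the plane
spanned by A and B and preserves angles, which contradicts either the additivity of the angle (if a
ray fixed by the group is involved) or the bound pi (if a translate of B along its orbit is A).
*)
theory Submission
  imports Defs "HOL-Computational_Algebra.Fundamental_Theorem_Algebra"
begin

section \<open>Integrating infinitesimal congruences\<close>

text \<open>If R = 0, the flow of - M / 2 does it: it moves B by - A and A by - B M^2, which then
  lies in the plane of A and B. In general the latter misses the plane by B R. The obstacle is to
  repair this without disturbing B. A direction skew for B does not move B; such is S - T, with T
  the B-adjoint of S, and it moves A by 2 B [M, S] = 2 B R. Half of it cancels the error. As only
  the nilpotency of R is used, a second number b may be chosen freely when M has a single
  eigenvalue, so there is no parabolic case to treat. A positive combination of normal vectors may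
  define an empty hyperplane, which blocks additivity. At least one of the pairs (A, B) and (-A, B)
  is free of this, and a domain containing one contains the other. For Q the obstacles are infinity
  and the cyclic order. Vectors of R^2 replace eigenvalues: each summand is homogeneous of degree 0
  in its two points, and neighbours are recognized by signs of determinants. A change of basis then
  acts by substitution, and infinity is a point like any other. Positivity is checked at one vector,
  as rotations with scaling carry any nonzero vector there.\<close>

text \<open>The matrix type is not an instance of the classes required by \<open>exp\<close>; endomorphisms with the operator
  norm (for which \<open>norm 1 = 1\<close>) are.\<close>

typedef (overloaded) 'a endo = "UNIV :: ('a::euclidean_space \<Rightarrow>\<^sub>L 'a) set"
  morphisms blinfun_of Endo by simp

setup_lifting type_definition_endo

instantiation endo :: (euclidean_space) real_normed_algebra_1
begin
lift_definition norm_endo :: "'a endo \<Rightarrow> real" is norm .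
lift_definition plus_endo :: "'a endo \<Rightarrow> 'a endo \<Rightarrow> 'a endo" is "(+)" .
lift_definition minus_endo :: "'a endo \<Rightarrow> 'a endo \<Rightarrow> 'a endo" is "(-)" .
lift_definition uminus_endo :: "'a endo \<Rightarrow> 'a endo" is uminus .
lift_definition zero_endo :: "'a endo" is 0 .
lift_definition one_endo :: "'a endo" is id_blinfun .
lift_definition times_endo :: "'a endo \<Rightarrow> 'a endo \<Rightarrow> 'a endo" is blinfun_compose .
lift_definition scaleR_endo :: "real \<Rightarrow> 'a endo \<Rightarrow> 'a endo" is scaleR .
definition dist_endo :: "'a endo \<Rightarrow> 'a endo \<Rightarrow> real" where "dist_endo a b = norm (a - b)"
definition "(uniformity :: ('a endo \<times> 'a endo) filter) =
  (INF e\<in>{0 <..}. principal {(x, y). dist x y < e})"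
definition open_endo :: "'a endo set \<Rightarrow> bool" where
  "open_endo S = (\<forall>x\<in>S. \<forall>\<^sub>F (x', y) in uniformity. x' = x \<longrightarrow> y \<in> S)"
definition sgn_endo :: "'a endo \<Rightarrow> 'a endo" where "sgn_endo x = scaleR (inverse (norm x)) x"
instance
  apply standard
  unfolding dist_endo_def open_endo_def sgn_endo_def uniformity_endo_def
  apply (rule refl | (transfer, force simp: algebra_simps norm_triangle_ineq norm_blinfun_compose
     intro!: blinfun_eqI simp: blinfun.bilinear_simps dest: arg_cong[where f="\<lambda>f. blinfun_apply f _"]) )+
  done
end

instance endo :: (euclidean_space) banach
proof
  fix X :: "nat \<Rightarrow> 'a endo" assume "Cauchy X"
  then have "Cauchy (\<lambda>n. blinfun_of (X n))"
    unfolding Cauchy_def dist_norm by transfer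
  then obtain l where "(\<lambda>n. blinfun_of (X n)) \<longlonglongrightarrow> l"
    using Cauchy_convergent convergent_def by blast
  then have "X \<longlonglongrightarrow> Endo l"
    unfolding LIMSEQ_def dist_norm
    by (simp add: norm_endo.rep_eq minus_endo.rep_eq Endo_inverse)
  then show "convergent X" by (auto simp: convergent_def)
qed

lift_definition adj :: "'a::euclidean_space endo \<Rightarrow> 'a endo"
  is "\<lambda>f. Blinfun (adjoint (blinfun_apply f))" .

lemma blinfun_adj: "blinfun_apply (blinfun_of (adj f)) = adjoint (blinfun_apply (blinfun_of f))"
proof -
  have "linear (adjoint (blinfun_apply (blinfun_of f)))"
    by (intro adjoint_linear bounded_linear.linear blinfun.bounded_linear_right)
  then show ?thesis
    by (simp add: adj.rep_eq bounded_linear_Blinfun_apply linear_conv_bounded_linear)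
qed

lemma adj_inner: "inner (blinfun_apply (blinfun_of (adj f)) x) y = inner x (blinfun_apply (blinfun_of f) y)"
  unfolding blinfun_adj
  by (metis adjoint_works blinfun.bounded_linear_right bounded_linear.linear inner_commute)

lemma endo_eqI:
  assumes "\<And>x y. inner (blinfun_apply (blinfun_of f) x) y = inner (blinfun_apply (blinfun_of g) x) y"
  shows "f = g"
  using assms by (metis blinfun_eqI blinfun_of_inject inner_eq_zero_iff vector_eq_rdot)

text \<open>Cauchy-Schwarz in |f* x|^2 = <x, f f* x>, with one factor cancelled. The bound makes
  \<open>adj\<close> continuous, so that it applies termwise to the exponential series.\<close>

lemma norm_adj_le: "norm (adj f) \<le> norm f"
proof -
  have "norm (blinfun_apply (blinfun_of (adj f)) x) \<le> norm f * norm x" for x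
  proof -
    let ?y = "blinfun_apply (blinfun_of (adj f)) x"
    have "norm ?y * norm ?y = inner x (blinfun_apply (blinfun_of f) ?y)"
      by (metis adj_inner norm_eq_sqrt_inner power2_eq_square power2_norm_eq_inner)
    also have "\<dots> \<le> norm x * norm (blinfun_apply (blinfun_of f) ?y)"
      by (rule norm_cauchy_schwarz)
    also have "\<dots> \<le> norm x * (norm f * norm ?y)"
      by (intro mult_left_mono) (auto simp: norm_endo.rep_eq norm_blinfun)
    finally show ?thesis
      by (cases "norm ?y = 0") (auto simp: mult.commute mult.left_commute)
  qed
  then show ?thesis unfolding norm_endo.rep_eq
    by (intro norm_blinfun_bound) auto
qed

lemma bounded_linear_adj: "bounded_linear adj"
proof
  show "adj (f + g) = adj f + adj g" for f g :: "'a endo"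
    by (rule endo_eqI) (simp add: adj_inner plus_endo.rep_eq blinfun.bilinear_simps inner_simps)
  show "adj (r *\<^sub>R f) = r *\<^sub>R adj f" for r and f :: "'a endo"
    by (rule endo_eqI) (simp add: adj_inner scaleR_endo.rep_eq blinfun.bilinear_simps inner_simps)
  show "\<exists>K. \<forall>f :: 'a endo. norm (adj f) \<le> norm f * K"
    using norm_adj_le by (intro exI[of _ 1]) auto
qed

lemma adj_mult: "adj (f * g) = adj g * adj f"
  by (rule endo_eqI) (simp add: adj_inner times_endo.rep_eq)

lemma adj_power: "adj (f ^ n) = adj f ^ n"
proof (induction n)
  case 0
  show ?case by (rule endo_eqI) (simp add: adj_inner one_endo.rep_eq)
next
  case (Suc n)
  then show ?case by (simp add: adj_mult power_commutes)
qed

lemma adj_exp: "adj (exp f) = exp (adj f)"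
proof -
  have "adj (exp f) = (\<Sum>n. adj (f ^ n /\<^sub>R fact n))"
    unfolding exp_def by (rule bounded_linear.suminf[OF bounded_linear_adj summable_exp_generic])
  also have "\<dots> = exp (adj f)"
    unfolding exp_def by (simp add: bounded_linear_adj bounded_linear.linear linear_scale adj_power)
  finally show ?thesis .
qed

text \<open>The hypothesis is the intertwining relation adj h c = c (p - h). It passes to powers and
  to power series, and exp (p - h) is exp p times the inverse of exp h.\<close>

lemma exp_congruence:
  fixes h c :: "'a::euclidean_space endo"
  assumes "adj h * c + c * h = p *\<^sub>R c"
  shows "adj (exp h) * c * exp h = exp p *\<^sub>R c"
proof -
  have 1: "adj h * c = c * (of_real p - h)"
    using assms by (simp add: algebra_simps of_real_def)
  have 2: "adj h ^ n * c = c * (of_real p - h) ^ n" for n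
  proof (induction n)
    case (Suc n)
    have "adj h ^ Suc n * c = adj h * (adj h ^ n * c)" by (simp add: mult.assoc)
    also have "\<dots> = c * (of_real p - h) ^ Suc n"
      by (simp only: Suc.IH mult.assoc[symmetric] 1) (simp add: mult.assoc)
    finally show ?case .
  qed simp
  have "exp (adj h) * c = (\<Sum>n. (adj h ^ n /\<^sub>R fact n) * c)"
    unfolding exp_def by (rule suminf_mult2[OF summable_exp_generic])
  also have "\<dots> = (\<Sum>n. c * ((of_real p - h) ^ n /\<^sub>R fact n))" by (simp add: 2)
  also have "\<dots> = c * exp (of_real p - h)"
    unfolding exp_def by (rule suminf_mult[OF summable_exp_generic])
  also have "of_real p * (- h) = (- h) * of_real p" by (simp add: of_real_def)
  from exp_add_commuting[OF this] have "exp (of_real p - h) = of_real (exp p) * exp (- h)"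
    by (simp add: exp_of_real[symmetric])
  finally have "adj (exp h) * c * exp h = c * (of_real (exp p) * (exp (- h) * exp h))"
    by (simp add: adj_exp mult.assoc)
  also have "exp (- h) * exp h = 1" using exp_minus_inverse[of "- h"] by simp
  finally show ?thesis by (simp add: of_real_def)
qed

section \<open>Dictionary between matrices and endomorphisms\<close>

definition endo_of_matrix :: "real^'n^'n \<Rightarrow> (real^'n) endo" where
  "endo_of_matrix M = Endo (Blinfun ((*v) M))"

definition matrix_of_endo :: "(real^'n) endo \<Rightarrow> real^'n^'n" where
  "matrix_of_endo f = matrix (blinfun_apply (blinfun_of f))"

lemma apply_endo_of_matrix [simp]: "blinfun_apply (blinfun_of (endo_of_matrix M)) = (*v) M"
  by (simp add: endo_of_matrix_def Endo_inverse bounded_linear_Blinfun_apply)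

lemma matrix_of_endo_vector [simp]: "matrix_of_endo f *v x = blinfun_apply (blinfun_of f) x"
  by (simp add: matrix_of_endo_def matrix_works linear_conv_bounded_linear blinfun.bounded_linear_right)

lemma matrix_of_endo_of_matrix [simp]: "matrix_of_endo (endo_of_matrix M) = M"
  by (simp add: matrix_eq)

lemma endo_of_matrix_of_endo [simp]: "endo_of_matrix (matrix_of_endo f) = f"
  by (rule endo_eqI) simp

lemma matrix_of_endo_mult: "matrix_of_endo (f * g) = matrix_of_endo f ** matrix_of_endo g"
  by (simp add: matrix_eq times_endo.rep_eq flip: matrix_vector_mul_assoc)

lemma matrix_of_endo_add: "matrix_of_endo (f + g) = matrix_of_endo f + matrix_of_endo g"
  by (simp add: matrix_eq plus_endo.rep_eq blinfun.bilinear_simps matrix_vector_mult_add_rdistrib)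

lemma matrix_of_endo_scaleR: "matrix_of_endo (r *\<^sub>R f) = r *\<^sub>R matrix_of_endo f"
  by (simp add: matrix_eq scaleR_endo.rep_eq blinfun.bilinear_simps scaleR_matrix_vector_assoc[symmetric])

lemma matrix_of_endo_one: "matrix_of_endo 1 = mat 1"
  by (simp add: matrix_eq one_endo.rep_eq)

lemma matrix_of_endo_adj: "matrix_of_endo (adj f) = transpose (matrix_of_endo f)"
proof -
  have "adjoint ((*v) (matrix_of_endo f)) = (*v) (transpose (matrix_of_endo f))"
    by (rule adjoint_matrix)
  moreover have "(*v) (matrix_of_endo f) = blinfun_apply (blinfun_of f)" by auto
  ultimately show ?thesis by (simp add: matrix_eq blinfun_adj)
qed

text \<open>E is the exponential of H. One E serves all \<open>C\<close> and \<open>p\<close>, so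
  that two matrices of a pencil can be rescaled simultaneously by different factors.\<close>

lemma infinitesimal_congruence_integrates:
  fixes H :: "real^'n^'n"
  obtains E where "det E > 0"
    "\<And>C p. transpose H ** C + C ** H = p *\<^sub>R C \<Longrightarrow> transpose E ** C ** E = exp p *\<^sub>R C"
proof -
  define h where "h = endo_of_matrix H"
  let ?E = "matrix_of_endo (exp h)"
  \<comment> \<open>As a square, exp h has nonnegative determinant; being invertible, it has a
    positive one. This permits rescaling to determinant 1 later.\<close>
  have "exp (h /\<^sub>R 2) * exp (h /\<^sub>R 2) = exp h"
    using exp_add_commuting[of "h /\<^sub>R 2" "h /\<^sub>R 2"] by (simp flip: scaleR_add_left)
  then have "det ?E = (det (matrix_of_endo (exp (h /\<^sub>R 2))))\<^sup>2"
    by (metis det_mul matrix_of_endo_mult power2_eq_square)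
  moreover have "?E ** matrix_of_endo (exp (- h)) = mat 1"
    by (metis exp_minus_inverse matrix_of_endo_mult matrix_of_endo_one)
  then have "det ?E \<noteq> 0" by (metis det_I det_mul mult_zero_left zero_neq_one)
  ultimately have 1: "det ?E > 0" by simp
  have 2: "transpose ?E ** C ** ?E = exp p *\<^sub>R C"
    if "transpose H ** C + C ** H = p *\<^sub>R C" for C p
  proof -
    let ?c = "endo_of_matrix C"
    have "matrix_of_endo (adj h * ?c + ?c * h) = matrix_of_endo (p *\<^sub>R ?c)"
      using that by (simp add: h_def matrix_of_endo_add matrix_of_endo_mult matrix_of_endo_scaleR
          matrix_of_endo_adj)
    then have "adj h * ?c + ?c * h = p *\<^sub>R ?c" by (metis endo_of_matrix_of_endo)
    from arg_cong[OF exp_congruence[OF this], of matrix_of_endo] show ?thesis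
      by (simp add: matrix_of_endo_mult matrix_of_endo_scaleR matrix_of_endo_adj)
  qed
  from that[OF 1 2] show thesis .
qed

section \<open>Nilpotent matrices and commutators\<close>

lemma matrix_add_rdistrib: "(A + B) ** C = A ** C + B ** C"
  by (vector matrix_matrix_mult_def sum.distrib distrib_right)

lemma matrix_sub_ldistrib: "C ** (A - B) = C ** A - C ** B" for C :: "'a::ring_1^'n^'m"
  by (vector matrix_matrix_mult_def sum_subtractf right_diff_distrib)

lemma matrix_sub_rdistrib: "(A - B) ** C = A ** C - B ** C" for C :: "'a::ring_1^'n^'m"
  by (vector matrix_matrix_mult_def sum_subtractf left_diff_distrib)

primrec matpow :: "'a::semiring_1^'n^'n \<Rightarrow> nat \<Rightarrow> 'a^'n^'n" where
  "matpow M 0 = mat 1"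
| "matpow M (Suc k) = M ** matpow M k"

lemma matpow_commute:
  assumes "M ** Z = Z ** M"
  shows "matpow M k ** Z = Z ** matpow M k"
  by (induction k) (simp_all add: assms flip: matrix_mul_assoc, simp add: assms matrix_mul_assoc)

lemma matpow_mult:
  assumes "M ** Z = Z ** M"
  shows "matpow (M ** Z) k = matpow M k ** matpow Z k"
proof (induction k)
  case (Suc k)
  have "matpow (M ** Z) (Suc k) = M ** (Z ** matpow M k) ** matpow Z k"
    by (simp add: Suc matrix_mul_assoc)
  also have "\<dots> = M ** (matpow M k ** Z) ** matpow Z k"
    by (simp only: matpow_commute[OF assms])
  finally show ?case by (simp add: matrix_mul_assoc)
qed simp

lemma projection_matrix_exists:
  fixes U :: "(real^'n) set"
  assumes "subspace U"
  obtains P :: "real^'n^'n" where "\<And>x. P *v x \<in> U" "\<And>x. x \<in> U \<Longrightarrow> P *v x = x"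
proof -
  obtain B where B: "B \<subseteq> U" "independent B" "U \<subseteq> span B" 
    using basis_exists by metis
  obtain g where g: "linear g" "\<forall>x\<in>B. g x = x" "range g = span ((\<lambda>x. x) ` B)"
    using linear_independent_extend_subspace[OF B(2), of "\<lambda>x. x"] by blast
  have sp: "span B = U" using B assms by (simp add: span_minimal subset_antisym)
  have mg: "matrix g *v x = g x" for x using g(1) by (simp add: matrix_works linear_conv_bounded_linear)
  have "matrix g *v x \<in> U" for x using g(3) mg sp by auto
  moreover have "matrix g *v x = x" if "x \<in> U" for x
    using linear_eq_on_span[OF g(1) linear_ident, of B x] g(2) that mg sp by auto
  ultimately show thesis using that by blast
qed

text \<open>With \<open>P j\<close> a projection onto the range of \<open>W^j\<close>, the trace of \<open>W P j\<close> does not depend on \<open>j\<close>.\<close>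

lemma trace_nilpotent:
  fixes W :: "real^'n^'n"
  assumes "matpow W m = 0"
  shows "trace W = 0"
proof -
  define U where "U j = range ((*v) (matpow W j))" for j
  have sub: "subspace (U j)" for j
    unfolding U_def by (rule linear_subspace_image) auto
  have "\<forall>j. \<exists>P. (\<forall>x. P *v x \<in> U j) \<and> (\<forall>x\<in>U j. P *v x = x)"
    using projection_matrix_exists[OF sub] by metis
  then obtain P where P: "\<And>j x. P j *v x \<in> U j" "\<And>j x. x \<in> U j \<Longrightarrow> P j *v x = x"
    by metis
  have W: "W *v x \<in> U (Suc j)" if "x \<in> U j" for x j
    using that by (auto simp: U_def matrix_vector_mul_assoc)
  have mono: "x \<in> U j" if "x \<in> U (Suc j)" for x j
  proof -
    obtain y where y: "x = matpow W (Suc j) *v y" using \<open>x \<in> U (Suc j)\<close> by (auto simp: U_def)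
    have "matpow W (Suc j) = matpow W j ** W" by (simp add: matpow_commute)
    then have "x = matpow W j *v (W *v y)" using y by (simp add: matrix_vector_mul_assoc)
    then show ?thesis by (auto simp: U_def)
  qed
  have tr: "trace (W ** P j) = trace W" for j
  proof (induction j)
    case 0
    have "P 0 *v x = x" for x by (rule P(2)) (auto simp: U_def)
    then have "P 0 = mat 1" by (simp add: matrix_eq)
    then show ?case by simp
  next
    case (Suc j)
    \<comment> \<open>W maps \<open>U j\<close> into \<open>U (Suc j)\<close>, so
      \<open>P (Suc j)\<close> can be put to the left of \<open>W ** P j\<close>. Since
      \<open>U (Suc j)\<close> lies in \<open>U j\<close>, \<open>P j\<close> can be inserted before
      \<open>P (Suc j)\<close>. Cyclicity of the trace connects the two.\<close>
    have 1: "P (Suc j) ** (W ** P j) = W ** P j"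
      using P(2)[OF W[OF P(1)]] by (simp add: matrix_eq flip: matrix_vector_mul_assoc)
    have 2: "P j ** P (Suc j) = P (Suc j)"
      using P(2)[OF mono[OF P(1)]] by (simp add: matrix_eq flip: matrix_vector_mul_assoc)
    have "trace (W ** P (Suc j)) = trace ((W ** P j) ** P (Suc j))"
      by (simp add: 2 flip: matrix_mul_assoc)
    also have "\<dots> = trace (P (Suc j) ** (W ** P j))" by (rule trace_mul_sym)
    finally show ?case using 1 Suc by simp
  qed
  have "P m *v x = 0" for x using P(1)[of m x] unfolding U_def assms by auto
  then have "P m = 0" by (simp add: matrix_eq)
  then have "W ** P m = 0" by simp
  with tr[of m] have "trace W = trace (0 :: real^'n^'n)" by metis
  then show ?thesis by (simp add: trace_def)
qed

lemma inner_matrix_trace: "inner (A :: real^'n^'m) B = trace (transpose A ** B)"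
  unfolding inner_vec_def trace_def matrix_matrix_mult_def transpose_def
  by (simp, subst sum.swap, simp)

lemma mat_zero [simp]: "mat 0 = (0 :: 'a::zero^'n^'n)"
  by (simp add: mat_def vec_eq_iff)

text \<open>The range of \<open>S \<mapsto> M S - S M\<close> is the orthogonal complement of the kernel of its adjoint, and this kernel
  consists of the transposes of the matrices commuting with \<open>M\<close>.\<close>

lemma commutator_exists:
  fixes M R :: "real^'n^'n"
  assumes "\<And>Z. M ** Z = Z ** M \<Longrightarrow> trace (R ** Z) = 0"
  obtains S where "M ** S - S ** M = R"
proof -
  define f where "f S = M ** S - S ** M" for S
  have "linear f"
    unfolding f_def by (rule linearI) (simp_all add: matrix_add_ldistrib matrix_add_rdistrib 
        scalar_matrix_assoc matrix_scalar_ac scaleR_diff_right)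
  then have sub: "span (range f) = range f"
    by (simp add: linear_subspace_image span_eq_iff)
  obtain y z where yz: "y \<in> span (range f)" "\<And>w. w \<in> span (range f) \<Longrightarrow> orthogonal z w" "R = y + z"
    using orthogonal_subspace_decomp_exists by blast
  define Z where "Z = transpose z"
  define K where "K = Z ** M - M ** Z"
  \<comment> \<open>Cyclicity moves the commutator from S to Z: trace (K S) = trace (Z [M, S]),
    which is 0 by orthogonality. The choice S = K^T then gives |K|^2 = 0, so Z commutes with
    M.\<close>
  have tr: "trace (K ** S) = 0" for S
  proof -
    have "0 = trace (Z ** f S)"
      using yz(2)[of "f S"] sub by (simp add: orthogonal_def inner_matrix_trace Z_def)
    also have "\<dots> = trace (Z ** (M ** S)) - trace ((Z ** S) ** M)"
      by (simp add: f_def matrix_sub_ldistrib trace_sub matrix_mul_assoc)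
    also have "trace ((Z ** S) ** M) = trace (M ** (Z ** S))" by (rule trace_mul_sym)
    finally show ?thesis by (simp add: K_def matrix_sub_rdistrib trace_sub matrix_mul_assoc)
  qed
  have "inner (transpose K) (transpose K) = 0"
    using tr[of "transpose K"] by (simp add: inner_matrix_trace)
  then have "transpose K = 0" by simp
  then have "K = 0" by (metis transpose_transpose transpose_mat mat_zero)
  \<comment> \<open>The hypothesis yields <z, R> = 0, whereas <z, R> = |z|^2 for the orthogonal
    component z of R.\<close>
  then have "trace (R ** Z) = 0" by (intro assms) (simp add: K_def)
  then have "inner z R = 0" unfolding inner_matrix_trace Z_def by (metis trace_mul_sym)
  moreover have "inner z y = 0" using yz by (simp add: orthogonal_def)
  ultimately have "z = 0" using yz(3) by (simp add: inner_right_distrib)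
  moreover obtain S where "y = f S" using yz(1) unfolding sub by blast
  ultimately show thesis using that[of S] yz(3) by (simp add: f_def)
qed

section \<open>Polynomials of a complex matrix and nilpotency\<close>

definition evalm :: "complex^'n^'n \<Rightarrow> complex poly \<Rightarrow> complex^'n^'n" where
  "evalm N p = fold_coeffs (\<lambda>a X. mat a + N ** X) p 0"

lemma mat_plus: "mat (a + b) = mat a + (mat b :: 'a::monoid_add^'n^'n)"
  by (simp add: mat_def vec_eq_iff)

lemma mat_mult_entry: "(mat a ** X) $ i $ j = a * X $ i $ j" for X :: "'a::semiring_1^'n^'n"
  by (simp add: matrix_matrix_mult_def mat_def if_distrib if_distribR cong: if_cong)

lemma mult_mat_entry: "(X ** mat a) $ i $ j = X $ i $ j * a" for X :: "'a::semiring_1^'n^'n"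
  by (simp add: matrix_matrix_mult_def mat_def if_distrib if_distribR cong: if_cong)

lemma mat_commute: "mat a ** X = X ** mat a" for X :: "'a::comm_semiring_1^'n^'n"
  by (simp add: vec_eq_iff mat_mult_entry mult_mat_entry mult.commute)

lemma mat_mult_mat: "mat a ** mat b = (mat (a * b) :: 'a::comm_semiring_1^'n^'n)"
  by (simp add: vec_eq_iff mat_mult_entry) (simp add: mat_def)

lemma evalm_0 [simp]: "evalm N 0 = 0"
  by (simp add: evalm_def)

lemma evalm_pCons [simp]: "evalm N (pCons a p) = mat a + N ** evalm N p"
  by (cases "p = 0"; cases "a = 0") (simp_all add: evalm_def)

lemma evalm_add: "evalm N (p + q) = evalm N p + evalm N q"
  by (induction p q rule: poly_induct2) (simp_all add: mat_plus matrix_add_ldistrib algebra_simps)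

lemma evalm_smult: "evalm N (smult c p) = mat c ** evalm N p"
proof (induction p)
  case (pCons a p)
  have "N ** (mat c ** X) = mat c ** (N ** X)" for X
    by (metis mat_commute matrix_mul_assoc)
  with pCons show ?case by (simp add: matrix_add_ldistrib mat_mult_mat)
qed simp

lemma evalm_linear_factor: "evalm N ([:-z, 1:] * q) = (N - mat z) ** evalm N q"
proof -
  have 1: "[:-z, 1:] * q = pCons 0 q + smult (- z) q" by simp
  have "mat (- z) ** X = - (mat z ** X)" for X :: "complex^'n^'n"
    by (simp add: vec_eq_iff mat_mult_entry)
  then show ?thesis
    unfolding 1 evalm_add evalm_smult by (simp add: matrix_sub_rdistrib)
qed

lemma evalm_monom: "evalm N (monom c i) = mat c ** matpow N i"
proof (induction i)
  case (Suc i)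
  have "N ** (mat c ** X) = mat c ** (N ** X)" for X
    by (metis mat_commute matrix_mul_assoc)
  with Suc show ?case by (simp add: monom_Suc)
qed (simp add: monom_0)

lemma evalm_sum: "evalm N (sum p I) = (\<Sum>i\<in>I. evalm N (p i))"
  by (induction I rule: infinite_finite_induct) (simp_all add: evalm_add)

text \<open>More powers of N than the real dimension of the matrix space are linearly dependent.
  Coinciding powers form a case of their own because dependence is a property of the set of powers;
  there a difference of two monomials annihilates N.\<close>

lemma annihilating_poly_exists:
  fixes N :: "complex^'n^'n"
  obtains p where "p \<noteq> 0" "evalm N p = 0"
proof -
  define D where "D = DIM(complex^'n^'n)"
  show thesis
  proof (cases "inj_on (matpow N) {..D}")
    case False
    then obtain i j where ij: "i \<noteq> j" "matpow N i = matpow N j" by (auto simp: inj_on_def)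
    define p :: "complex poly" where "p = monom 1 i + smult (- 1) (monom 1 j)"
    have "coeff p i = 1" using ij by (simp add: p_def)
    then have "p \<noteq> 0" by auto
    moreover have "mat (- 1) = - (mat 1 :: complex^'n^'n)" by (simp add: mat_def vec_eq_iff)
    then have "evalm N p = 0"
      using ij unfolding p_def evalm_add evalm_smult evalm_monom 
      by (simp add: vec_eq_iff mat_mult_entry)
    ultimately show ?thesis using that by blast
  next
    case True
    then have "card (matpow N ` {..D}) > DIM(complex^'n^'n)"
      by (simp add: card_image D_def)
    then have "dependent (matpow N ` {..D})" by (intro dependent_biggerset) auto
    then obtain u where u: "\<exists>v\<in>matpow N ` {..D}. u v \<noteq> 0"
        "(\<Sum>v\<in>matpow N ` {..D}. u v *\<^sub>R v) = 0"
      by (subst (asm) dependent_finite) auto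
    define p where "p = (\<Sum>i\<le>D. monom (complex_of_real (u (matpow N i))) i)"
    obtain i where i: "i \<le> D" "u (matpow N i) \<noteq> 0" using u(1) by auto
    have "coeff p i = u (matpow N i)" using i(1) by (simp add: p_def coeff_sum)
    then have "p \<noteq> 0" using i(2) by auto
    moreover have "mat (complex_of_real r) ** X = r *\<^sub>R X" for r and X :: "complex^'n^'n"
      by (simp add: vec_eq_iff mat_mult_entry scaleR_conv_of_real[where 'a=complex])
    then have "evalm N p = (\<Sum>i\<le>D. u (matpow N i) *\<^sub>R matpow N i)"
      by (simp add: p_def evalm_sum evalm_monom)
    then have "evalm N p = 0" using u(2) True by (simp add: sum.reindex)
    ultimately show ?thesis using that by blast
  qed
qed

text \<open>Strip linear factors off an annihilating polynomial: factors at \<open>a\<close> or \<open>b\<close> are absorbed into powers of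
  \<open>R\<close>, all others are invertible.\<close>

lemma nilpotent_of_spectrum:
  fixes N :: "complex^'n^'n" and a b :: complex
  defines "R \<equiv> (N - mat a) ** (N - mat b)"
  assumes "\<And>z. z \<noteq> a \<Longrightarrow> z \<noteq> b \<Longrightarrow> invertible (N - mat z)"
  obtains m where "matpow R m = 0"
proof -
  have com: "(N - mat z) ** (N - mat w) = (N - mat w) ** (N - mat z)" for z w
    by (simp add: matrix_sub_rdistrib matrix_sub_ldistrib mat_commute[of _ N] mat_mult_mat mult.commute)
  have comR: "(N - mat z) ** R = R ** (N - mat z)" for z
    unfolding R_def by (metis com matrix_mul_assoc)
  \<comment> \<open>The invariant of the induction is R^j p(N) = 0. Once p is a nonzero constant,
    R^j itself vanishes.\<close>
  have *: "\<exists>m. matpow R m = 0" if "p \<noteq> 0" "matpow R j ** evalm N p = 0" for p j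
    using that
  proof (induction "degree p" arbitrary: p j rule: less_induct)
    case less
    show ?case
    proof (cases "degree p = 0")
      case True
      then obtain c where c: "p = [:c:]" by (auto elim: degree_eq_zeroE)
      then have "matpow R j ** mat c = 0" using less.prems by simp
      then have "matpow R j = 0" using c less.prems by (auto simp: vec_eq_iff mult_mat_entry)
      then show ?thesis by blast
    next
      case False
      then obtain z where "poly p z = 0"
        using fundamental_theorem_of_algebra[of p] unfolding constant_degree by blast
      then obtain q where q: "p = [:-z, 1:] * q" by (auto simp: poly_eq_0_iff_dvd)
      have q0: "q \<noteq> 0" using q less.prems(1) by auto
      then have dq: "degree q < degree p"
        using degree_mult_eq[of "[:-z, 1:]" q] by (simp add: q del: mult_pCons_left)
      have comj: "matpow R j ** (N - mat z) = (N - mat z) ** matpow R j"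
        by (rule matpow_commute) (simp add: comR)
      have 0: "(N - mat z) ** (matpow R j ** evalm N q) = 0"
        using less.prems(2) unfolding q evalm_linear_factor
        by (simp only: matrix_mul_assoc comj)
      show ?thesis
      proof (cases "z = a \<or> z = b")
        case True
        \<comment> \<open>Here w is the other one of a and b: multiplying by
          \<open>N - mat w\<close> completes the stripped factor to a further R, which raises j by
          one.\<close>
        then obtain w where w: "R = (N - mat w) ** (N - mat z)"
          unfolding R_def using com by blast
        have "matpow R (Suc j) ** evalm N q = (N - mat w) ** ((N - mat z) ** (matpow R j ** evalm N q))"
          by (simp add: w matrix_mul_assoc)
        then show ?thesis using less.hyps[OF dq q0, of "Suc j"] 0 by simp
      next
        case False
        then obtain V where V: "V ** (N - mat z) = mat 1" 
          using assms(2)[of z] by (auto simp: invertible_def)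
        have "matpow R j ** evalm N q = V ** ((N - mat z) ** (matpow R j ** evalm N q))"
          by (simp add: V matrix_mul_assoc)
        then show ?thesis using less.hyps[OF dq q0, of j] 0 by simp
      qed
    qed
  qed
  obtain p where "p \<noteq> 0" "evalm N p = 0" by (rule annihilating_poly_exists)
  with *[of p 0] that show thesis by auto
qed

section \<open>The hyperbolic action on a pencil with two real eigenvalues\<close>

definition cmat :: "real^'n^'m \<Rightarrow> complex^'n^'m" where
  "cmat M = (\<chi> i j. complex_of_real (M $ i $ j))"

lemma cmat_mult: "cmat (X ** Y) = cmat X ** cmat Y"
  by (simp add: cmat_def matrix_matrix_mult_def vec_eq_iff)

lemma cmat_diff: "cmat (X - Y) = cmat X - cmat Y"
  by (simp add: cmat_def vec_eq_iff)

lemma cmat_mat: "cmat (mat x) = mat (complex_of_real x)"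
  by (simp add: cmat_def mat_def vec_eq_iff)

lemma cmat_matpow: "cmat (matpow X m) = matpow (cmat X) m"
  by (induction m) (simp_all add: cmat_mult cmat_mat)

lemma cmat_eq_0: "cmat X = 0 \<longleftrightarrow> X = 0"
  by (simp add: cmat_def vec_eq_iff)

lemma pencil_factor:
  assumes "B ** M = A"
  shows "pencil A B z = cmat B ** (cmat M - mat z)"
proof -
  have "pencil A B z = cmat A - mat z ** cmat B"
    by (simp add: pencil_def vec_eq_iff mat_mult_entry) (simp add: cmat_def)
  then show ?thesis
    by (simp add: matrix_sub_ldistrib mat_commute flip: cmat_mult assms)
qed

lemma det_smult_rows: "det (\<chi> i j. c * A $ i $ j) = c ^ CARD('n) * det A" for A :: "'a::comm_ring_1^'n^'n"
proof -
  have "(\<chi> i j. c * A $ i $ j) = (\<chi> i. c *s A $ i)" by (simp add: vec_eq_iff)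
  then show ?thesis using det_rows_mul[of "\<lambda>_. c" "\<lambda>i. A $ i"] by simp
qed

lemma det_scaleR: "det (c *\<^sub>R A) = c ^ CARD('n) * det A" for A :: "real^'n^'n"
proof -
  have "c *\<^sub>R A = (\<chi> i j. c * A $ i $ j)" by (simp add: vec_eq_iff)
  then show ?thesis by (simp only: det_smult_rows)
qed

lemma transpose_add: "transpose (X + Y) = transpose X + transpose Y"
  by (simp add: transpose_def vec_eq_iff)

lemma transpose_diff: "transpose (X - Y) = transpose X - transpose Y"
  by (simp add: transpose_def vec_eq_iff)

text \<open>The hypothesis concerns complex numbers, so nilpotency is obtained for the complexified
  matrix. Complexification is multiplicative and injective, which brings it back to
  \<open>M\<close>.\<close>

lemma nilpotent_of_real_spectrum:
  fixes A B M :: "real^'n^'n"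
  assumes "B ** M = A" "invertible B"
    and spec: "\<And>z. z \<noteq> complex_of_real a \<Longrightarrow> z \<noteq> complex_of_real b \<Longrightarrow> invertible (pencil A B z)"
  obtains m where "matpow ((M - mat a) ** (M - mat b)) m = 0"
proof -
  have "invertible (cmat M - mat z)" if "z \<noteq> complex_of_real a" "z \<noteq> complex_of_real b" for z
    using spec[OF that] unfolding pencil_factor[OF assms(1)] invertible_det_nz det_mul by simp
  then obtain m where "matpow ((cmat M - mat a) ** (cmat M - mat b)) m = 0"
    by (rule nilpotent_of_spectrum)
  then have "cmat (matpow ((M - mat a) ** (M - mat b)) m) = 0"
    by (simp add: cmat_matpow cmat_mult cmat_diff cmat_mat)
  then show thesis using that by (simp add: cmat_eq_0)
qed

text \<open>With \<open>M = B\<^sup>-\<^sup>1 A\<close>, \<open>[M, S] = (M - a) (M - b)\<close> and \<open>T\<close> the adjoint of \<open>S\<close> with respect to \<open>B\<close>, take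
  \<open>H = (S - T - M) / 2\<close>.\<close>

lemma infinitesimal_scaling_exists:
  fixes A B :: "real^'n^'n"
  assumes sym: "transpose A = A" "transpose B = B" and inv: "invertible B"
    and spec: "\<And>z. z \<noteq> complex_of_real a \<Longrightarrow> z \<noteq> complex_of_real b \<Longrightarrow> invertible (pencil A B z)"
  obtains H where "transpose H ** B + B ** H = - A"
    "transpose H ** A + A ** H = (a * b) *\<^sub>R B - (a + b) *\<^sub>R A"
proof -
  obtain B' where B': "B ** B' = mat 1" "B' ** B = mat 1" using inv by (auto simp: invertible_def)
  define M where "M = B' ** A"
  have BM: "B ** M = A" by (simp add: M_def matrix_mul_assoc B')
  have MB: "transpose M ** B = A" 
    using arg_cong[OF BM, of transpose] by (simp add: matrix_transpose_mul sym)
  define R where "R = (M - mat a) ** (M - mat b)"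
  have smat: "mat x ** X = x *\<^sub>R X" "X ** mat x = x *\<^sub>R X" for x and X :: "real^'n^'n"
    by (simp_all add: vec_eq_iff mat_mult_entry mult_mat_entry mult.commute)
  have R: "R = M ** M - (a + b) *\<^sub>R M + mat (a * b)"
  proof -
    have "x *\<^sub>R mat y = (mat (x * y) :: real^'n^'n)" for x y
      by (simp add: vec_eq_iff mat_def)
    then show ?thesis
      by (simp add: R_def matrix_sub_rdistrib matrix_sub_ldistrib smat algebra_simps)
  qed
  obtain m where m: "matpow R m = 0"
    unfolding R_def using nilpotent_of_real_spectrum[OF BM inv spec] by blast
  have "trace (R ** Z) = 0" if "M ** Z = Z ** M" for Z
  proof -
    have "M ** (M ** Z) = Z ** (M ** M)" using that by (metis matrix_mul_assoc)
    then have "R ** Z = Z ** R"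
      by (simp add: R matrix_sub_rdistrib matrix_sub_ldistrib matrix_add_rdistrib matrix_add_ldistrib
          smat that matrix_scalar_ac matrix_mul_assoc[symmetric] flip: scalar_matrix_assoc)
    then have "matpow (R ** Z) m = 0" using m by (simp add: matpow_mult)
    then show ?thesis by (rule trace_nilpotent)
  qed
  then obtain S where S: "M ** S - S ** M = R" by (rule commutator_exists)
  define T where "T = B' ** transpose S ** B"
  have BT: "B ** T = transpose S ** B" by (simp add: T_def matrix_mul_assoc B')
  have TB: "transpose T ** B = B ** S"
    using arg_cong[OF BT, of transpose] by (simp add: matrix_transpose_mul sym)
  define H where "H = (1/2) *\<^sub>R (S - T - M)"
  have AS: "A ** S = B ** (M ** S)" by (simp add: BM matrix_mul_assoc)
  have AM: "A ** M = transpose M ** A" by (metis BM MB matrix_mul_assoc)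
  have AT: "A ** T = transpose M ** (transpose S ** B)" by (metis BT MB matrix_mul_assoc)
  have TA: "transpose T ** A = B ** (S ** M)" by (metis BM TB matrix_mul_assoc)
  have SA: "transpose S ** A = (transpose S ** transpose M) ** B" by (metis MB matrix_mul_assoc)
  have tH: "transpose H = (1/2) *\<^sub>R (transpose S - transpose T - transpose M)"
    by (simp add: H_def transpose_diff transpose_scalar)
  have BR: "B ** R = A ** M - (a + b) *\<^sub>R A + (a * b) *\<^sub>R B"
    by (simp add: R matrix_sub_ldistrib matrix_add_ldistrib smat matrix_scalar_ac matrix_mul_assoc BM
        flip: scalar_matrix_assoc)
  have "transpose (A ** M) = A ** M" by (simp add: matrix_transpose_mul sym AM)
  \<comment> \<open>\<open>B ** R\<close> is a combination of the symmetric matrices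
    \<open>A ** M\<close>, A and B. Hence R is self-adjoint for B, and the terms R^T B and B R below
    add up to 2 B R.\<close>
  then have tBR: "transpose (B ** R) = B ** R"
    unfolding BR by (simp add: transpose_diff transpose_add transpose_scalar sym)
  have RB: "transpose R ** B = B ** R" using tBR by (simp add: matrix_transpose_mul sym)
  show thesis
  proof (rule that)
    have 1: "transpose H ** B = (1/2) *\<^sub>R (transpose S ** B - B ** S - A)"
      unfolding tH by (simp add: matrix_sub_rdistrib MB TB flip: scalar_matrix_assoc)
    have 2: "B ** H = (1/2) *\<^sub>R (B ** S - transpose S ** B - A)"
      unfolding H_def
      by (simp add: matrix_scalar_ac matrix_sub_ldistrib BM BT scaleR_diff_right flip: scalar_matrix_assoc)
    have "transpose H ** B + B ** H = (1/2) *\<^sub>R ((- 2) *\<^sub>R A)"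
      unfolding 1 2 scaleR_add_right[symmetric]
      by (rule arg_cong[where f="scaleR _"]) (simp add: scaleR_2)
    then show "transpose H ** B + B ** H = - A" by simp
    have "transpose H ** A + A ** H = (1/2) *\<^sub>R (transpose S ** A - transpose T ** A - transpose M ** A
        + (A ** S - A ** T - A ** M))"
      unfolding tH unfolding H_def
      by (simp add: matrix_scalar_ac matrix_sub_rdistrib matrix_sub_ldistrib
          scaleR_add_right scaleR_diff_right flip: scalar_matrix_assoc)
    also have "transpose S ** A - transpose T ** A - transpose M ** A + (A ** S - A ** T - A ** M)
      = transpose R ** B + B ** R - 2 *\<^sub>R (A ** M)"
      unfolding S[symmetric] transpose_diff matrix_transpose_mul matrix_sub_rdistrib matrix_sub_ldistrib
        AS AT TA SA AM by (simp add: matrix_mul_assoc scaleR_2 algebra_simps)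
    also have "\<dots> = 2 *\<^sub>R ((a * b) *\<^sub>R B - (a + b) *\<^sub>R A)"
      unfolding RB BR by (simp add: vec_eq_iff algebra_simps)
    finally show "transpose H ** A + A ** H = (a * b) *\<^sub>R B - (a + b) *\<^sub>R A" by simp
  qed
qed

text \<open>By the equations for H, A - a B and A - b B are eigenvectors of the infinitesimal
  congruence, with eigenvalues -b and -a. These differ, so the flow attains every positive ratio t
  of scaling factors.\<close>

lemma hyperbolic_action_exists:
  fixes A B :: "real^'n^'n"
  assumes sym: "transpose A = A" "transpose B = B" and inv: "invertible B" and ab: "a \<noteq> b"
    and spec: "\<And>z. z \<noteq> complex_of_real a \<Longrightarrow> z \<noteq> complex_of_real b \<Longrightarrow> invertible (pencil A B z)"
    and t: "t > 0"
  obtains g q where "g \<in> SL" "q > 0" "act_normal g (A - a *\<^sub>R B) = (t * q) *\<^sub>R (A - a *\<^sub>R B)"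
    "act_normal g (A - b *\<^sub>R B) = q *\<^sub>R (A - b *\<^sub>R B)"
proof -
  obtain H where H: "transpose H ** B + B ** H = - A"
    "transpose H ** A + A ** H = (a * b) *\<^sub>R B - (a + b) *\<^sub>R A"
    using infinitesimal_scaling_exists[OF sym inv spec] by blast
  \<comment> \<open>The time at which the factors exp (- s b) and exp (- s a) have ratio t.\<close>
  define s where "s = ln t / (a - b)"
  obtain E where E: "det E > 0" "\<And>C p. transpose (s *\<^sub>R H) ** C + C ** (s *\<^sub>R H) = p *\<^sub>R C \<Longrightarrow>
      transpose E ** C ** E = exp p *\<^sub>R C"
    using infinitesimal_congruence_integrates[of "s *\<^sub>R H"] by blast
  have lin: "transpose H ** (A - x *\<^sub>R B) + (A - x *\<^sub>R B) ** H =
     (transpose H ** A + A ** H) - x *\<^sub>R (transpose H ** B + B ** H)" for x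
    by (simp add: matrix_sub_ldistrib matrix_sub_rdistrib matrix_scalar_ac scaleR_add_right
        flip: scalar_matrix_assoc)
  have s: "transpose (s *\<^sub>R H) ** C + C ** (s *\<^sub>R H) = (s * p) *\<^sub>R C"
    if "transpose H ** C + C ** H = p *\<^sub>R C" for C p
    using arg_cong[OF that, of "scaleR s"]
    by (simp add: transpose_scalar matrix_scalar_ac scaleR_add_right flip: scalar_matrix_assoc)
  have "transpose H ** (A - a *\<^sub>R B) + (A - a *\<^sub>R B) ** H = (- b) *\<^sub>R (A - a *\<^sub>R B)"
    unfolding lin H by (simp add: algebra_simps)
  note Ea = E(2)[OF s[OF this]]
  have "transpose H ** (A - b *\<^sub>R B) + (A - b *\<^sub>R B) ** H = (- a) *\<^sub>R (A - b *\<^sub>R B)"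
    unfolding lin H by (simp add: algebra_simps)
  note Eb = E(2)[OF s[OF this]]
  define n where "n = CARD('n)"
  have n: "n > 0" by (simp add: n_def)
  \<comment> \<open>Scaling E by c normalizes the determinant to 1. Both factors get multiplied by
    c^2, which goes into q.\<close>
  define c where "c = root n (inverse (det E))"
  have c: "c > 0" "c ^ n = inverse (det E)" using E(1) n by (simp_all add: c_def)
  define F where "F = transpose (c *\<^sub>R E)"
  have detF: "det F = 1"
    using c E(1) by (simp add: F_def det_transpose det_scaleR n_def)
  then have FSL: "F \<in> SL" by (simp add: SL_def)
  \<comment> \<open>\<open>act_normal\<close> has the inverse of g on the left and its transpose on
    the right, whereas the flow has E^T on the left; so g inverts the transposed matrix.\<close>
  define g where "g = matrix_inv F"
  have gSL: "g \<in> SL" using FSL SL_matrix_inv by (simp add: g_def)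
  have "matrix_inv g = F"
    using SL_inv[OF FSL] SL_inv[OF gSL] unfolding g_def by (metis matrix_mul_assoc matrix_mul_lid matrix_mul_rid)
  then have ag: "act_normal g C = c\<^sup>2 *\<^sub>R (transpose E ** C ** E)" for C
    by (simp add: act_normal_def F_def transpose_scalar matrix_scalar_ac power2_eq_square
        flip: scalar_matrix_assoc)
  define q where "q = c\<^sup>2 * exp (s * - a)"
  have "t = exp (s * (a - b))" using t ab by (simp add: s_def)
  then have tq: "c\<^sup>2 * exp (s * - b) = t * q" by (simp add: q_def algebra_simps flip: exp_add)
  show thesis
  proof (rule that[OF gSL])
    show "q > 0" using c by (simp add: q_def)
    show "act_normal g (A - a *\<^sub>R B) = (t * q) *\<^sub>R (A - a *\<^sub>R B)" 
      unfolding ag Ea by (simp only: scaleR_scaleR tq)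
    show "act_normal g (A - b *\<^sub>R B) = q *\<^sub>R (A - b *\<^sub>R B)" 
      unfolding ag Eb by (simp only: scaleR_scaleR q_def)
  qed
qed

section \<open>Angles on a hyperbolic plane\<close>

lemma trace_mult_lincomb:
  "trace (X ** (a *\<^sub>R A + b *\<^sub>R B)) = a * trace (X ** A) + b * trace (X ** B)"
  for X :: "real^'n^'n"
  by (simp add: trace_def matrix_matrix_mult_def sum.distrib sum_distrib_left algebra_simps)

lemma trace_lincomb_mult:
  "trace ((a *\<^sub>R A + b *\<^sub>R B) ** X) = a * trace (A ** X) + b * trace (B ** X)"
  for X :: "real^'n^'n"
  by (simp add: trace_def matrix_matrix_mult_def sum.distrib sum_distrib_left algebra_simps)

lemma Sym_lincomb: "A \<in> Sym \<Longrightarrow> B \<in> Sym \<Longrightarrow> a *\<^sub>R A + b *\<^sub>R B \<in> Sym"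
  by (simp add: Sym_def transpose_def vec_eq_iff)

section \<open>Positive definite matrices and normal vectors\<close>

definition posdef :: "real^'n^'n \<Rightarrow> bool" where
  "posdef X \<longleftrightarrow> (\<forall>v. v \<noteq> 0 \<longrightarrow> v \<bullet> (X *v v) > 0)"

lemma posdef_convex:
  fixes X Y :: "real^'n^'n"
  assumes "posdef X" "posdef Y" "0 \<le> s" "s \<le> 1"
  shows "posdef ((1 - s) *\<^sub>R X + s *\<^sub>R Y)"
  unfolding posdef_def
proof (intro allI impI)
  fix v :: "real^'n" assume "v \<noteq> 0"
  then have p: "v \<bullet> (X *v v) > 0" "v \<bullet> (Y *v v) > 0" using assms by (auto simp: posdef_def)
  have "v \<bullet> (((1 - s) *\<^sub>R X + s *\<^sub>R Y) *v v) = (1 - s) * (v \<bullet> (X *v v)) + s * (v \<bullet> (Y *v v))"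
    by (simp add: matrix_vector_mult_add_rdistrib scaleR_matrix_vector_assoc[symmetric] inner_add_right)
  also have "\<dots> > 0"
  proof (cases "s = 0")
    case False
    then show ?thesis using p assms(3,4) by (intro add_nonneg_pos) auto
  qed (use p in simp)
  finally show "v \<bullet> (((1 - s) *\<^sub>R X + s *\<^sub>R Y) *v v) > 0" .
qed

lemma posdef_det_nz:
  assumes "posdef X" shows "det X \<noteq> 0"
proof
  assume "det X = 0"
  then have "\<not> invertible X" by (simp add: invertible_det_nz)
  then obtain v where "X *v v = 0" "v \<noteq> 0"
    by (metis invertible_left_inverse matrix_left_invertible_ker)
  then show False using assms by (force simp: posdef_def)
qed

text \<open>On the segment from the identity to X all matrices are positive definite, so the
  determinant never vanishes there and keeps its sign.\<close>

lemma posdef_det_pos: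
  fixes X :: "real^'n^'n"
  assumes "posdef X" shows "det X > 0"
proof (rule ccontr)
  assume "\<not> det X > 0"
  define f where "f s = det ((1 - s) *\<^sub>R mat 1 + s *\<^sub>R X)" for s :: real
  have "continuous_on {0..1} f"
    unfolding f_def det_def by (intro continuous_intros)
  moreover have "f 1 \<le> 0" "0 \<le> f 0" using \<open>\<not> det X > 0\<close> by (simp_all add: f_def)
  ultimately obtain s where s: "0 \<le> s" "s \<le> 1" "f s = 0"
    using IVT2'[of f 1 0 0] by auto
  have "posdef (mat 1 :: real^'n^'n)" by (simp add: posdef_def)
  from posdef_det_nz[OF posdef_convex[OF this assms s(1,2)]] show False using s(3) by (simp add: f_def)
qed

lemma PD_posdef: "X \<in> PD \<longleftrightarrow> X \<in> Sym \<and> posdef X \<and> det X = 1"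
  by (auto simp: PD_def posdef_def)

text \<open>Positive definite matrices form a convex cone, on which a linear functional without zeros
  cannot change sign.\<close>

lemma not_normal_sign:
  fixes C :: "real^'n^'n"
  assumes "C \<in> Sym" "C \<noteq> 0" "\<not> is_normal C"
  shows "(\<forall>X\<in>PD. trace (X ** C) > 0) \<or> (\<forall>X\<in>PD. trace (X ** C) < 0)"
proof (rule ccontr)
  have nz: "trace (X ** C) \<noteq> 0" if "X \<in> PD" for X
    using assms that by (auto simp: is_normal_def perp_def)
  assume "\<not> ?thesis"
  then obtain X Y where XY: "X \<in> PD" "trace (X ** C) < 0" "Y \<in> PD" "trace (Y ** C) > 0"
    using nz by (metis linorder_neqE_linordered_idom)
  define p q where "p = trace (X ** C)" and "q = trace (Y ** C)"
  \<comment> \<open>The zero of the affine function (1 - s) p + s q, which has opposite signs at 0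
    and 1.\<close>
  define s where "s = p / (p - q)"
  have pq: "p < 0" "q > 0" using XY by (auto simp: p_def q_def)
  then have s: "0 \<le> s" "s \<le> 1" by (auto simp: s_def field_simps)
  define Z where "Z = (1 - s) *\<^sub>R X + s *\<^sub>R Y"
  have Z: "posdef Z" "Z \<in> Sym"
    using XY s posdef_convex Sym_lincomb unfolding Z_def PD_posdef by blast+
  have "(1 - s) * p + s * q = 0" using pq by (simp add: s_def field_simps)
  then have tZ: "trace (Z ** C) = 0" unfolding Z_def trace_lincomb_mult p_def q_def .
  define n where "n = CARD('n)"
  have n: "n > 0" by (simp add: n_def)
  have dZ: "det Z > 0" using Z(1) by (rule posdef_det_pos)
  define c where "c = root n (inverse (det Z))"
  have c: "c > 0" "c ^ n = inverse (det Z)" using dZ n by (simp_all add: c_def)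
  have "c *\<^sub>R Z \<in> PD"
  proof -
    have "det (c *\<^sub>R Z) = 1" using c dZ by (simp add: det_scaleR n_def)
    moreover have "posdef (c *\<^sub>R Z)" using Z(1) c(1) 
      by (simp add: posdef_def scaleR_matrix_vector_assoc[symmetric])
    moreover have "c *\<^sub>R Z \<in> Sym" using Sym_lincomb[OF Z(2) Z(2), of c 0] by simp
    ultimately show ?thesis by (simp add: PD_posdef)
  qed
  moreover have "trace (c *\<^sub>R Z ** C) = 0"
    using trace_lincomb_mult[of c Z 0 0 C] tZ by simp
  ultimately show False using nz by blast
qed

lemma is_normal_zero: "is_normal B \<Longrightarrow> \<exists>X\<in>PD. trace (X ** B) = 0"
  by (auto simp: is_normal_def perp_def)

text \<open>If a A + b B fails, its trace functional has constant sign on P(n). Testing it at X with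
  tr (X A) = 0 and at Y with tr (Y B) = 0 shows that tr (X B) and tr (Y A) have equal signs. A
  failing combination of - A and B shows in the same way that the signs are opposite.\<close>

lemma combinations_normal:
  fixes A B :: "real^'n^'n"
  assumes N: "is_normal A" "is_normal B" and ind: "\<And>x y. x *\<^sub>R A + y *\<^sub>R B = 0 \<Longrightarrow> x = 0 \<and> y = 0"
  shows "(\<forall>a>0. \<forall>b>0. is_normal (a *\<^sub>R A + b *\<^sub>R B)) \<or>
         (\<forall>a>0. \<forall>b>0. is_normal (a *\<^sub>R (- A) + b *\<^sub>R B))"
proof (rule ccontr)
  assume "\<not> ?thesis"
  then obtain a b a' b' where p: "a > 0" "b > 0" "a' > 0" "b' > 0"
    and n: "\<not> is_normal (a *\<^sub>R A + b *\<^sub>R B)" "\<not> is_normal ((- a') *\<^sub>R A + b' *\<^sub>R B)"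
    by auto
  have S: "A \<in> Sym" "B \<in> Sym" using N by (auto simp: is_normal_def)
  have nz: "a *\<^sub>R A + b *\<^sub>R B \<noteq> 0" "(- a') *\<^sub>R A + b' *\<^sub>R B \<noteq> 0"
    using ind[of a b] ind[of "- a'" b'] p by auto
  note s1 = not_normal_sign[OF Sym_lincomb[OF S] nz(1) n(1), unfolded trace_mult_lincomb]
  note s2 = not_normal_sign[OF Sym_lincomb[OF S] nz(2) n(2), unfolded trace_mult_lincomb]
  obtain X where X: "X \<in> PD" "trace (X ** A) = 0" using N(1) is_normal_zero by blast
  obtain Y where Y: "Y \<in> PD" "trace (Y ** B) = 0" using N(2) is_normal_zero by blast
  let ?x = "trace (X ** B)" and ?y = "trace (Y ** A)"
  have "(b * ?x > 0 \<and> a * ?y > 0) \<or> (b * ?x < 0 \<and> a * ?y < 0)"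
    using s1
  proof
    assume *: "\<forall>X\<in>PD. 0 < a * trace (X ** A) + b * trace (X ** B)"
    show ?thesis using bspec[OF * X(1)] bspec[OF * Y(1)] X(2) Y(2) by simp
  next
    assume *: "\<forall>X\<in>PD. a * trace (X ** A) + b * trace (X ** B) < 0"
    show ?thesis using bspec[OF * X(1)] bspec[OF * Y(1)] X(2) Y(2) by simp
  qed
  moreover have "(b' * ?x > 0 \<and> - a' * ?y > 0) \<or> (b' * ?x < 0 \<and> - a' * ?y < 0)"
    using s2
  proof
    assume *: "\<forall>X\<in>PD. 0 < - a' * trace (X ** A) + b' * trace (X ** B)"
    show ?thesis using bspec[OF * X(1)] bspec[OF * Y(1)] X(2) Y(2) by simp
  next
    assume *: "\<forall>X\<in>PD. - a' * trace (X ** A) + b' * trace (X ** B) < 0"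
    show ?thesis using bspec[OF * X(1)] bspec[OF * Y(1)] X(2) Y(2) by simp
  qed
  ultimately show False using p by (auto simp: zero_less_mult_iff mult_less_0_iff)
qed

lemma is_normal_scaleR:
  assumes "is_normal A" "c > 0" shows "is_normal (c *\<^sub>R A)"
proof -
  have "perp (c *\<^sub>R A) = perp A" using arg_cong[OF cohyp_scale[OF assms(2), of A], of fst]
    by (simp add: cohyp_def)
  then show ?thesis using assms Sym_lincomb[of A A c 0] by (auto simp: is_normal_def)
qed

lemma is_normal_iff_cohyps: "is_normal A \<longleftrightarrow> cohyp A \<in> cohyps"
  using cohyp_eqD is_normal_scaleR unfolding cohyps_def by blast

lemma lies_between_cohyp:
  assumes "is_normal (a *\<^sub>R A + b *\<^sub>R B)" "a > 0" "b > 0"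
  shows "lies_between (cohyp (a *\<^sub>R A + b *\<^sub>R B)) (cohyp A) (cohyp B)"
proof -
  have m: "M \<in> normals (cohyp M)" for M :: "real^'n^'n"
    unfolding normals_def cohyp_def by (simp, rule exI[of _ 1]) simp
  show ?thesis unfolding lies_between_def using assms m is_normal_iff_cohyps by blast
qed

lemma lies_between_cohypD:
  fixes A B :: "real^'n^'n"
  assumes "lies_between \<tau> (cohyp A) (cohyp B)"
  obtains a b where "a > 0" "b > 0" "is_normal (a *\<^sub>R A + b *\<^sub>R B)"
    "\<tau> = cohyp (a *\<^sub>R A + b *\<^sub>R B)"
proof -
  obtain C where C: "\<tau> = cohyp C" "is_normal C"
    using assms by (auto simp: lies_between_def cohyps_def)
  obtain p q where "p \<in> normals (cohyp A)" "q \<in> normals (cohyp B)"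
      "\<exists>a>0. \<exists>b>0. a *\<^sub>R p + b *\<^sub>R q \<in> normals (cohyp C)"
    using assms C by (auto simp: lies_between_def)
  then obtain a b x y z where p: "a > 0" "b > 0" "x > 0" "y > 0" "z > 0" 
    and e: "a *\<^sub>R x *\<^sub>R A + b *\<^sub>R y *\<^sub>R B = z *\<^sub>R C"
    by (auto simp: normals_def cohyp_def)
  have "C = inverse z *\<^sub>R (z *\<^sub>R C)" using p by simp
  also have "\<dots> = (a * x / z) *\<^sub>R A + (b * y / z) *\<^sub>R B"
    unfolding e[symmetric] by (simp add: scaleR_add_right divide_inverse mult.commute)
  finally have "C = (a * x / z) *\<^sub>R A + (b * y / z) *\<^sub>R B" .
  then show thesis using that[of "a * x / z" "b * y / z"] p C by simp
qed

lemma act_normal_lincomb: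
  "act_normal g (x *\<^sub>R A + y *\<^sub>R B) = x *\<^sub>R act_normal g A + y *\<^sub>R act_normal g B"
proof -
  have "act_normal g (A + B) = act_normal g A + act_normal g B" for A B
    by (simp add: act_normal_def matrix_add_ldistrib) 
      (simp add: matrix_matrix_mult_def vec_eq_iff sum.distrib algebra_simps)
  then show ?thesis by (simp add: act_normal_scaleR)
qed

text \<open>In the application X and Y are A - a B and A - b B. They may fail to be normal vectors
  themselves, so membership in \<open>cohyps\<close> is asked of individual rays. On rays only the
  relative stretch t is visible, not q.\<close>

locale angle_on_hyperbolic_plane =
  fixes D :: "('n::finite cohyp \<times> 'n cohyp) set" and \<theta> and X Y :: "real^'n^'n"
  assumes angle: "invariant_angle_function D \<theta>"
    and indep: "x *\<^sub>R X + y *\<^sub>R Y = 0 \<Longrightarrow> x = 0 \<and> y = 0"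
    and action: "t > 0 \<Longrightarrow> \<exists>g\<in>SL. \<exists>q>0. act_normal g X = (t * q) *\<^sub>R X \<and> act_normal g Y = q *\<^sub>R Y"
begin

lemma dom:
  assumes "(\<sigma>, \<tau>) \<in> D"
  shows "\<sigma> \<in> cohyps" "\<tau> \<in> cohyps" "g \<in> SL \<Longrightarrow> (act g \<sigma>, act g \<tau>) \<in> D" "(\<tau>, \<sigma>) \<in> D" "(opp \<sigma>, \<tau>) \<in> D"
    "lies_between \<rho> \<sigma> \<tau> \<Longrightarrow> (\<sigma>, \<rho>) \<in> D" "lies_between \<rho> \<sigma> \<tau> \<Longrightarrow> (\<rho>, \<tau>) \<in> D"
proof -
  note a = angle[unfolded invariant_angle_function_def]
  note b = bspec[OF conjunct1[OF conjunct2[OF a]] assms, unfolded prod.case]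
  show "\<sigma> \<in> cohyps" "\<tau> \<in> cohyps" using conjunct1[OF a] assms by auto
  show "g \<in> SL \<Longrightarrow> (act g \<sigma>, act g \<tau>) \<in> D" "(\<tau>, \<sigma>) \<in> D" "(opp \<sigma>, \<tau>) \<in> D"
    using b by simp_all
  show "lies_between \<rho> \<sigma> \<tau> \<Longrightarrow> (\<sigma>, \<rho>) \<in> D" "lies_between \<rho> \<sigma> \<tau> \<Longrightarrow> (\<rho>, \<tau>) \<in> D"
    using b by - iprover+
qed

lemma ang:
  assumes "(\<sigma>, \<tau>) \<in> D"
  shows "0 \<le> \<theta> \<sigma> \<tau>" "\<theta> \<sigma> \<tau> \<le> pi" "\<theta> \<sigma> \<tau> = 0 \<longleftrightarrow> \<sigma> = \<tau>"
    "g \<in> SL \<Longrightarrow> \<theta> (act g \<sigma>) (act g \<tau>) = \<theta> \<sigma> \<tau>" "\<theta> \<tau> \<sigma> = \<theta> \<sigma> \<tau>" "\<theta> (opp \<sigma>) \<tau> = pi - \<theta> \<sigma> \<tau>"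
    "lies_between \<rho> \<sigma> \<tau> \<Longrightarrow> \<theta> \<sigma> \<rho> + \<theta> \<rho> \<tau> = \<theta> \<sigma> \<tau>"
proof -
  note a = angle[unfolded invariant_angle_function_def, THEN conjunct2, THEN conjunct2]
  note b = bspec[OF conjunct1[OF a] assms, unfolded prod.case]
    bspec[OF conjunct1[OF conjunct2[OF a]] assms, unfolded prod.case]
    bspec[OF conjunct1[OF conjunct2[OF conjunct2[OF a]]] assms, unfolded prod.case]
    bspec[OF conjunct2[OF conjunct2[OF conjunct2[OF a]]] assms, unfolded prod.case]
  show "0 \<le> \<theta> \<sigma> \<tau>" "\<theta> \<sigma> \<tau> \<le> pi" "\<theta> \<sigma> \<tau> = 0 \<longleftrightarrow> \<sigma> = \<tau>" using b(1) by simp_all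
  show "g \<in> SL \<Longrightarrow> \<theta> (act g \<sigma>) (act g \<tau>) = \<theta> \<sigma> \<tau>" using b(2) by simp
  show "\<theta> \<tau> \<sigma> = \<theta> \<sigma> \<tau>" "\<theta> (opp \<sigma>) \<tau> = pi - \<theta> \<sigma> \<tau>" using b(3) by simp_all
  show "lies_between \<rho> \<sigma> \<tau> \<Longrightarrow> \<theta> \<sigma> \<rho> + \<theta> \<rho> \<tau> = \<theta> \<sigma> \<tau>" using b(4) by iprover
qed

definition pt :: "real \<Rightarrow> real \<Rightarrow> 'n cohyp" where
  "pt x y = cohyp (x *\<^sub>R X + y *\<^sub>R Y)"

lemma pt_scale: "c > 0 \<Longrightarrow> pt (c * x) (c * y) = pt x y"
  using cohyp_scale[of c "x *\<^sub>R X + y *\<^sub>R Y"] by (simp add: pt_def scaleR_add_right)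

lemma pt_eqD: 
  assumes "pt x y = pt x' y'" shows "\<exists>c>0. x = c * x' \<and> y = c * y'"
proof -
  obtain c where c: "c > 0" "x *\<^sub>R X + y *\<^sub>R Y = c *\<^sub>R (x' *\<^sub>R X + y' *\<^sub>R Y)"
    using cohyp_eqD assms unfolding pt_def by blast
  have "(x - c * x') *\<^sub>R X + (y - c * y') *\<^sub>R Y = x *\<^sub>R X + y *\<^sub>R Y - c *\<^sub>R (x' *\<^sub>R X + y' *\<^sub>R Y)"
    by (simp add: algebra_simps)
  also have "\<dots> = 0" by (simp only: c(2)) simp
  finally have "x - c * x' = 0 \<and> y - c * y' = 0" by (rule indep)
  then show ?thesis using c(1) by auto
qed

lemma opp_pt: "opp (pt x y) = pt (- x) (- y)"
  by (simp add: pt_def opp_cohyp)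

lemma pt_between:
  assumes "pt (a * x + b * x') (a * y + b * y') \<in> cohyps" "a > 0" "b > 0"
  shows "lies_between (pt (a * x + b * x') (a * y + b * y')) (pt x y) (pt x' y')"
proof -
  have "(a * x + b * x') *\<^sub>R X + (a * y + b * y') *\<^sub>R Y = a *\<^sub>R (x *\<^sub>R X + y *\<^sub>R Y) + b *\<^sub>R (x' *\<^sub>R X + y' *\<^sub>R Y)"
    by (simp add: algebra_simps)
  with assms show ?thesis
    unfolding pt_def by (metis is_normal_iff_cohyps lies_between_cohyp)
qed

lemma act_pt:
  assumes "t > 0"
  obtains g where "g \<in> SL" "\<And>x y. act g (pt x y) = pt (t * x) y"
proof -
  obtain g q where g: "g \<in> SL" "q > 0" "act_normal g X = (t * q) *\<^sub>R X" "act_normal g Y = q *\<^sub>R Y"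
    using action[OF assms] by blast
  have "act g (pt x y) = pt (q * (t * x)) (q * y)" for x y
    unfolding pt_def act_cohyp[OF g(1)] act_normal_lincomb g(3,4) by (simp add: mult.commute mult.left_commute)
  then show thesis using that g(1,2) pt_scale by metis
qed

lemma scaled_in: 
  assumes "pt x y \<in> cohyps" "t > 0" shows "pt (t * x) y \<in> cohyps"
  using act_pt[OF assms(2)] act_in[OF assms(1)] by metis

lemma scaled_dom:
  assumes "(pt x y, pt x' y') \<in> D" "t > 0"
  shows "(pt (t * x) y, pt (t * x') y') \<in> D" "\<theta> (pt (t * x) y) (pt (t * x') y') = \<theta> (pt x y) (pt x' y')"
  using act_pt[OF assms(2)] dom(3)[OF assms(1)] ang(4)[OF assms(1)] by metis+

text \<open>Replacing t by 1 / t exchanges the two axes, so that a result about the X axis also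
  serves for the Y axis.\<close>

lemma swapped: "angle_on_hyperbolic_plane D \<theta> Y X"
proof
  show "invariant_angle_function D \<theta>" by (rule angle)
  show "x = 0 \<and> y = 0" if "x *\<^sub>R Y + y *\<^sub>R X = 0" for x y
    using indep[of y x] that by (simp add: add.commute)
  fix t :: real assume t: "t > 0"
  then obtain g q where g: "g \<in> SL" "q > 0" "act_normal g X = (1 / t * q) *\<^sub>R X" "act_normal g Y = q *\<^sub>R Y"
    using action[of "1 / t"] by auto
  then show "\<exists>g\<in>SL. \<exists>q>0. act_normal g Y = (t * q) *\<^sub>R Y \<and> act_normal g X = q *\<^sub>R X"
    using t by (intro bexI[of _ g] exI[of _ "q / t"]) auto
qed

lemma swap_pt: "angle_on_hyperbolic_plane.pt Y X x y = pt y x"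
proof -
  interpret s: angle_on_hyperbolic_plane D \<theta> Y X by (rule swapped)
  show ?thesis by (simp add: s.pt_def pt_def add.commute)
qed

text \<open>The action fixes \<open>pt x 0\<close> and moves \<open>pt x' y'\<close> strictly towards it, leaving the angle unchanged.\<close>

lemma no_angle_from_axis:
  assumes d: "(pt x 0, pt x' y') \<in> D" and nz: "x \<noteq> 0" "x' \<noteq> 0" "y' \<noteq> 0"
    and N: "\<And>a b. a > 0 \<Longrightarrow> b > 0 \<Longrightarrow> pt (a * x + b * x') (b * y') \<in> cohyps"
  shows False
proof -
  \<comment> \<open>The sign of x' / x decides whether stretching or shrinking moves the ray towards
    the axis. The choice makes c positive, and (t x', y') = c (x, 0) + (x', y').\<close>
  define t where "t = (if x' / x > 0 then 2 else 1 / 2 :: real)"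
  define c where "c = (t - 1) * (x' / x)"
  have t: "t > 0" "t \<noteq> 1" by (auto simp: t_def)
  have c: "c > 0" using nz by (auto simp: c_def t_def mult_neg_neg zero_less_divide_iff divide_less_0_iff)
  have "c * x + 1 * x' = t * x'" using nz by (simp add: c_def field_simps)
  then have e: "pt (t * x') y' = pt (c * x + 1 * x') (c * 0 + 1 * y')" by simp
  have "pt (t * x') y' \<in> cohyps" using dom(2)[OF d] t scaled_in by blast
  then have b: "lies_between (pt (t * x') y') (pt x 0) (pt x' y')"
    unfolding e using c by (intro pt_between) auto
  have "\<theta> (pt x 0) (pt (t * x') y') = \<theta> (pt (t * x) (t * 0)) (pt (t * x') y')"
    by (simp only: pt_scale[OF t(1)])
  also have "\<dots> = \<theta> (pt x 0) (pt x' y')" using scaled_dom(2)[OF d t(1)] by simp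
  finally have "\<theta> (pt (t * x') y') (pt x' y') = 0" using ang(7)[OF d b] by simp
  then have "pt (t * x') y' = pt x' y'" using ang(3)[OF dom(7)[OF d b]] by simp
  then show False using pt_eqD nz t(2) by force
qed

text \<open>Iterating the group element that maps \<open>pt x' y'\<close> to \<open>pt x y\<close> yields pairs of angle \<open>m * \<alpha>\<close>, which exceeds
  \<open>\<pi>\<close> for large \<open>m\<close>. They lie in the domain because \<open>- P (m + 1)\<close> is between \<open>- P m\<close> and \<open>P 0\<close>.\<close>

lemma no_angle_same_quadrant:
  assumes d: "(pt x y, pt x' y') \<in> D" and q: "x * x' > 0" "y * y' > 0" and ne: "pt x y \<noteq> pt x' y'"
  shows False
proof -
  \<comment> \<open>The stretch by r carries the second ray to the first: (x, y) = (y / y') (r x',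
    y').\<close>
  define r where "r = (x / x') / (y / y')"
  have nz: "x \<noteq> 0" "x' \<noteq> 0" "y \<noteq> 0" "y' \<noteq> 0" using q by auto
  have yy: "y / y' > 0" "x / x' > 0" using q by (auto simp: zero_less_divide_iff zero_less_mult_iff)
  then have r: "r > 0" unfolding r_def by (rule divide_pos_pos[rotated])
  define P where "P m = pt (r ^ m * x') y'" for m :: nat
  have P0: "P 0 = pt x' y'" by (simp add: P_def)
  have "pt x y = pt (y / y' * (r * x')) (y / y' * y')" using nz by (simp add: r_def)
  then have P1: "P 1 = pt x y" unfolding pt_scale[OF yy(1)] by (simp add: P_def)
  have r1: "r \<noteq> 1" using ne P0 P1 by (auto simp: P_def)
  have Pc: "P m \<in> cohyps" for m unfolding P_def using dom(2)[OF d] r by (intro scaled_in) auto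
  define \<alpha> where "\<alpha> = \<theta> (P 1) (P 0)"
  have d1: "(P 1, P 0) \<in> D" using d P0 P1 by simp
  have \<alpha>: "\<alpha> > 0" using ang(1,3)[OF d1] ne P0 P1 by (simp add: \<alpha>_def less_le)
  have dm: "(P (Suc m), P m) \<in> D" "\<theta> (P (Suc m)) (P m) = \<alpha>" for m
    using scaled_dom[of "r * x'" y' x' y' "r ^ m"] d1 r by (simp_all add: P_def \<alpha>_def mult_ac)
  have "(P (Suc m), P 0) \<in> D \<and> \<theta> (P (Suc m)) (P 0) = real (Suc m) * \<alpha>" for m
  proof (induction m)
    case 0
    show ?case using d1 by (simp add: \<alpha>_def)
  next
    case (Suc m)
    define u v where "u = r ^ Suc m" and "v = r ^ Suc (Suc m)"
    have uv: "(u - 1) / (v - 1) > 0" "(v - u) / (v - 1) > 0"  "v \<noteq> 1"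
    proof -
      consider "r > 1" | "r < 1" using r1 by linarith
      then have "(u > 1 \<and> v > u) \<or> (u < 1 \<and> v < u)"
      proof cases
        case 1
        then show ?thesis unfolding u_def v_def by (metis one_less_power power_strict_increasing zero_less_Suc lessI)
      next
        case 2
        have "r ^ Suc m < 1" using 2 r by (intro power_Suc_less_one) auto
        moreover have "r ^ Suc (Suc m) < r ^ Suc m" using 2 r by (intro power_strict_decreasing) auto
        ultimately show ?thesis by (simp add: u_def v_def)
      qed
      then show "(u - 1) / (v - 1) > 0" "(v - u) / (v - 1) > 0" "v \<noteq> 1"
        by (auto simp: zero_less_divide_iff)
    qed
    \<comment> \<open>The solution of - (v x', y') = - a (u x', y') + b (x', y'), that is, of a - b
      = 1 and a u - b = v. It is written through the two quotients already known to be
      positive.\<close>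
    define a b where "a = 1 / ((u - 1) / (v - 1))" and "b = ((v - u) / (v - 1)) / ((u - 1) / (v - 1))"
    have ab: "a > 0" "b > 0"
      unfolding a_def b_def
      using divide_pos_pos[OF zero_less_one uv(1)] divide_pos_pos[OF uv(2,1)] .
    have u1: "u \<noteq> 1" using uv(1) by auto
    have "a = (v - 1) / (u - 1)" "b = (v - u) / (u - 1)" using uv(3) by (simp_all add: a_def b_def)
    then have "a - b = ((v - 1) - (v - u)) / (u - 1)" "a * u - b = (v * (u - 1)) / (u - 1)"
      by (simp_all add: diff_divide_distrib[symmetric] algebra_simps)
    then have ab1: "a - b = 1" "a * u - b = v" using u1 by simp_all
    have e: "opp (P (Suc (Suc m))) = pt (a * - (u * x') + b * x') (a * - y' + b * y')"
    proof -
      have "a * - (u * x') + b * x' = - ((a * u - b) * x')" "a * - y' + b * y' = - ((a - b) * y')"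
        by (simp_all add: algebra_simps)
      then show ?thesis unfolding ab1 by (simp add: P_def opp_pt v_def)
    qed
    \<comment> \<open>A domain is closed only under passing inward, to rays in between, while
      \<open>P (Suc (Suc m))\<close> lies beyond \<open>P (Suc m)\<close> as seen from
      \<open>P 0\<close>. After the change of sign the outward step becomes an inward one.\<close>
    have bet: "lies_between (opp (P (Suc (Suc m)))) (opp (P (Suc m))) (P 0)"
    proof -
      have "opp (P (Suc (Suc m))) \<in> cohyps" using Pc opp_in by blast
      moreover have "opp (P (Suc m)) = pt (- (u * x')) (- y')" "P 0 = pt x' y'"
        by (simp_all add: P_def opp_pt u_def)
      ultimately show ?thesis unfolding e using ab by (simp only:) (rule pt_between)
    qed
    have dom': "(opp (P (Suc m)), P 0) \<in> D" using Suc dom(5) by blast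
    have 1: "(P (Suc (Suc m)), P 0) \<in> D"
      using dom(5)[OF dom(7)[OF dom' bet]] by (simp add: opp_opp)
    have 2: "\<theta> (opp (P (Suc m))) (opp (P (Suc (Suc m)))) = \<alpha>"
    proof -
      note s = dm(1)[of "Suc m"]
      have "(opp (P (Suc (Suc m))), P (Suc m)) \<in> D" using s by (rule dom(5))
      then have t: "(P (Suc m), opp (P (Suc (Suc m)))) \<in> D" by (rule dom(4))
      show ?thesis using ang(6)[OF t] ang(5)[OF dom(5)[OF s]] ang(6)[OF s] dm(2)[of "Suc m"] by simp
    qed
    \<comment> \<open>Additivity for the three rays with signs; changing both signs of a pair keeps
      its angle, changing one gives the supplement. Cancelling pi leaves the induction step.\<close>
    have "\<alpha> + (pi - \<theta> (P (Suc (Suc m))) (P 0)) = pi - \<theta> (P (Suc m)) (P 0)"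
      using ang(7)[OF dom' bet] ang(6)[OF 1] ang(6)[of "P (Suc m)" "P 0"] Suc 2 by simp
    then show ?case using 1 Suc by (simp add: algebra_simps)
  qed
  then have "real (Suc m) * \<alpha> \<le> pi" for m using ang(2) by metis
  moreover obtain m :: nat where "pi / \<alpha> < real m" using reals_Archimedean2 by blast
  ultimately show False using \<alpha> by (metis divide_less_eq less_le_not_le lift_Suc_mono_less_iff
      less_trans lessI of_nat_less_iff mult.commute mult_less_cancel_right_pos not_le)
qed

text \<open>Rays in different open quadrants have an axis between them, and the ray on this axis
  forms with one of the two a pair in the domain; this is the axis case. Two rays in one open
  quadrant, or in opposite ones, remain: the first case is handled by iteration, and in the second
  an axis is crossed again.\<close>

lemma not_in_domain_of_normal_combinations:
  assumes d: "(pt x y, pt x' y') \<in> D" and ind: "x * y' \<noteq> x' * y"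
    and N: "\<And>a b. a > 0 \<Longrightarrow> b > 0 \<Longrightarrow> pt (a * x + b * x') (a * y + b * y') \<in> cohyps"
  shows False
proof -
  interpret s: angle_on_hyperbolic_plane D \<theta> Y X by (rule swapped)
  have axis: False
    if d: "(pt x y, pt x' y') \<in> D" and ind: "x * y' \<noteq> x' * y" and ax: "x * y = 0"
      and N: "\<And>a b. a > 0 \<Longrightarrow> b > 0 \<Longrightarrow> pt (a * x + b * x') (a * y + b * y') \<in> cohyps"
    for x y x' y'
  proof -
    have off: False if d: "(pt x y, pt x' y') \<in> D" and nz: "x' * y' \<noteq> 0"
      and N: "\<And>a b. a > 0 \<Longrightarrow> b > 0 \<Longrightarrow> pt (a * x + b * x') (a * y + b * y') \<in> cohyps" for x' y'
    proof (cases "y = 0")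
      case True
      then show False
        using no_angle_from_axis[of x x' y'] d nz N ind by auto
    next
      case False
      then have "x = 0" using ax by simp
      then show False
        using s.no_angle_from_axis[of y y' x'] d nz N ind False unfolding swap_pt by auto
    qed
    show False
    proof (cases "x' * y' = 0")
      case True
      \<comment> \<open>Both rays lie on axes, and on different ones, so their sum lies off the axes
        and between them.\<close>
      have c: "pt (x + x') (y + y') \<in> cohyps" using N[of 1 1] by simp
      then have b: "lies_between (pt (x + x') (y + y')) (pt x y) (pt x' y')"
        using pt_between[of 1 x 1 x' y y'] by simp
      have "(x + x') * (y + y') \<noteq> 0" using True ax ind by auto
      then show False
      proof (rule off[OF dom(6)[OF d b]])
        fix a b :: real assume "a > 0" "b > 0"
        then show "pt (a * x + b * (x + x')) (a * y + b * (y + y')) \<in> cohyps"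
          using N[of "a + b" b] by (simp add: algebra_simps)
      qed
    qed (use off d N in blast)
  qed
  have to_axis: False if c: "c > 0" and z: "(x + c * x') * (y + c * y') = 0" for c
  proof -
    have m: "pt (x + c * x') (y + c * y') \<in> cohyps" using N[of 1 c] c by simp
    then have b: "lies_between (pt (x + c * x') (y + c * y')) (pt x y) (pt x' y')"
      using pt_between[of 1 x c x' y y'] c by simp
    show False
    proof (rule axis[OF dom(7)[OF d b] _ z])
      show "(x + c * x') * y' \<noteq> x' * (y + c * y')" using ind by (simp add: algebra_simps)
      fix a b :: real assume "a > 0" "b > 0"
      then show "pt (a * (x + c * x') + b * x') (a * (y + c * y') + b * y') \<in> cohyps"
        using N[of a "a * c + b"] c by (simp add: algebra_simps add_pos_pos)
    qed
  qed
  have opp_d: "(pt (- x) (- y), pt x' y') \<in> D" using dom(5)[OF d] by (simp add: opp_pt)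
  consider "x * y = 0" | "x' * y' = 0" | "x * x' < 0" | "y * y' < 0" | "x * x' > 0" "y * y' > 0"
    by (metis linorder_neqE_linordered_idom mult_eq_0_iff)
  then show False
  proof cases
    case 1
    then show ?thesis using axis[OF d ind] N by blast
  next
    case 2
    show ?thesis
    proof (rule axis[OF dom(4)[OF d] _ 2])
      show "x' * y \<noteq> x * y'" using ind by simp
      fix a b :: real assume "a > 0" "b > 0"
      then show "pt (a * x' + b * x) (a * y' + b * y) \<in> cohyps" using N[of b a] by (simp add: add.commute)
    qed
  next
    case 3
    then have "- x / x' > 0" "x + (- x / x') * x' = 0" by (auto simp: mult_less_0_iff field_simps)
    then show ?thesis using to_axis[of "- x / x'"] by simp
  next
    case 4
    then have "- y / y' > 0" "y + (- y / y') * y' = 0" by (auto simp: mult_less_0_iff field_simps)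
    then show ?thesis using to_axis[of "- y / y'"] by simp
  next
    case 5
    have "pt x y \<noteq> pt x' y'"
    proof
      assume "pt x y = pt x' y'"
      then obtain c where "x = c * x'" "y = c * y'" using pt_eqD by blast
      then show False using ind by simp
    qed
    then show ?thesis using no_angle_same_quadrant[OF d 5] by blast
  qed
qed

text \<open>After replacing A by - A if necessary, all positive combinations are normal by
  \<open>combinations_normal\<close>. The domain contains the pair with the opposite first member,
  and the determinant of the coordinates stays nonzero.\<close>

lemma not_in_domain:
  assumes d: "(cohyp A, cohyp B) \<in> D" and A: "A = x *\<^sub>R X + y *\<^sub>R Y" and B: "B = x' *\<^sub>R X + y' *\<^sub>R Y"
    and ind: "x * y' \<noteq> x' * y"
  shows False
proof -
  have comb: "a *\<^sub>R A + b *\<^sub>R B = (a * x + b * x') *\<^sub>R X + (a * y + b * y') *\<^sub>R Y" for a b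
    by (simp add: A B algebra_simps)
  have 1: "a = 0 \<and> b = 0" if "a *\<^sub>R A + b *\<^sub>R B = 0" for a b
  proof -
    have e: "a * x + b * x' = 0" "a * y + b * y' = 0"
      using indep[OF that[unfolded comb]] by auto
    have "a * (x * y' - x' * y) = (a * x + b * x') * y' - (a * y + b * y') * x'"
      "b * (x * y' - x' * y) = (a * y + b * y') * x - (a * x + b * x') * y"
      by (simp_all add: algebra_simps)
    then have "a * (x * y' - x' * y) = 0" "b * (x * y' - x' * y) = 0" unfolding e by simp_all
    then show ?thesis using ind by simp
  qed
  have "is_normal A" "is_normal B" using dom(1,2)[OF d] by (simp_all add: is_normal_iff_cohyps)
  from combinations_normal[OF this 1] show False
  proof
    assume "\<forall>a>0. \<forall>b>0. is_normal (a *\<^sub>R A + b *\<^sub>R B)"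
    then have "\<forall>a>0. \<forall>b>0. pt (a * x + b * x') (a * y + b * y') \<in> cohyps"
      unfolding is_normal_iff_cohyps pt_def comb .
    moreover have "(pt x y, pt x' y') \<in> D" using d by (simp add: pt_def A B)
    ultimately show False using not_in_domain_of_normal_combinations ind by blast
  next
    assume "\<forall>a>0. \<forall>b>0. is_normal (a *\<^sub>R (- A) + b *\<^sub>R B)"
    moreover have "a *\<^sub>R (- A) + b *\<^sub>R B = (a * - x + b * x') *\<^sub>R X + (a * - y + b * y') *\<^sub>R Y" for a b
      using comb[of "- a" b] by simp
    ultimately have "\<forall>a>0. \<forall>b>0. pt (a * - x + b * x') (a * - y + b * y') \<in> cohyps"
      unfolding is_normal_iff_cohyps pt_def by simp
    moreover have "(pt (- x) (- y), pt x' y') \<in> D"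
      using dom(5)[OF d] unfolding opp_pt[symmetric] by (simp add: pt_def A B)
    moreover have "(- x) * y' \<noteq> x' * (- y)" using ind by simp
    ultimately show False using not_in_domain_of_normal_combinations by blast
  qed
qed

end

section \<open>Angles from equivariant sets of complex numbers\<close>

lemma det_cmat: "det (cmat M) = complex_of_real (det M)"
  by (simp add: det_def cmat_def)

lemma pencil_of_real: "pencil A B (complex_of_real x) = cmat (A - x *\<^sub>R B)"
  by (simp add: pencil_def cmat_def vec_eq_iff)

lemma Fin_gen_eigenvalues: "Fin z \<in> gen_eigenvalues A B \<longleftrightarrow> det (pencil A B z) = 0"
  by (simp add: gen_eigenvalues_def invertible_det_nz)

lemma Fin_real_gen_eigenvalues: "Fin (complex_of_real x) \<in> gen_eigenvalues A B \<longleftrightarrow> det (A - x *\<^sub>R B) = 0"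
  by (simp add: Fin_gen_eigenvalues pencil_of_real det_cmat)

lemma Infty_gen_eigenvalues: "Infty \<in> gen_eigenvalues A B \<longleftrightarrow> det B = 0"
  by (simp add: gen_eigenvalues_def invertible_det_nz)

text \<open>The Leibniz formula with linear polynomials as entries gives a polynomial in z with
  value det (A - z B), nonzero by regularity.\<close>

lemma finite_gen_eigenvalues:
  assumes "regular_pencil A B" shows "finite (gen_eigenvalues A B)"
proof -
  define p where "p = (\<Sum>\<sigma> | \<sigma> permutes UNIV. [:of_int (sign \<sigma>):] *
    (\<Prod>i\<in>UNIV. [:complex_of_real (A $ i $ \<sigma> i), - complex_of_real (B $ i $ \<sigma> i):]))"
  have p: "poly p z = det (pencil A B z)" for z
    by (simp add: p_def det_def pencil_def poly_sum poly_prod)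
  then have "p \<noteq> 0" using assms by (auto simp: regular_pencil_def)
  then have "finite {z. poly p z = 0}" by (rule poly_roots_finite)
  moreover have "gen_eigenvalues A B \<subseteq> insert Infty (Fin ` {z. poly p z = 0})"
    by (auto simp: gen_eigenvalues_def p invertible_det_nz)
  ultimately show ?thesis using finite_subset by blast
qed

text \<open>det (c B - z B) = (c - z)^n det B, and regularity forces det B to be nonzero, which
  excludes infinity too. Any further eigenvalue thus shows that the normals are not proportional to
  each other in this way.\<close>

lemma gen_eigenvalues_proportional:
  fixes B :: "real^'n^'n"
  assumes "regular_pencil (c *\<^sub>R B) B"
  shows "gen_eigenvalues (c *\<^sub>R B) B \<subseteq> {Fin c}"
proof -
  have *: "det (pencil (c *\<^sub>R B) B z) = (complex_of_real c - z) ^ CARD('n) * det (cmat B)" for z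
  proof -
    have "pencil (c *\<^sub>R B) B z = (\<chi> i j. (complex_of_real c - z) * cmat B $ i $ j)"
      by (simp add: pencil_def cmat_def vec_eq_iff algebra_simps)
    then show ?thesis by (simp only: det_smult_rows)
  qed
  then have "det B \<noteq> 0" using assms by (auto simp: regular_pencil_def det_cmat)
  then show ?thesis
    by (auto simp: gen_eigenvalues_def invertible_det_nz * det_cmat)
qed

text \<open>A smaller set is padded: the hyperbolic group asks only that the spectrum lie in {a, b}
  with distinct a and b.\<close>

lemma at_most_two_reals:
  fixes S :: "real set"
  assumes "finite S" "card S \<le> 2"
  obtains a b where "a \<noteq> b" "S \<subseteq> {a, b}"
proof (cases "card S = 2")
  case True
  then show thesis using that by (auto simp: card_2_iff)
next
  case False
  then have "card S \<le> Suc 0" using assms(2) by simp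
  then have "\<forall>x\<in>S. \<forall>y\<in>S. x = y" using assms(1) by (simp add: card_le_Suc0_iff_eq)
  then obtain a where "S \<subseteq> {a}" by blast
  then show thesis using that[of a "a + 1"] by auto
qed

text \<open>For a and b enclosing the spectrum, A - a B and A - b B form a basis of the plane of A
  and B that diagonalizes the group. Independence of A and B is what excluding equal and opposite
  hyperplanes provides.\<close>

lemma no_invariant_angle:
  fixes A B :: "real^'n^'n"
  assumes reg: "regular_normals A B" and real: "gen_eigenvalues A B \<subseteq> real_eigs"
    and card: "card (gen_eigenvalues A B) \<le> 2"
    and ne: "cohyp A \<noteq> cohyp B" "cohyp A \<noteq> opp (cohyp B)"
    and angle: "invariant_angle_function D \<theta>" and d: "(cohyp A, cohyp B) \<in> D"
  shows False
proof -
  have N: "transpose A = A" "transpose B = B" "A \<noteq> 0" "B \<noteq> 0"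
    using reg by (auto simp: regular_normals_def is_normal_def Sym_def)
  have indep: "A \<noteq> c *\<^sub>R B" for c
  proof
    assume c: "A = c *\<^sub>R B"
    consider "c > 0" | "c = 0" | "- c > 0" by linarith
    then show False
    proof cases
      case 3
      then have "cohyp ((- c) *\<^sub>R (- B)) = cohyp (- B)" by (rule cohyp_scale)
      then show False using ne(2) c by (simp add: opp_cohyp)
    qed (use c ne cohyp_scale N in auto)
  qed
  \<comment> \<open>Infinity is not among \<open>real_eigs\<close>, so B is invertible.\<close>
  have "Infty \<notin> gen_eigenvalues A B" using real by (auto simp: real_eigs_def)
  then have inv: "invertible B" by (simp add: Infty_gen_eigenvalues invertible_det_nz)
  define S where "S = {x. Fin (complex_of_real x) \<in> gen_eigenvalues A B}"
  have img: "gen_eigenvalues A B = (\<lambda>x. Fin (complex_of_real x)) ` S"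
    using real by (auto simp: S_def real_eigs_def)
  have inj: "inj_on (\<lambda>x. Fin (complex_of_real x)) S" by (simp add: inj_on_def)
  have "finite S"
    using finite_gen_eigenvalues[of A B] reg finite_imageD[OF _ inj] unfolding img regular_normals_def by auto
  moreover have "card S \<le> 2" using card unfolding img card_image[OF inj] .
  ultimately obtain a b where ab: "a \<noteq> b" "S \<subseteq> {a, b}" by (rule at_most_two_reals)
  have spec: "invertible (pencil A B z)" if "z \<noteq> complex_of_real a" "z \<noteq> complex_of_real b" for z
  proof -
    have "Fin z \<notin> gen_eigenvalues A B" using that ab(2) unfolding img by auto
    then show ?thesis by (simp add: gen_eigenvalues_def)
  qed
  define X Y where "X = A - a *\<^sub>R B" and "Y = A - b *\<^sub>R B"
  interpret angle_on_hyperbolic_plane D \<theta> X Y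
  proof
    show "x = 0 \<and> y = 0" if "x *\<^sub>R X + y *\<^sub>R Y = 0" for x y
    proof -
      have e: "(x + y) *\<^sub>R A = (x * a + y * b) *\<^sub>R B"
        using that by (simp add: X_def Y_def algebra_simps)
      have 0: "x + y = 0"
      proof (rule ccontr)
        assume "x + y \<noteq> 0"
        then have "A = ((x * a + y * b) / (x + y)) *\<^sub>R B"
          using arg_cong[OF e, of "scaleR (inverse (x + y))"] by (simp add: divide_inverse mult.commute)
        then show False using indep by blast
      qed
      then have "x * a + y * b = 0" using e N(4) by simp
      moreover have "y = - x" using 0 by simp
      ultimately have "x * (a - b) = 0" by (simp add: algebra_simps)
      then show ?thesis using ab(1) \<open>y = - x\<close> by simp
    qed
    show "\<exists>g\<in>SL. \<exists>q>0. act_normal g X = (t * q) *\<^sub>R X \<and> act_normal g Y = q *\<^sub>R Y" if "t > 0" for t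
      using hyperbolic_action_exists[OF N(1,2) inv ab(1) spec that] unfolding X_def Y_def by blast
  qed (rule angle)
  \<comment> \<open>Coordinates of B and A in the basis X, Y, from X - Y = (b - a) B. Their
    determinant is - 1 / (b - a).\<close>
  have "B = (1 / (b - a)) *\<^sub>R ((b - a) *\<^sub>R B)" using ab(1) by simp
  also have "(b - a) *\<^sub>R B = X - Y" by (simp add: X_def Y_def algebra_simps)
  finally have B: "B = (1 / (b - a)) *\<^sub>R X + (- 1 / (b - a)) *\<^sub>R Y" by (simp add: scaleR_diff_right)
  have "A = X + a *\<^sub>R B" by (simp add: X_def)
  also have "\<dots> = (1 + a / (b - a)) *\<^sub>R X + (- a / (b - a)) *\<^sub>R Y"
    by (subst B) (simp add: scaleR_add_left scaleR_diff_right)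
  finally have A: "A = (1 + a / (b - a)) *\<^sub>R X + (- a / (b - a)) *\<^sub>R Y" .
  show False
  proof (rule not_in_domain[OF d A B])
    show "(1 + a / (b - a)) * (- 1 / (b - a)) \<noteq> 1 / (b - a) * (- a / (b - a))"
    proof
      assume "(1 + a / (b - a)) * (- 1 / (b - a)) = 1 / (b - a) * (- a / (b - a))"
      moreover have "(1 + x) * (- 1 / e) - 1 / e * (- x) = - 1 / e" for x e :: real
        by (cases "e = 0") (simp_all add: field_simps)
      from this[of "a / (b - a)" "b - a"]
      have "(1 + a / (b - a)) * (- 1 / (b - a)) - 1 / (b - a) * (- a / (b - a)) = - 1 / (b - a)"
        by simp
      ultimately show False using ab(1) by simp
    qed
  qed
qed

section \<open>Absolute arguments of nonreal numbers\<close>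

lemma Arg_mult_upper:
  assumes "Im v > 0" "Im w > 0" "Im (v * w) > 0"
  shows "Arg (v * w) = Arg v + Arg w"
proof -
  define s where "s = Arg v + Arg w"
  have vw: "v \<noteq> 0" "w \<noteq> 0" using assms by auto
  have "v * w = (of_real (norm v) * exp (\<i> * Arg v)) * (of_real (norm w) * exp (\<i> * Arg w))"
    using Arg_eq[OF vw(1)] Arg_eq[OF vw(2)] by simp
  also have "\<dots> = of_real (norm (v * w)) * exp (\<i> * s)"
    by (simp add: s_def norm_mult exp_add distrib_left)
  finally have e: "of_real (norm (v * w)) * exp (\<i> * s) = v * w" ..
  have "Im (v * w) = norm (v * w) * sin s"
    by (subst e[symmetric]) (simp add: Im_exp)
  then have "sin s > 0" using assms(3) by (metis norm_ge_zero not_le mult_nonneg_nonpos)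
  moreover have "0 < s" "s < 2 * pi" using assms Arg_lt_pi[of v] Arg_lt_pi[of w] by (auto simp: s_def)
  \<comment> \<open>A positive sine excludes s between pi and 2 pi, so the sum of the arguments is
    again a principal argument.\<close>
  ultimately have "s \<le> pi" using sin_le_zero[of s] by linarith
  moreover have "norm (v * w) > 0" using vw by simp
  ultimately show ?thesis using Arg_unique[OF e] \<open>0 < s\<close> by (simp add: s_def)
qed

lemma abs_Arg_cnj: "\<bar>Arg (cnj z)\<bar> = \<bar>Arg z\<bar>"
  by (cases "z \<in> \<real>") (auto simp: Arg_cnj complex_is_Real_iff complex_cnj_cancel_iff Reals_cnj_iff)

lemma abs_Arg_bounds: "z \<notin> \<real> \<Longrightarrow> 0 < \<bar>Arg z\<bar> \<and> \<bar>Arg z\<bar> < pi"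
  using mpi_less_Arg[of z] Arg_le_pi[of z] Arg_eq_0_pi[of z] by linarith

lemma abs_Arg_minus: "z \<notin> \<real> \<Longrightarrow> \<bar>Arg (- z)\<bar> = pi - \<bar>Arg z\<bar>"
  using mpi_less_Arg[of z] Arg_le_pi[of z] Arg_eq_0_pi[of z] Arg_minus[of z]
  by (cases "z = 0") (auto split: if_splits)

lemma abs_Arg_inverse: "\<bar>Arg (inverse z)\<bar> = \<bar>Arg z\<bar>"
  by (simp add: Arg_inverse)

text \<open>Put w = a z + b. If z is in the upper half-plane, then so are w, as a > 0, and z / w, as
  Im (z / w) = b Im z / |w|^2; their product is z. The lower half-plane follows by
  conjugation.\<close>

lemma abs_Arg_additive:
  assumes "z \<notin> \<real>" "a > 0" "b > 0"
  shows "\<bar>Arg (z / (of_real a * z + of_real b))\<bar> + \<bar>Arg (of_real a * z + of_real b)\<bar> = \<bar>Arg z\<bar>"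
proof -
  have *: "\<bar>Arg (z / (of_real a * z + of_real b))\<bar> + \<bar>Arg (of_real a * z + of_real b)\<bar> = \<bar>Arg z\<bar>"
    if "Im z > 0" for z
  proof -
    define w where "w = of_real a * z + of_real b"
    have w: "Im w > 0" using that assms by (simp add: w_def)
    then have w0: "w \<noteq> 0" by auto
    have "Im (z / w) = (Im z * Re w - Re z * Im w) / (norm w)\<^sup>2"
      by (simp add: Im_divide cmod_power2)
    also have "Im z * Re w - Re z * Im w = b * Im z" by (simp add: w_def algebra_simps)
    also have "b * Im z / (norm w)\<^sup>2 > 0" using w0 assms(3) that by simp
    finally have v: "Im (z / w) > 0" .
    have "Arg z = Arg (z / w) + Arg w" using Arg_mult_upper[OF v w] that w0 by simp
    then show ?thesis using Arg_lt_pi[of "z / w"] Arg_lt_pi[of w] v w unfolding w_def[symmetric] by linarith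
  qed
  show ?thesis
  proof (cases "Im z > 0")
    case False
    then have "Im (cnj z) > 0" using assms(1) by (simp add: complex_is_Real_iff)
    from *[OF this] have "\<bar>Arg (cnj (z / (of_real a * z + of_real b)))\<bar> + \<bar>Arg (cnj (of_real a * z + of_real b))\<bar> = \<bar>Arg (cnj z)\<bar>"
      by simp
    then show ?thesis by (simp only: abs_Arg_cnj)
  qed (rule *)
qed

definition mean_angle :: "complex set \<Rightarrow> real" where
  "mean_angle Z = (\<Sum>z\<in>Z. \<bar>Arg z\<bar>) / card Z"

lemma mean_angle_image:
  assumes "inj_on f Z" shows "mean_angle (f ` Z) = (\<Sum>z\<in>Z. \<bar>Arg (f z)\<bar>) / card Z"
  using assms by (simp add: mean_angle_def sum.reindex card_image)

text \<open>The effect on an eigenvalue z of replacing the pencil (A, B) by (a A + b B, c A + d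
  B).\<close>

definition moebius :: "real \<Rightarrow> real \<Rightarrow> real \<Rightarrow> real \<Rightarrow> complex \<Rightarrow> complex" where
  "moebius a b c d z = (of_real a * z + of_real b) / (of_real c * z + of_real d)"

lemma moebius_denominator: 
  assumes "z \<notin> \<real>" "a * d - b * c \<noteq> 0" shows "of_real c * z + of_real d \<noteq> (0 :: complex)"
proof
  assume "of_real c * z + of_real d = (0 :: complex)"
  then have "Im (of_real c * z + of_real d) = 0" "Re (of_real c * z + of_real d) = 0" by simp_all
  then show False using assms by (auto simp: complex_is_Real_iff)
qed

lemma moebius_inj:
  assumes "Z \<inter> \<real> = {}" "a * d - b * c \<noteq> 0" shows "inj_on (moebius a b c d) Z"
proof (rule inj_onI)
  fix z w assume zw: "z \<in> Z" "w \<in> Z" and e: "moebius a b c d z = moebius a b c d w"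
  have "of_real c * z + of_real d \<noteq> 0" "of_real c * w + of_real d \<noteq> 0"
    using zw assms moebius_denominator by blast+
  with e have "(of_real a * z + of_real b) * (of_real c * w + of_real d)
      = (of_real a * w + of_real b) * (of_real c * z + of_real d)"
    by (simp add: moebius_def frac_eq_eq)
  then have "of_real (a * d - b * c) * (z - w) = 0" by (simp add: algebra_simps)
  then show "z = w" using assms(2) by (simp only: mult_eq_0_iff of_real_eq_0_iff) simp
qed

text \<open>Apart from invariance under SL, the axioms compare pencils of one plane, so they come
  from the Moebius hypothesis with suitable matrices: diagonal for rescaling and change of sign,
  antidiagonal for symmetry, triangular for additivity.\<close>

lemma invariant_angle_function_of_equivariant_set:
  fixes P :: "real^'n^'n \<Rightarrow> real^'n^'n \<Rightarrow> bool" and Z :: "real^'n^'n \<Rightarrow> real^'n^'n \<Rightarrow> complex set"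
  assumes P: "\<And>A B. P A B \<Longrightarrow> is_normal A \<and> is_normal B \<and> (\<forall>c. A \<noteq> c *\<^sub>R B)"
    and act: "\<And>A B g. P A B \<Longrightarrow> g \<in> SL \<Longrightarrow>
      P (act_normal g A) (act_normal g B) \<and> Z (act_normal g A) (act_normal g B) = Z A B"
    and moebius: "\<And>A B a b c d. P A B \<Longrightarrow> a * d - b * c \<noteq> 0 \<Longrightarrow>
      is_normal (a *\<^sub>R A + b *\<^sub>R B) \<Longrightarrow> is_normal (c *\<^sub>R A + d *\<^sub>R B) \<Longrightarrow>
      P (a *\<^sub>R A + b *\<^sub>R B) (c *\<^sub>R A + d *\<^sub>R B) \<and>
      Z (a *\<^sub>R A + b *\<^sub>R B) (c *\<^sub>R A + d *\<^sub>R B) = moebius a b c d ` Z A B"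
    and Z: "\<And>A B. P A B \<Longrightarrow> finite (Z A B) \<and> Z A B \<noteq> {} \<and> Z A B \<inter> \<real> = {}"
  shows "\<exists>\<theta>. invariant_angle_function {(cohyp A, cohyp B) | A B. P A B} \<theta> \<and>
    (\<forall>A B. P A B \<longrightarrow> \<theta> (cohyp A) (cohyp B) = mean_angle (Z A B))"
proof -
  let ?D = "{(cohyp A, cohyp B) | A B. P A B}"
  define m where "m A B = mean_angle (Z A B)" for A B
  have m_moebius: "m (a *\<^sub>R A + b *\<^sub>R B) (c *\<^sub>R A + d *\<^sub>R B)
      = (\<Sum>z\<in>Z A B. \<bar>Arg (moebius a b c d z)\<bar>) / card (Z A B)"
    if "P A B" "a * d - b * c \<noteq> 0" "is_normal (a *\<^sub>R A + b *\<^sub>R B)" "is_normal (c *\<^sub>R A + d *\<^sub>R B)" for A B a b c d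
    using moebius[OF that] Z[OF that(1)] moebius_inj[OF _ that(2)] by (simp add: m_def mean_angle_image)
  have card: "card (Z A B) > 0" if "P A B" for A B
    using Z[OF that] by (simp add: card_gt_0_iff)
  have nonreal: "z \<notin> \<real>" if "P A B" "z \<in> Z A B" for A B z
    using Z[OF that(1)] that(2) by blast

  \<comment> \<open>Positive factors of A and B multiply z by a positive number, so the mean angle
    depends on the rays alone.\<close>
  have scale: "P (a *\<^sub>R A) (b *\<^sub>R B)" "m (a *\<^sub>R A) (b *\<^sub>R B) = m A B" if p: "P A B" "a > 0" "b > 0" for A B a b
  proof -
    have N: "is_normal (a *\<^sub>R A + 0 *\<^sub>R B)" "is_normal (0 *\<^sub>R A + b *\<^sub>R B)" "a * b - 0 * 0 \<noteq> 0"
      using P[OF p(1)] p is_normal_scaleR by auto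
    show "P (a *\<^sub>R A) (b *\<^sub>R B)" using moebius[OF p(1) N(3,1,2)] by simp
    have "moebius a 0 0 b z = of_real (a / b) * z" for z by (simp add: moebius_def)
    then have "\<bar>Arg (moebius a 0 0 b z)\<bar> = \<bar>Arg z\<bar>" for z using p by simp
    then show "m (a *\<^sub>R A) (b *\<^sub>R B) = m A B"
      using m_moebius[OF p(1) N(3,1,2)] by (simp add: m_def mean_angle_def)
  qed
  have swap: "P B A" "m B A = m A B" if p: "P A B" for A B
  proof -
    have N: "is_normal (0 *\<^sub>R A + 1 *\<^sub>R B)" "is_normal (1 *\<^sub>R A + 0 *\<^sub>R B)" "0 * 0 - 1 * (1 :: real) \<noteq> 0"
      using P[OF p(1)] by auto
    show "P B A" using moebius[OF p(1) N(3,1,2)] by simp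
    have "moebius 0 1 1 0 z = inverse z" for z by (simp add: moebius_def inverse_eq_divide)
    then show "m B A = m A B"
      using m_moebius[OF p(1) N(3,1,2)] by (simp add: m_def mean_angle_def abs_Arg_inverse)
  qed
  have minus: "P (- A) B" "m (- A) B = pi - m A B" if p: "P A B" for A B
  proof -
    have "cohyp (- A) \<in> cohyps"
      using P[OF p] opp_in[of "cohyp A"] by (simp add: opp_cohyp is_normal_iff_cohyps)
    then have N: "is_normal ((- 1) *\<^sub>R A + 0 *\<^sub>R B)" "is_normal (0 *\<^sub>R A + 1 *\<^sub>R B)" "(- 1) * 1 - 0 * (0 :: real) \<noteq> 0"
      using P[OF p(1)] is_normal_iff_cohyps by auto
    show "P (- A) B" using moebius[OF p(1) N(3,1,2)] by simp
    have "m (- A) B = (\<Sum>z\<in>Z A B. \<bar>Arg (- z)\<bar>) / card (Z A B)"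
      using m_moebius[OF p(1) N(3,1,2)] by (simp add: moebius_def)
    also have "(\<Sum>z\<in>Z A B. \<bar>Arg (- z)\<bar>) = (\<Sum>z\<in>Z A B. pi - \<bar>Arg z\<bar>)"
      using nonreal[OF p] by (intro sum.cong refl abs_Arg_minus) auto
    finally show "m (- A) B = pi - m A B"
      using card[OF p] by (simp add: m_def mean_angle_def sum_subtractf diff_divide_distrib)
  qed
  \<comment> \<open>The matrices are (1 0; a b) for (A, a A + b B) and (a b; 0 1) for (a A + b B,
    B). They send z to the two numbers in \<open>abs_Arg_additive\<close>.\<close>
  have between: "P A (a *\<^sub>R A + b *\<^sub>R B)" "P (a *\<^sub>R A + b *\<^sub>R B) B"
      "m A (a *\<^sub>R A + b *\<^sub>R B) + m (a *\<^sub>R A + b *\<^sub>R B) B = m A B"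
    if p: "P A B" "a > 0" "b > 0" and n: "is_normal (a *\<^sub>R A + b *\<^sub>R B)" for A B a b
  proof -
    have N: "is_normal (1 *\<^sub>R A + 0 *\<^sub>R B)" "is_normal (0 *\<^sub>R A + 1 *\<^sub>R B)" "1 * b - 0 * a \<noteq> 0" "a * 1 - b * 0 \<noteq> 0"
      using P[OF p(1)] p by auto
    show "P A (a *\<^sub>R A + b *\<^sub>R B)" using moebius[OF p(1) N(3,1) n] by simp
    show "P (a *\<^sub>R A + b *\<^sub>R B) B" using moebius[OF p(1) N(4) n N(2)] by simp
    have "m A (a *\<^sub>R A + b *\<^sub>R B) + m (a *\<^sub>R A + b *\<^sub>R B) B = (\<Sum>z\<in>Z A B. 
        \<bar>Arg (z / (of_real a * z + of_real b))\<bar> + \<bar>Arg (of_real a * z + of_real b)\<bar>) / card (Z A B)"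
      using m_moebius[OF p(1) N(3,1) n] m_moebius[OF p(1) N(4) n N(2)]
      by (simp add: moebius_def sum.distrib add_divide_distrib)
    also have "\<dots> = m A B" unfolding m_def mean_angle_def
      using abs_Arg_additive[OF nonreal[OF p(1)] p(2,3)] by (simp cong: sum.cong)
    finally show "m A (a *\<^sub>R A + b *\<^sub>R B) + m (a *\<^sub>R A + b *\<^sub>R B) B = m A B" .
  qed
  \<comment> \<open>No pair of the domain is equal or opposite, so the extreme values 0 and pi must
    not occur at all. Nonreal z give the strict bounds.\<close>
  have range: "0 < m A B" "m A B < pi" if p: "P A B" for A B
  proof -
    have b: "0 < \<bar>Arg z\<bar>" "\<bar>Arg z\<bar> < pi" if "z \<in> Z A B" for z
      using abs_Arg_bounds nonreal[OF p that] by blast+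
    have "0 < (\<Sum>z\<in>Z A B. \<bar>Arg z\<bar>)" using Z[OF p] b by (intro sum_pos) auto
    then show "0 < m A B" using card[OF p] by (simp add: m_def mean_angle_def)
    have "(\<Sum>z\<in>Z A B. \<bar>Arg z\<bar>) < (\<Sum>z\<in>Z A B. pi)" using Z[OF p] b by (intro sum_strict_mono) auto
    then show "m A B < pi" using card[OF p] by (simp add: m_def mean_angle_def divide_less_eq mult.commute)
  qed
  have ne: "cohyp A \<noteq> cohyp B" "cohyp A \<noteq> opp (cohyp B)" if p: "P A B" for A B
  proof -
    have c: "A \<noteq> c *\<^sub>R B" for c using P[OF p] by blast
    show "cohyp A \<noteq> cohyp B" using cohyp_eqD c by metis
    show "cohyp A \<noteq> opp (cohyp B)"
    proof
      assume "cohyp A = opp (cohyp B)"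
      then obtain k where "A = k *\<^sub>R (- B)" unfolding opp_cohyp using cohyp_eqD by blast
      then show False using c[of "- k"] by simp
    qed
  qed

  \<comment> \<open>An angle has co-oriented hyperplanes as arguments, so normals are chosen;
    \<open>scale\<close> makes the value independent of the choice.\<close>
  define rep :: "'n cohyp \<Rightarrow> real^'n^'n" where "rep \<sigma> = (SOME A. \<sigma> = cohyp A)" for \<sigma>
  define \<theta> where "\<theta> \<sigma> \<tau> = m (rep \<sigma>) (rep \<tau>)" for \<sigma> \<tau>
  have rep: "\<exists>c>0. rep (cohyp A) = c *\<^sub>R A" for A
  proof -
    have "cohyp A = cohyp (rep (cohyp A))" unfolding rep_def by (rule someI[of _ A]) simp
    from cohyp_eqD[OF this[symmetric]] show ?thesis .
  qed
  have \<theta>: "\<theta> (cohyp A) (cohyp B) = m A B" if "P A B" for A B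
  proof -
    obtain a b where "a > 0" "rep (cohyp A) = a *\<^sub>R A" "b > 0" "rep (cohyp B) = b *\<^sub>R B"
      using rep by blast
    then show ?thesis using scale(2)[OF that] by (simp add: \<theta>_def)
  qed
  have D: "(cohyp A, cohyp B) \<in> ?D" if "P A B" for A B using that by blast
  have closed: "(\<forall>g\<in>SL. (act g \<sigma>, act g \<tau>) \<in> ?D) \<and> (\<tau>, \<sigma>) \<in> ?D \<and> (opp \<sigma>, \<tau>) \<in> ?D \<and>
      (\<forall>\<rho>. lies_between \<rho> \<sigma> \<tau> \<longrightarrow> (\<sigma>, \<rho>) \<in> ?D \<and> (\<rho>, \<tau>) \<in> ?D)"
    and vals: "0 \<le> \<theta> \<sigma> \<tau> \<and> \<theta> \<sigma> \<tau> \<le> pi \<and> (\<theta> \<sigma> \<tau> = 0 \<longleftrightarrow> \<sigma> = \<tau>) \<and> (\<theta> \<sigma> \<tau> = pi \<longleftrightarrow> \<sigma> = opp \<tau>)"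
    and invar: "\<forall>g\<in>SL. \<theta> (act g \<sigma>) (act g \<tau>) = \<theta> \<sigma> \<tau>"
    and symm: "\<theta> \<tau> \<sigma> = \<theta> \<sigma> \<tau> \<and> \<theta> (opp \<sigma>) \<tau> = pi - \<theta> \<sigma> \<tau>"
    and addit: "\<forall>\<rho>. lies_between \<rho> \<sigma> \<tau> \<longrightarrow> \<theta> \<sigma> \<rho> + \<theta> \<rho> \<tau> = \<theta> \<sigma> \<tau>"
    if st: "(\<sigma>, \<tau>) \<in> ?D" for \<sigma> \<tau>
  proof -
    obtain A B where AB: "\<sigma> = cohyp A" "\<tau> = cohyp B" and p: "P A B" using st by blast
    have btw: "(\<sigma>, \<rho>) \<in> ?D \<and> (\<rho>, \<tau>) \<in> ?D \<and> \<theta> \<sigma> \<rho> + \<theta> \<rho> \<tau> = \<theta> \<sigma> \<tau>" if "lies_between \<rho> \<sigma> \<tau>" for \<rho>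
    proof -
      obtain a b where ab: "a > 0" "b > 0" "is_normal (a *\<^sub>R A + b *\<^sub>R B)" "\<rho> = cohyp (a *\<^sub>R A + b *\<^sub>R B)"
        using \<open>lies_between \<rho> \<sigma> \<tau>\<close> unfolding AB by (rule lies_between_cohypD)
      note b = between[OF p ab(1-3)]
      show ?thesis unfolding AB ab(4) \<theta>[OF p] \<theta>[OF b(1)] \<theta>[OF b(2)] using D b by blast
    qed
    show "(\<forall>g\<in>SL. (act g \<sigma>, act g \<tau>) \<in> ?D) \<and> (\<tau>, \<sigma>) \<in> ?D \<and> (opp \<sigma>, \<tau>) \<in> ?D \<and>
      (\<forall>\<rho>. lies_between \<rho> \<sigma> \<tau> \<longrightarrow> (\<sigma>, \<rho>) \<in> ?D \<and> (\<rho>, \<tau>) \<in> ?D)"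
    proof (intro conjI ballI)
      fix g :: "real^'n^'n" assume "g \<in> SL"
      then show "(act g \<sigma>, act g \<tau>) \<in> ?D" using act[OF p] D by (simp only: AB act_cohyp)
    next
      show "(\<tau>, \<sigma>) \<in> ?D" unfolding AB using swap[OF p] D by blast
      show "(opp \<sigma>, \<tau>) \<in> ?D" unfolding AB opp_cohyp using minus[OF p] D by blast
    qed (use btw in iprover)
    show "0 \<le> \<theta> \<sigma> \<tau> \<and> \<theta> \<sigma> \<tau> \<le> pi \<and> (\<theta> \<sigma> \<tau> = 0 \<longleftrightarrow> \<sigma> = \<tau>) \<and> (\<theta> \<sigma> \<tau> = pi \<longleftrightarrow> \<sigma> = opp \<tau>)"
      using range[OF p] ne[OF p] by (simp add: AB \<theta>[OF p])
    show "\<forall>g\<in>SL. \<theta> (act g \<sigma>) (act g \<tau>) = \<theta> \<sigma> \<tau>"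
      using act[OF p] \<theta> p by (simp add: AB act_cohyp m_def)
    show "\<theta> \<tau> \<sigma> = \<theta> \<sigma> \<tau> \<and> \<theta> (opp \<sigma>) \<tau> = pi - \<theta> \<sigma> \<tau>"
      using swap[OF p] minus[OF p] \<theta> p by (simp add: AB opp_cohyp)
    show "\<forall>\<rho>. lies_between \<rho> \<sigma> \<tau> \<longrightarrow> \<theta> \<sigma> \<rho> + \<theta> \<rho> \<tau> = \<theta> \<sigma> \<tau>" using btw by iprover
  qed
  have sub: "?D \<subseteq> cohyps \<times> cohyps" using P is_normal_iff_cohyps by blast
  have "invariant_angle_function ?D \<theta>"
    unfolding invariant_angle_function_def
  proof (intro conjI)
    show "?D \<subseteq> cohyps \<times> cohyps" by (rule sub)
    show "\<forall>(\<sigma>\<^sub>1, \<sigma>\<^sub>2)\<in>?D. (\<forall>g\<in>SL. (act g \<sigma>\<^sub>1, act g \<sigma>\<^sub>2) \<in> ?D) \<and> (\<sigma>\<^sub>2, \<sigma>\<^sub>1) \<in> ?D \<and> (opp \<sigma>\<^sub>1, \<sigma>\<^sub>2) \<in> ?D \<and>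
        (\<forall>\<sigma>\<^sub>3. lies_between \<sigma>\<^sub>3 \<sigma>\<^sub>1 \<sigma>\<^sub>2 \<longrightarrow> (\<sigma>\<^sub>1, \<sigma>\<^sub>3) \<in> ?D \<and> (\<sigma>\<^sub>3, \<sigma>\<^sub>2) \<in> ?D)"
      by (rule ballI, split prod.split, intro allI impI, rule closed, simp only:)
    show "\<forall>(\<sigma>\<^sub>1, \<sigma>\<^sub>2)\<in>?D. 0 \<le> \<theta> \<sigma>\<^sub>1 \<sigma>\<^sub>2 \<and> \<theta> \<sigma>\<^sub>1 \<sigma>\<^sub>2 \<le> pi \<and> (\<theta> \<sigma>\<^sub>1 \<sigma>\<^sub>2 = 0 \<longleftrightarrow> \<sigma>\<^sub>1 = \<sigma>\<^sub>2) \<and>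
        (\<theta> \<sigma>\<^sub>1 \<sigma>\<^sub>2 = pi \<longleftrightarrow> \<sigma>\<^sub>1 = opp \<sigma>\<^sub>2)"
      by (rule ballI, split prod.split, intro allI impI, rule vals, simp only:)
    show "\<forall>(\<sigma>\<^sub>1, \<sigma>\<^sub>2)\<in>?D. \<forall>g\<in>SL. \<theta> (act g \<sigma>\<^sub>1) (act g \<sigma>\<^sub>2) = \<theta> \<sigma>\<^sub>1 \<sigma>\<^sub>2"
      by (rule ballI, split prod.split, intro allI impI, rule invar, simp only:)
    show "\<forall>(\<sigma>\<^sub>1, \<sigma>\<^sub>2)\<in>?D. \<theta> \<sigma>\<^sub>2 \<sigma>\<^sub>1 = \<theta> \<sigma>\<^sub>1 \<sigma>\<^sub>2 \<and> \<theta> (opp \<sigma>\<^sub>1) \<sigma>\<^sub>2 = pi - \<theta> \<sigma>\<^sub>1 \<sigma>\<^sub>2"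
      by (rule ballI, split prod.split, intro allI impI, rule symm, simp only:)
    show "\<forall>(\<sigma>\<^sub>1, \<sigma>\<^sub>3)\<in>?D. \<forall>\<sigma>\<^sub>2. lies_between \<sigma>\<^sub>2 \<sigma>\<^sub>1 \<sigma>\<^sub>3 \<longrightarrow> \<theta> \<sigma>\<^sub>1 \<sigma>\<^sub>2 + \<theta> \<sigma>\<^sub>2 \<sigma>\<^sub>3 = \<theta> \<sigma>\<^sub>1 \<sigma>\<^sub>3"
      by (rule ballI, split prod.split, intro allI impI, rule addit[THEN spec, THEN mp], simp only:)
  qed
  moreover have "\<forall>A B. P A B \<longrightarrow> \<theta> (cohyp A) (cohyp B) = mean_angle (Z A B)"
    using \<theta> by (simp add: m_def)
  ultimately show ?thesis by blast
qed

section \<open>Nonreal eigenvalues\<close>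

lemma pencil_cmat: "pencil A B z = cmat A - mat z ** cmat B"
  by (simp add: pencil_def vec_eq_iff mat_mult_entry) (simp add: cmat_def)

lemma det_act_normal:
  assumes "g \<in> SL" shows "det (act_normal g A) = det A"
  using SL_matrix_inv[OF assms] by (simp add: act_normal_def det_mul det_transpose SL_def)

lemma det_pencil_act_normal:
  assumes "g \<in> SL"
  shows "det (pencil (act_normal g A) (act_normal g B) z) = det (pencil A B z)"
proof -
  define F where "F = matrix_inv g"
  have F: "det F = 1" using SL_matrix_inv[OF assms] by (simp add: F_def SL_def)
  have "mat z ** (cmat F ** cmat B ** cmat (transpose F)) = cmat F ** (mat z ** cmat B) ** cmat (transpose F)"
    by (metis mat_commute matrix_mul_assoc)
  then have "pencil (act_normal g A) (act_normal g B) z = cmat F ** pencil A B z ** cmat (transpose F)"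
    by (simp add: act_normal_def pencil_cmat cmat_mult matrix_sub_ldistrib matrix_sub_rdistrib flip: F_def)
  then show ?thesis by (simp add: det_mul det_cmat det_transpose F)
qed

lemma gen_eigenvalues_act_normal:
  assumes "g \<in> SL" shows "gen_eigenvalues (act_normal g A) (act_normal g B) = gen_eigenvalues A B"
  by (simp add: gen_eigenvalues_def invertible_det_nz det_pencil_act_normal[OF assms] det_act_normal[OF assms])

lemma is_normal_act_normal:
  assumes "g \<in> SL" "is_normal A" shows "is_normal (act_normal g A)"
  using act_in[of "cohyp A" g] assms by (simp add: is_normal_iff_cohyps act_cohyp)

lemma regular_normals_act_normal:
  assumes "g \<in> SL" "regular_normals A B"
  shows "regular_normals (act_normal g A) (act_normal g B)"
  using assms is_normal_act_normal
  by (auto simp: regular_normals_def regular_pencil_def det_pencil_act_normal)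

lemma moebius_nonreal:
  assumes "z \<notin> \<real>" "a * d - b * c \<noteq> 0" shows "moebius a b c d z \<notin> \<real>"
proof
  assume r: "moebius a b c d z \<in> \<real>"
  then obtain x where x: "moebius a b c d z = of_real x" by (auto elim: Reals_cases)
  have "of_real a * z + of_real b = of_real x * (of_real c * z + of_real d)"
    using moebius_denominator[OF assms] x by (simp add: moebius_def divide_eq_eq)
  then have "Im (of_real a * z + of_real b) = Im (of_real x * (of_real c * z + of_real d))"
    "Re (of_real a * z + of_real b) = Re (of_real x * (of_real c * z + of_real d))" by simp_all
  then have "(a - x * c) * Im z = 0" "(a - x * c) * Re z = x * d - b" by (simp_all add: algebra_simps)
  then have "a = x * c" "b = x * d" using assms(1) by (auto simp: complex_is_Real_iff)
  then show False using assms(2) by simp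
qed

lemma moebius_inverse:
  assumes "w \<notin> \<real>" "a * d - b * c \<noteq> 0"
  shows "moebius a b c d (moebius d (- b) (- c) a w) = w"
proof -
  let ?e = "of_real (- c) * w + of_real a" and ?D = "of_real (a * d - b * c) :: complex"
  have e: "?e \<noteq> 0" using moebius_denominator[of w d a "- b" "- c"] assms by (simp add: mult.commute)
  have "of_real a * (of_real d * w + of_real (- b)) + of_real b * ?e = ?D * w"
    "of_real c * (of_real d * w + of_real (- b)) + of_real d * ?e = ?D"
    by (simp_all add: algebra_simps)
  moreover have "moebius a b c d (n / ?e) = (of_real a * n + of_real b * ?e) / (of_real c * n + of_real d * ?e)" for n
  proof -
    have "of_real x * (n / ?e) + of_real y = (of_real x * n + of_real y * ?e) / ?e" for x y
      using e by (simp add: add_divide_distrib)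
    then show ?thesis using e by (simp add: moebius_def)
  qed
  ultimately have "moebius a b c d (moebius d (- b) (- c) a w) = ?D * w / ?D"
    by (simp only: moebius_def[of d])
  moreover have D: "?D \<noteq> 0" using assms(2) by (simp only: of_real_eq_0_iff not_False_eq_True)
  ultimately show ?thesis by (simp only: nonzero_mult_div_cancel_left[OF D])
qed

text \<open>The equivalence gives one inclusion at once. For the other one, points are pulled back
  by the adjugate matrix, whose Moebius map preserves nonreal numbers as well.\<close>

lemma eq_moebius_image:
  assumes "Z \<inter> \<real> = {}" "Z' \<inter> \<real> = {}" and D: "a * d - b * c \<noteq> 0"
    and iff: "\<And>z. z \<notin> \<real> \<Longrightarrow> moebius a b c d z \<in> Z' \<longleftrightarrow> z \<in> Z"
  shows "Z' = moebius a b c d ` Z"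
proof (intro equalityI subsetI)
  fix w assume w: "w \<in> Z'"
  then have r: "w \<notin> \<real>" using assms(2) by blast
  let ?z = "moebius d (- b) (- c) a w"
  have "?z \<notin> \<real>" using moebius_nonreal[of w d a "- b" "- c"] r D by (simp add: mult.commute)
  then show "w \<in> moebius a b c d ` Z"
    using iff[of ?z] w moebius_inverse[OF r D] by (metis image_eqI)
qed (use assms in blast)

text \<open>(c z + d) (a A + b B) - (a z + b) (c A + d B) = (a d - b c) (A - z B).\<close>

lemma det_pencil_moebius:
  fixes A B :: "real^'n^'n"
  assumes "of_real c * z + of_real d \<noteq> (0 :: complex)" "a * d - b * c \<noteq> 0"
  shows "det (pencil (a *\<^sub>R A + b *\<^sub>R B) (c *\<^sub>R A + d *\<^sub>R B) (moebius a b c d z)) = 0 \<longleftrightarrow> det (pencil A B z) = 0"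
proof -
  let ?e = "of_real c * z + of_real d :: complex"
  let ?M = "pencil (a *\<^sub>R A + b *\<^sub>R B) (c *\<^sub>R A + d *\<^sub>R B) (moebius a b c d z)"
  have "?e * ?M $ i $ j = of_real (a * d - b * c) * pencil A B z $ i $ j" for i j
  proof -
    have "?e * ?M $ i $ j = ?e * complex_of_real (a * A $ i $ j + b * B $ i $ j)
        - ?e * moebius a b c d z * of_real (c * A $ i $ j + d * B $ i $ j)"
      by (simp add: pencil_def right_diff_distrib)
    also have "?e * moebius a b c d z = of_real a * z + of_real b"
      using assms(1) by (simp add: moebius_def)
    finally show ?thesis by (simp add: pencil_def algebra_simps)
  qed
  then have "(\<chi> i j. ?e * ?M $ i $ j) = (\<chi> i j. of_real (a * d - b * c) * pencil A B z $ i $ j)"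
    by simp
  then have "?e ^ CARD('n) * det ?M = of_real (a * d - b * c) ^ CARD('n) * det (pencil A B z)"
    by (metis det_smult_rows)
  then show ?thesis using assms
    by (metis mult_eq_0_iff of_real_eq_0_iff power_not_zero)
qed

text \<open>A point of the line Im z = 1 that is no eigenvalue is transported; being nonreal, it
  meets no pole of the Moebius map.\<close>

lemma regular_pencil_lincomb:
  assumes "regular_pencil A B" "a * d - b * c \<noteq> 0"
  shows "regular_pencil (a *\<^sub>R A + b *\<^sub>R B) (c *\<^sub>R A + d *\<^sub>R B)"
proof -
  have "finite (Fin -` gen_eigenvalues A B)"
    by (intro finite_vimageI finite_gen_eigenvalues assms) (simp add: inj_def)
  moreover have "infinite (range (\<lambda>x. Complex x 1))"
    using infinite_UNIV_char_0[where 'a=real] finite_imageD[of "\<lambda>x. Complex x 1" UNIV] by (auto simp: inj_on_def)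
  ultimately obtain x where "Complex x 1 \<notin> Fin -` gen_eigenvalues A B"
    by (metis finite_subset image_subset_iff)
  then have "det (pencil A B (Complex x 1)) \<noteq> 0" by (simp add: Fin_gen_eigenvalues)
  moreover have "Complex x 1 \<notin> \<real>" by (simp add: complex_is_Real_iff)
  ultimately show ?thesis
    using det_pencil_moebius[OF moebius_denominator assms(2)] assms(2) unfolding regular_pencil_def by blast
qed

lemma nonreal_eigenvalues_moebius:
  assumes "a * d - b * c \<noteq> 0"
  shows "nonreal_eigenvalues (a *\<^sub>R A + b *\<^sub>R B) (c *\<^sub>R A + d *\<^sub>R B) = moebius a b c d ` nonreal_eigenvalues A B"
proof (rule eq_moebius_image[OF _ _ assms])
  fix z :: complex assume z: "z \<notin> \<real>"
  show "moebius a b c d z \<in> nonreal_eigenvalues (a *\<^sub>R A + b *\<^sub>R B) (c *\<^sub>R A + d *\<^sub>R B) \<longleftrightarrow> z \<in> nonreal_eigenvalues A B"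
    using z moebius_nonreal[OF z assms] det_pencil_moebius[OF moebius_denominator[OF z assms] assms]
    by (simp add: nonreal_eigenvalues_def Fin_gen_eigenvalues)
qed (auto simp: nonreal_eigenvalues_def)

lemma finite_nonreal_eigenvalues:
  assumes "regular_pencil A B" shows "finite (nonreal_eigenvalues A B)"
proof (rule finite_subset)
  show "nonreal_eigenvalues A B \<subseteq> Fin -` gen_eigenvalues A B" by (auto simp: nonreal_eigenvalues_def)
  show "finite (Fin -` gen_eigenvalues A B)"
    by (intro finite_vimageI finite_gen_eigenvalues assms) (simp add: inj_def)
qed

text \<open>|Arg| is invariant under conjugation, so averaging over all 2 k numbers equals averaging
  over one of each conjugate pair.\<close>

lemma mean_angle_enumerates_nonreal:
  assumes "enumerates_nonreal A B k l"
  shows "mean_angle (nonreal_eigenvalues A B) = (1 / real k) * (\<Sum>i=1..k. \<bar>Arg (l i)\<bar>)"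
proof -
  let ?L = "l ` {1..k}"
  have e: "inj_on l {1..k}" "?L \<inter> cnj ` ?L = {}" "nonreal_eigenvalues A B = ?L \<union> cnj ` ?L"
    using assms by (auto simp: enumerates_nonreal_def)
  have c: "inj_on cnj ?L" by (simp add: inj_on_def)
  have "(\<Sum>z\<in>cnj ` ?L. \<bar>Arg z\<bar>) = (\<Sum>z\<in>?L. \<bar>Arg z\<bar>)"
    unfolding sum.reindex[OF c] by (simp add: abs_Arg_cnj)
  moreover have "(\<Sum>z\<in>?L. \<bar>Arg z\<bar>) = (\<Sum>i=1..k. \<bar>Arg (l i)\<bar>)"
    unfolding sum.reindex[OF e(1)] by simp
  ultimately have "(\<Sum>z\<in>?L \<union> cnj ` ?L. \<bar>Arg z\<bar>) = 2 * (\<Sum>i=1..k. \<bar>Arg (l i)\<bar>)"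
    using e(2) by (subst sum.union_disjoint) simp_all
  moreover have "card (cnj ` ?L) = k" "card ?L = k" using card_image[OF c] card_image[OF e(1)] by simp_all
  then have "card (?L \<union> cnj ` ?L) = 2 * k"
    using e(2) by (subst card_Un_disjoint) simp_all
  ultimately show ?thesis by (simp add: mean_angle_def e(3))
qed

lemma regular_normals_not_proportional:
  assumes "regular_normals A B" "\<not> gen_eigenvalues A B \<subseteq> {Fin (complex_of_real c)}"
  shows "A \<noteq> c *\<^sub>R B"
  using gen_eigenvalues_proportional assms by (auto simp: regular_normals_def)

lemma nonreal_invariant_angle:
  "\<exists>\<theta>. invariant_angle_function
      {(cohyp A, cohyp B) | (A :: real^'n^'n) (B :: real^'n^'n). nonreal_case A B} \<theta> \<and>
    (\<forall>(A :: real^'n^'n) B. nonreal_case A B \<longrightarrow>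
        \<theta> (cohyp A) (cohyp B) = mean_angle (nonreal_eigenvalues A B))"
  proof (rule invariant_angle_function_of_equivariant_set[of nonreal_case nonreal_eigenvalues])
    fix A B :: "real^'n^'n" assume p: "nonreal_case A B"
    then have r: "regular_normals A B" and z: "nonreal_eigenvalues A B \<noteq> {}" by (simp_all add: nonreal_case_def)
    have "A \<noteq> c *\<^sub>R B" for c
    proof (rule regular_normals_not_proportional[OF r])
      show "\<not> gen_eigenvalues A B \<subseteq> {Fin (complex_of_real c)}"
        using z by (auto simp: nonreal_eigenvalues_def)
    qed
    then show "is_normal A \<and> is_normal B \<and> (\<forall>c. A \<noteq> c *\<^sub>R B)" using r by (simp add: regular_normals_def)
    show "finite (nonreal_eigenvalues A B) \<and> nonreal_eigenvalues A B \<noteq> {} \<and> nonreal_eigenvalues A B \<inter> \<real> = {}"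
      using z r finite_nonreal_eigenvalues by (auto simp: regular_normals_def nonreal_eigenvalues_def)
    show "nonreal_case (act_normal g A) (act_normal g B) \<and>
      nonreal_eigenvalues (act_normal g A) (act_normal g B) = nonreal_eigenvalues A B" if "g \<in> SL" for g
      using p regular_normals_act_normal[OF that]
      by (simp add: nonreal_case_def nonreal_eigenvalues_def gen_eigenvalues_act_normal[OF that])
    show "nonreal_case (a *\<^sub>R A + b *\<^sub>R B) (c *\<^sub>R A + d *\<^sub>R B) \<and>
      nonreal_eigenvalues (a *\<^sub>R A + b *\<^sub>R B) (c *\<^sub>R A + d *\<^sub>R B) = moebius a b c d ` nonreal_eigenvalues A B"
      if "a * d - b * c \<noteq> 0" "is_normal (a *\<^sub>R A + b *\<^sub>R B)" "is_normal (c *\<^sub>R A + d *\<^sub>R B)" for a b c d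
      using r z that regular_pencil_lincomb[of A B, OF _ that(1)]
      by (simp add: nonreal_case_def regular_normals_def nonreal_eigenvalues_moebius)
  qed

section \<open>The quadratic form of a cyclically ordered set of points\<close>

text \<open>The determinant of two vectors; on (s, 1) and (t, 1) it is s - t. Vectors stand for
  points of the projective line, (1, 0) for infinity.\<close>

definition wedge :: "real \<times> real \<Rightarrow> real \<times> real \<Rightarrow> real" where
  "wedge p q = fst p * snd q - snd p * fst q"

text \<open>For points in cyclic order on the projective line, the good pairs with distinct entries are the pairs
  \<open>(next p, p)\<close>. Stating this by signs makes the invariance under linear maps visible. Pairs \<open>(p, p)\<close> are
  good as well, but contribute nothing because \<open>x / 0 = 0\<close>.\<close>

definition good_pairs :: "(real \<times> real) set \<Rightarrow> ((real \<times> real) \<times> (real \<times> real)) set" where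
  "good_pairs L = {(p, q) \<in> L \<times> L. \<forall>r\<in>L. wedge r p * wedge r q / wedge p q \<ge> 0}"

text \<open>For p = (s, 1), q = (t, 1) and y = 1 this is (x - s) (x - t) / (s - t). Rescaling p or q
  by a nonzero factor does not change it.\<close>

definition pair_form :: "(real \<times> real) \<times> (real \<times> real) \<Rightarrow> complex \<Rightarrow> complex \<Rightarrow> complex" where
  "pair_form pq x y = (case pq of (p, q) \<Rightarrow>
     (x * of_real (snd p) - y * of_real (fst p)) * (x * of_real (snd q) - y * of_real (fst q)) / of_real (wedge p q))"

definition form :: "(real \<times> real) set \<Rightarrow> complex \<Rightarrow> complex \<Rightarrow> complex" where
  "form L x y = (\<Sum>pq\<in>good_pairs L. pair_form pq x y)"

definition linmap :: "real \<Rightarrow> real \<Rightarrow> real \<Rightarrow> real \<Rightarrow> real \<times> real \<Rightarrow> real \<times> real" where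
  "linmap a b c d p = (a * fst p + b * snd p, c * fst p + d * snd p)"

lemma wedge_lin: "wedge (linmap a b c d p) (linmap a b c d q) = (a * d - b * c) * wedge p q"
  by (simp add: wedge_def linmap_def algebra_simps)

lemma wedge_scaleR: "wedge (s *\<^sub>R p) (t *\<^sub>R q) = s * t * wedge p q"
  by (simp add: wedge_def algebra_simps)

lemma wedge_swap: "wedge q p = - wedge p q"
  by (simp add: wedge_def)

lemma pair_form_swap: "pair_form (q, p) x y = - pair_form (p, q) x y"
  by (simp add: pair_form_def wedge_swap[of q p] mult.commute)

text \<open>Each of the two linear factors and the denominator acquire the factor a d - b c, and s,
  t cancel; one determinant survives.\<close>

lemma pair_form_lin:
  assumes "s \<noteq> 0" "t \<noteq> 0" "a * d - b * c \<noteq> 0"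
  shows "pair_form (s *\<^sub>R linmap a b c d p, t *\<^sub>R linmap a b c d q)
      (of_real a * x + of_real b * y) (of_real c * x + of_real d * y)
    = of_real (a * d - b * c) * pair_form (p, q) x y"
proof -
  let ?D = "of_real (a * d - b * c) :: complex"
  let ?u = "\<lambda>p. x * of_real (snd p) - y * of_real (fst p) :: complex"
  have "(of_real a * x + of_real b * y) * of_real (snd (s *\<^sub>R linmap a b c d p))
     - (of_real c * x + of_real d * y) * of_real (fst (s *\<^sub>R linmap a b c d p)) = of_real s * ?D * ?u p" for s p
    by (simp add: linmap_def algebra_simps)
  then have "pair_form (s *\<^sub>R linmap a b c d p, t *\<^sub>R linmap a b c d q)
      (of_real a * x + of_real b * y) (of_real c * x + of_real d * y)
     = (of_real s * ?D * ?u p) * (of_real t * ?D * ?u q) / (of_real s * of_real t * ?D * of_real (wedge p q))"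
    by (simp add: pair_form_def wedge_scaleR wedge_lin)
  also have "\<dots> = ((of_real s * of_real t * ?D) * (?D * (?u p * ?u q))) / ((of_real s * of_real t * ?D) * of_real (wedge p q))"
    by (simp only: mult_ac)
  also have "\<dots> = ?D * (?u p * ?u q) / of_real (wedge p q)"
    by (rule nonzero_mult_divide_mult_cancel_left) (use assms in \<open>simp del: of_real_diff\<close>)
  finally show ?thesis by (simp add: pair_form_def)
qed

lemma good_pairs_sign_lin:
  assumes "s \<noteq> 0" "t \<noteq> 0" "u \<noteq> 0" "a * d - b * c \<noteq> 0"
  shows "wedge (u *\<^sub>R linmap a b c d r) (s *\<^sub>R linmap a b c d p) * wedge (u *\<^sub>R linmap a b c d r) (t *\<^sub>R linmap a b c d q)
      / wedge (s *\<^sub>R linmap a b c d p) (t *\<^sub>R linmap a b c d q)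
    = u\<^sup>2 * ((a * d - b * c) * (wedge r p * wedge r q / wedge p q))"
  using assms by (simp add: wedge_scaleR wedge_lin power2_eq_square)

text \<open>A map of negative determinant reverses the cyclic order, so good pairs correspond after
  swapping their entries. Swapping also changes the sign of \<open>pair_form\<close>, which turns
  the determinant into its absolute value.\<close>

lemma form_lin:
  assumes fin: "finite L" and inj: "inj_on h L"
    and h: "\<And>p. p \<in> L \<Longrightarrow> \<exists>s. s \<noteq> 0 \<and> h p = s *\<^sub>R linmap a b c d p" and D: "a * d - b * c \<noteq> 0"
  shows "form (h ` L) (of_real a * x + of_real b * y) (of_real c * x + of_real d * y)
    = of_real \<bar>a * d - b * c\<bar> * form L x y"
proof -
  let ?D = "a * d - b * c"
  define \<phi> where "\<phi> = (\<lambda>(p, q). if ?D > 0 then (h p, h q) else (h q, h p))"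
  obtain s where s: "\<And>p. p \<in> L \<Longrightarrow> s p \<noteq> 0 \<and> h p = s p *\<^sub>R linmap a b c d p" using h by metis
  have inj\<phi>: "inj_on \<phi> (L \<times> L)"
    using inj by (auto simp: inj_on_def \<phi>_def split: if_splits)
  have img: "\<phi> ` (L \<times> L) = h ` L \<times> h ` L"
  proof (intro equalityI subsetI)
    fix x assume "x \<in> h ` L \<times> h ` L"
    then obtain p q where "p \<in> L" "q \<in> L" "x = (h p, h q)" by blast
    then have "x = \<phi> (if ?D > 0 then (p, q) else (q, p))" "(if ?D > 0 then (p, q) else (q, p)) \<in> L \<times> L"
      by (auto simp: \<phi>_def)
    then show "x \<in> \<phi> ` (L \<times> L)" by (rule image_eqI)
  qed (auto simp: \<phi>_def split: if_splits)
  have good: "\<phi> (p, q) \<in> good_pairs (h ` L) \<longleftrightarrow> (p, q) \<in> good_pairs L" if pq: "p \<in> L" "q \<in> L" for p q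
  proof -
    have e: "wedge (h r) (h p) * wedge (h r) (h q) / wedge (h p) (h q) = (s r)\<^sup>2 * (?D * (wedge r p * wedge r q / wedge p q))"
      if "r \<in> L" "p \<in> L" "q \<in> L" for r p q
      using good_pairs_sign_lin[OF _ _ _ D] s[OF that(1)] s[OF that(2)] s[OF that(3)] by simp
    have s2: "(s r)\<^sup>2 > 0" if "r \<in> L" for r using s[OF that] by simp
    show ?thesis
    proof (cases "?D > 0")
      case True
      then have z: "0 \<le> (s r)\<^sup>2 * (?D * z) \<longleftrightarrow> 0 \<le> z" if "r \<in> L" for r z
        using s2[OF that] by (simp add: zero_le_mult_iff)
      have "wedge (h r) (h p) * wedge (h r) (h q) / wedge (h p) (h q) \<ge> 0 \<longleftrightarrow> 0 \<le> wedge r p * wedge r q / wedge p q"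
        if "r \<in> L" for r
        unfolding e[OF that pq] by (rule z[OF that])
      with True show ?thesis using pq by (simp add: good_pairs_def \<phi>_def)
    next
      case False
      have z: "0 \<le> (s r)\<^sup>2 * (?D * (wedge r q * wedge r p / wedge q p)) \<longleftrightarrow> 0 \<le> wedge r p * wedge r q / wedge p q" if "r \<in> L" for r
      proof -
        have m: "wedge r q * wedge r p / wedge q p = - (wedge r p * wedge r q / wedge p q)"
          unfolding wedge_swap[of q p] by (simp add: mult.commute)
        have "(s r)\<^sup>2 * (?D * (wedge r q * wedge r p / wedge q p)) = (s r)\<^sup>2 * ((- ?D) * (wedge r p * wedge r q / wedge p q))"
          unfolding m by (simp only: mult_minus_left mult_minus_right)
        then show ?thesis using s2[OF that] False D by (simp only: zero_le_mult_iff) auto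
      qed
      have "wedge (h r) (h q) * wedge (h r) (h p) / wedge (h q) (h p) \<ge> 0 \<longleftrightarrow> 0 \<le> wedge r p * wedge r q / wedge p q"
        if "r \<in> L" for r
        unfolding e[OF that pq(2,1)] by (rule z[OF that])
      with False show ?thesis using pq by (simp add: good_pairs_def \<phi>_def)
    qed
  qed
  have sub: "good_pairs L \<subseteq> L \<times> L" for L by (auto simp: good_pairs_def)
  have gimg: "good_pairs (h ` L) = \<phi> ` good_pairs L"
  proof (intro equalityI subsetI)
    fix x assume x: "x \<in> good_pairs (h ` L)"
    then obtain p q where "p \<in> L" "q \<in> L" "x = \<phi> (p, q)" using sub[of "h ` L"] img by blast
    then show "x \<in> \<phi> ` good_pairs L" using good x by blast
  next
    fix x assume "x \<in> \<phi> ` good_pairs L"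
    then show "x \<in> good_pairs (h ` L)" using good sub[of L] by auto
  qed
  have "form (h ` L) (of_real a * x + of_real b * y) (of_real c * x + of_real d * y)
    = (\<Sum>pq\<in>good_pairs L. pair_form (\<phi> pq) (of_real a * x + of_real b * y) (of_real c * x + of_real d * y))"
    unfolding form_def gimg by (subst sum.reindex) (auto intro: inj_on_subset[OF inj\<phi> sub])
  also have "\<dots> = (\<Sum>pq\<in>good_pairs L. of_real \<bar>?D\<bar> * pair_form pq x y)"
  proof (rule sum.cong[OF refl])
    fix pq assume "pq \<in> good_pairs L"
    then obtain p q where pq: "pq = (p, q)" "p \<in> L" "q \<in> L" using sub[of L] by blast
    note e = pair_form_lin[OF s[OF pq(2), THEN conjunct1] s[OF pq(3), THEN conjunct1] D, of p q, folded
        s[OF pq(2), THEN conjunct2] s[OF pq(3), THEN conjunct2]]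
    show "pair_form (\<phi> pq) (of_real a * x + of_real b * y) (of_real c * x + of_real d * y) = of_real \<bar>?D\<bar> * pair_form pq x y"
    proof (cases "?D > 0")
      case True
      then show ?thesis using e by (simp add: pq(1) \<phi>_def)
    next
      case False
      then have "of_real \<bar>?D\<bar> = - (of_real ?D :: complex)" by simp
      then show ?thesis using False e unfolding pq(1) \<phi>_def by (simp add: pair_form_swap[of "h q"] algebra_simps)
    qed
  qed
  finally show ?thesis by (simp add: form_def sum_distrib_left)
qed

lemma form_scale: "form L (k * x) (k * y) = k\<^sup>2 * form L x y"
  by (simp add: form_def sum_distrib_left pair_form_def case_prod_unfold power2_eq_square algebra_simps)

text \<open>The coefficients of x^2, - x y and y^2 in \<open>pair_form\<close>. On (s, 1) and (t, 1)
  the three definitions give 1, s + t and s t, each divided by s - t.\<close>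

definition quad_coeff :: "(real \<times> real) \<times> (real \<times> real) \<Rightarrow> real" where
  "quad_coeff pq = snd (fst pq) * snd (snd pq) / wedge (fst pq) (snd pq)"

definition mid_coeff :: "(real \<times> real) \<times> (real \<times> real) \<Rightarrow> real" where
  "mid_coeff pq = (fst (fst pq) * snd (snd pq) + snd (fst pq) * fst (snd pq)) / wedge (fst pq) (snd pq)"

definition const_coeff :: "(real \<times> real) \<times> (real \<times> real) \<Rightarrow> real" where
  "const_coeff pq = fst (fst pq) * fst (snd pq) / wedge (fst pq) (snd pq)"

lemma pair_form_coeffs: "pair_form pq x y = of_real (quad_coeff pq) * x\<^sup>2 - of_real (mid_coeff pq) * (x * y) + of_real (const_coeff pq) * y\<^sup>2"
  by (cases pq) (simp add: pair_form_def quad_coeff_def mid_coeff_def const_coeff_def power2_eq_square algebra_simps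
      diff_divide_distrib add_divide_distrib)

lemma form_coeffs: "form L x y = of_real (sum quad_coeff (good_pairs L)) * x\<^sup>2 - of_real (sum mid_coeff (good_pairs L)) * (x * y)
    + of_real (sum const_coeff (good_pairs L)) * y\<^sup>2"
  by (simp add: form_def pair_form_coeffs sum.distrib sum_subtractf sum_distrib_right)

definition cyc_next :: "nat \<Rightarrow> nat \<Rightarrow> nat" where
  "cyc_next k i = (if i = k then 1 else i + 1)"

definition cyc_pair :: "nat \<Rightarrow> (nat \<Rightarrow> real \<times> real) \<Rightarrow> nat \<Rightarrow> (real \<times> real) \<times> (real \<times> real)" where
  "cyc_pair k v i = (v (cyc_next k i), v i)"

text \<open>For points (x, 1) the condition says that x increases. Infinity may come last, as the
  wedge of (1, 0) and (x, 1) is 1.\<close>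

definition cyclic_enum :: "nat \<Rightarrow> (nat \<Rightarrow> real \<times> real) \<Rightarrow> bool" where
  "cyclic_enum k v \<longleftrightarrow> 3 \<le> k \<and> (\<forall>i j. 1 \<le> i \<longrightarrow> i < j \<longrightarrow> j \<le> k \<longrightarrow> wedge (v j) (v i) > 0)"

text \<open>The sign of wedge (v i) (v j) is that of i - j. For b < a goodness of (v a, v b) thus
  means that no index lies strictly between b and a; for a < b it means that all indices lie between
  a and b, so a = 1 and b = k. Diagonal pairs drop out because f vanishes on them.\<close>

lemma sum_good_pairs:
  fixes f :: "(real \<times> real) \<times> (real \<times> real) \<Rightarrow> 'a::comm_monoid_add"
  assumes v: "cyclic_enum k v" and f: "\<And>p. f (p, p) = 0"
  shows "sum f (good_pairs (v ` {1..k})) = (\<Sum>i=1..k. f (cyc_pair k v i))"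
proof -
  have k: "3 \<le> k" and w: "wedge (v j) (v i) > 0" if "1 \<le> i" "i < j" "j \<le> k" for i j
    using v that by (auto simp: cyclic_enum_def)
  have k: "3 \<le> k" using v by (simp add: cyclic_enum_def)
  have w0: "wedge p p = 0" for p by (simp add: wedge_def)
  have wn: "wedge (v i) (v j) < 0" if "1 \<le> i" "i < j" "j \<le> k" for i j
    using w[OF that] wedge_swap[of "v i" "v j"] by simp
  have inj: "inj_on v {1..k}"
  proof (rule linorder_inj_onI)
    fix i j assume "i < j" "i \<in> {1..k}" "j \<in> {1..k}"
    then have "wedge (v j) (v i) > 0" using w by simp
    then show "v i \<noteq> v j" by (auto simp: w0)
  qed auto
  have good: "(v a, v b) \<in> good_pairs (v ` {1..k}) \<longleftrightarrow> a = cyc_next k b"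
    if ab: "a \<in> {1..k}" "b \<in> {1..k}" "a \<noteq> b" for a b
  proof -
    have g: "(v a, v b) \<in> good_pairs (v ` {1..k}) \<longleftrightarrow>
        (\<forall>r\<in>{1..k}. 0 \<le> wedge (v r) (v a) * wedge (v r) (v b) / wedge (v a) (v b))"
      using ab by (auto simp: good_pairs_def)
    have ws: "0 < wedge (v i) (v j) \<longleftrightarrow> j < i" "wedge (v i) (v j) < 0 \<longleftrightarrow> i < j" "wedge (v i) (v j) = 0 \<longleftrightarrow> i = j"
      if "i \<in> {1..k}" "j \<in> {1..k}" for i j
      using w[of i j] wn[of i j] w[of j i] wn[of j i] w0[of "v i"] that by (cases i j rule: linorder_cases; force)+
    have ws': "0 \<le> wedge (v i) (v j) \<longleftrightarrow> j \<le> i" "wedge (v i) (v j) \<le> 0 \<longleftrightarrow> i \<le> j"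
      if "i \<in> {1..k}" "j \<in> {1..k}" for i j
      using ws[OF that] by (simp_all add: le_less) (auto)
    show ?thesis
    proof (cases "b < a")
      case True
      have "(\<forall>r\<in>{1..k}. 0 \<le> wedge (v r) (v a) * wedge (v r) (v b) / wedge (v a) (v b)) \<longleftrightarrow>
        (\<forall>r\<in>{1..k}. a \<le> r \<or> r \<le> b)"
      proof (intro ball_cong refl)
        fix r assume "r \<in> {1..k}"
        then show "(0 \<le> wedge (v r) (v a) * wedge (v r) (v b) / wedge (v a) (v b)) = (a \<le> r \<or> r \<le> b)"
          using ab True ws[of a b] by (auto simp: zero_le_divide_iff zero_le_mult_iff ws' ws)
      qed
      also have "\<dots> \<longleftrightarrow> a = b + 1"
      proof
        assume *: "\<forall>r\<in>{1..k}. a \<le> r \<or> r \<le> b"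
        have "b + 1 \<in> {1..k}" using ab True by auto
        then show "a = b + 1" using * True by fastforce
      qed auto
      also have "\<dots> \<longleftrightarrow> a = cyc_next k b" using ab True by (auto simp: cyc_next_def)
      finally show ?thesis using g by simp
    next
      case False
      then have ab': "a < b" using ab(3) by simp
      have "(\<forall>r\<in>{1..k}. 0 \<le> wedge (v r) (v a) * wedge (v r) (v b) / wedge (v a) (v b)) \<longleftrightarrow>
        (\<forall>r\<in>{1..k}. a \<le> r \<and> r \<le> b)"
      proof (intro ball_cong refl)
        fix r assume "r \<in> {1..k}"
        then show "(0 \<le> wedge (v r) (v a) * wedge (v r) (v b) / wedge (v a) (v b)) = (a \<le> r \<and> r \<le> b)"
          using ab ab' ws[of a b] by (auto simp: zero_le_divide_iff mult_le_0_iff ws' ws)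
      qed
      also have "\<dots> \<longleftrightarrow> a = 1 \<and> b = k"
      proof
        assume *: "\<forall>r\<in>{1..k}. a \<le> r \<and> r \<le> b"
        have "1 \<in> {1..k}" "k \<in> {1..k}" using k by auto
        with * have "a \<le> 1" "k \<le> b" by blast+
        then show "a = 1 \<and> b = k" using ab by auto
      qed (use ab in auto)
      also have "\<dots> \<longleftrightarrow> a = cyc_next k b" using ab ab' k by (auto simp: cyc_next_def)
      finally show ?thesis using g by simp
    qed
  qed
  have nx: "cyc_next k i \<in> {1..k}" "cyc_next k i \<noteq> i" if "i \<in> {1..k}" for i
    using that k by (auto simp: cyc_next_def)
  have "sum f (good_pairs (v ` {1..k})) = sum f (cyc_pair k v ` {1..k})"
  proof (rule sum.mono_neutral_right)
    show "finite (good_pairs (v ` {1..k}))"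
      by (rule finite_subset[of _ "v ` {1..k} \<times> v ` {1..k}"]) (auto simp: good_pairs_def)
    show "cyc_pair k v ` {1..k} \<subseteq> good_pairs (v ` {1..k})"
    proof
      fix x assume "x \<in> cyc_pair k v ` {1..k}"
      then obtain i where i: "i \<in> {1..k}" "x = (v (cyc_next k i), v i)" by (auto simp: cyc_pair_def)
      then show "x \<in> good_pairs (v ` {1..k})" using good nx by blast
    qed
    show "\<forall>x\<in>good_pairs (v ` {1..k}) - cyc_pair k v ` {1..k}. f x = 0"
    proof
      fix x assume x: "x \<in> good_pairs (v ` {1..k}) - cyc_pair k v ` {1..k}"
      then obtain a b where ab: "a \<in> {1..k}" "b \<in> {1..k}" "x = (v a, v b)" by (auto simp: good_pairs_def)
      have "a = b"
      proof (rule ccontr)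
        assume "a \<noteq> b"
        then have "x = cyc_pair k v b" using good[OF ab(1,2)] x ab(3) by (simp add: cyc_pair_def)
        then show False using x ab(2) by blast
      qed
      then show "f x = 0" using ab f by simp
    qed
  qed
  also have "\<dots> = (\<Sum>i=1..k. f (cyc_pair k v i))"
  proof -
    have "inj_on (cyc_pair k v) {1..k}"
    proof (rule inj_onI)
      fix i j assume ij: "i \<in> {1..k}" "j \<in> {1..k}" and "cyc_pair k v i = cyc_pair k v j"
      then have "v i = v j" by (simp add: cyc_pair_def)
      then show "i = j" by (rule inj_onD[OF inj _ ij])
    qed
    then show ?thesis by (simp only: sum.reindex o_def)
  qed
  finally show ?thesis .
qed

section \<open>Positive definiteness and the roots of the form\<close>

definition canonical :: "real \<times> real \<Rightarrow> bool" where
  "canonical p \<longleftrightarrow> snd p = 1 \<or> p = (1, 0)"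

definition canon :: "real \<times> real \<Rightarrow> real \<times> real" where
  "canon p = (if snd p = 0 then (1, 0) else (fst p / snd p, 1))"

lemma canon_canonical: "canonical (canon p)"
  by (simp add: canonical_def canon_def)

lemma canon_scale: "p \<noteq> 0 \<Longrightarrow> \<exists>s. s \<noteq> 0 \<and> canon p = s *\<^sub>R p"
  by (cases "snd p = 0")
    (auto simp: canon_def prod_eq_iff intro: exI[of _ "1 / fst p"] exI[of _ "1 / snd p"])

lemma canonical_nz: "canonical p \<Longrightarrow> p \<noteq> 0"
  by (auto simp: canonical_def zero_prod_def)

lemma canonical_scale_eq: "canonical p \<Longrightarrow> canonical q \<Longrightarrow> p = s *\<^sub>R q \<Longrightarrow> p = q"
  by (auto simp: canonical_def prod_eq_iff)

lemma lin_lin: "linmap d (- b) (- c) a (linmap a b c d p) = (a * d - b * c) *\<^sub>R p"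
  by (simp add: linmap_def prod_eq_iff algebra_simps)

lemma lin_scaleR: "linmap a b c d (s *\<^sub>R p) = s *\<^sub>R linmap a b c d p"
  by (simp add: linmap_def prod_eq_iff algebra_simps)

lemma lin_nz:
  assumes "p \<noteq> 0" "a * d - b * c \<noteq> 0" shows "linmap a b c d p \<noteq> 0"
proof
  assume "linmap a b c d p = 0"
  then have "linmap d (- b) (- c) a (linmap a b c d p) = 0" by (simp add: linmap_def zero_prod_def)
  then have "(a * d - b * c) *\<^sub>R p = 0" unfolding lin_lin .
  then show False using assms by simp
qed

definition projmap :: "real \<Rightarrow> real \<Rightarrow> real \<Rightarrow> real \<Rightarrow> real \<times> real \<Rightarrow> real \<times> real" where
  "projmap a b c d p = canon (linmap a b c d p)"

lemma proj_scale:
  assumes "canonical p" "a * d - b * c \<noteq> 0"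
  shows "\<exists>s. s \<noteq> 0 \<and> projmap a b c d p = s *\<^sub>R linmap a b c d p"
  unfolding projmap_def by (rule canon_scale[OF lin_nz[OF canonical_nz[OF assms(1)] assms(2)]])

lemma proj_inverse:
  assumes "canonical p" "a * d - b * c \<noteq> 0"
  shows "projmap d (- b) (- c) a (projmap a b c d p) = p"
proof -
  have D: "d * a - (- b) * (- c) \<noteq> 0" using assms(2) by (simp add: mult.commute)
  obtain s where s: "s \<noteq> 0" "projmap a b c d p = s *\<^sub>R linmap a b c d p" using proj_scale[OF assms] by blast
  obtain t where t: "projmap d (- b) (- c) a (projmap a b c d p) = t *\<^sub>R linmap d (- b) (- c) a (projmap a b c d p)"
    using proj_scale[OF _ D] canon_canonical by (metis projmap_def)
  have "projmap d (- b) (- c) a (projmap a b c d p) = (t * s * (a * d - b * c)) *\<^sub>R p"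
    unfolding t unfolding s(2) lin_scaleR lin_lin by simp
  then show ?thesis using canonical_scale_eq assms(1) canon_canonical by (metis projmap_def)
qed

lemma proj_inj:
  assumes "\<And>p. p \<in> L \<Longrightarrow> canonical p" "a * d - b * c \<noteq> 0" shows "inj_on (projmap a b c d) L"
  using proj_inverse assms by (metis inj_on_inverseI)

lemma form_proj:
  assumes "finite L" "\<And>p. p \<in> L \<Longrightarrow> canonical p" "a * d - b * c \<noteq> 0"
  shows "form (projmap a b c d ` L) (of_real a * x + of_real b * y) (of_real c * x + of_real d * y)
    = of_real \<bar>a * d - b * c\<bar> * form L x y"
  using assms proj_inj by (intro form_lin proj_scale) auto

lemma strict_mono_enum:
  fixes S :: "real set"
  assumes "finite S"
  obtains l where "strict_mono_on {1..card S} l" "S = l ` {1..card S}"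
proof -
  define xs where "xs = sorted_list_of_set S"
  have xs: "sorted_wrt (<) xs" "set xs = S" "length xs = card S"
    using assms by (simp_all add: xs_def)
  define l where "l i = xs ! (i - 1)" for i
  have "strict_mono_on {1..card S} l"
  proof (rule strict_mono_onI)
    fix i j assume "i \<in> {1..card S}" "j \<in> {1..card S}" "i < j"
    then show "l i < l j" using sorted_wrt_nth_less[OF xs(1), of "i - 1" "j - 1"] xs(3) by (auto simp: l_def)
  qed
  moreover have "S = l ` {1..card S}"
  proof -
    have "l ` {1..card S} = (\<lambda>i. xs ! i) ` ((\<lambda>i. i - 1) ` {1..card S})" by (simp add: l_def image_image)
    also have "(\<lambda>i. i - 1) ` {1..card S} = {..<card S}"
    proof (intro equalityI subsetI)
      fix i assume "i \<in> {..<card S}"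
      then show "i \<in> (\<lambda>i. i - 1) ` {1..card S}" by (intro image_eqI[of _ _ "i + 1"]) auto
    qed auto
    also have "(\<lambda>i. xs ! i) ` {..<card S} = S"
      using xs by (auto simp: set_conv_nth image_iff)
    finally show ?thesis ..
  qed
  ultimately show thesis using that by blast
qed

definition finite_pts :: "(nat \<Rightarrow> real) \<Rightarrow> nat \<Rightarrow> real \<times> real" where
  "finite_pts l i = (l i, 1)"

definition infinite_pts :: "nat \<Rightarrow> (nat \<Rightarrow> real) \<Rightarrow> nat \<Rightarrow> real \<times> real" where
  "infinite_pts k l i = (if i = k then (1, 0) else (l i, 1))"

lemma cyclic_enum_finite:
  assumes "strict_mono_on {1..k} l" "k \<ge> 3" shows "cyclic_enum k (finite_pts l)"
  using assms by (auto simp: cyclic_enum_def finite_pts_def wedge_def strict_mono_on_def)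

lemma cyclic_enum_infinite:
  assumes "strict_mono_on {1..<k} l" "k \<ge> 3" shows "cyclic_enum k (infinite_pts k l)"
  using assms by (auto simp: cyclic_enum_def infinite_pts_def wedge_def strict_mono_on_def)

lemma canonical_enum:
  assumes "finite L" "\<And>p. p \<in> L \<Longrightarrow> canonical p" "card L \<ge> 3"
  obtains k l where "k \<ge> 3" "strict_mono_on {1..k} l" "L = finite_pts l ` {1..k}"
  | k l where "k \<ge> 3" "strict_mono_on {1..<k} l" "L = infinite_pts k l ` {1..k}"
proof -
  define S where "S = {x. (x, 1) \<in> L}"
  have finS: "finite S" unfolding S_def using finite_vimageI[OF assms(1), of "\<lambda>x. (x, 1)"]
    by (simp add: inj_def vimage_def)
  obtain l where l: "strict_mono_on {1..card S} l" "S = l ` {1..card S}" by (rule strict_mono_enum[OF finS])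
  have im: "finite_pts l ` {1..card S} = (\<lambda>x. (x, 1)) ` S"
    by (subst (2) l(2)) (simp add: finite_pts_def image_image)
  have inj: "inj_on (\<lambda>x. (x, 1 :: real)) S" by (simp add: inj_on_def)
  have LS: "L - {(1, 0)} = (\<lambda>x. (x, 1)) ` S"
    using assms(2) by (force simp: S_def canonical_def)
  show thesis
  proof (cases "(1, 0) \<in> L")
    case False
    then have L: "L = (\<lambda>x. (x, 1)) ` S" using LS by simp
    then have "card L = card S" by (simp add: card_image[OF inj])
    then show thesis using that(1)[of "card S" l] assms(3) l(1) L im by simp
  next
    case True
    have "card (L - {(1, 0)}) = card S" unfolding LS by (rule card_image[OF inj])
    then have c: "card L = Suc (card S)" using card_Suc_Diff1[OF assms(1) True] by simp
    have "infinite_pts (card L) l ` {1..card L} = insert (1, 0) (finite_pts l ` {1..card S})"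
    proof -
      have "{1..card L} = insert (card L) {1..card S}" using c by auto
      moreover have "infinite_pts (card L) l ` {1..card S} = finite_pts l ` {1..card S}"
        by (intro image_cong) (auto simp: infinite_pts_def finite_pts_def c)
      moreover have "infinite_pts (card L) l (card L) = (1, 0)" by (simp add: infinite_pts_def)
      ultimately show ?thesis by (simp only: image_insert)
    qed
    also have "\<dots> = L" unfolding im LS[symmetric] using True by blast
    finally have L: "L = infinite_pts (card L) l ` {1..card L}" ..
    have "{1..<card L} = {1..card S}" using c by auto
    then show thesis using that(2)[of "card L" l] assms(3) l(1) L by simp
  qed
qed

section \<open>Positivity\<close>

lemma coefficient_degenerate: "quad_coeff (p, p) = 0" "mid_coeff (p, p) = 0" "const_coeff (p, p) = 0"
  by (simp_all add: quad_coeff_def mid_coeff_def const_coeff_def wedge_def)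

text \<open>Without infinity only the closing term -1 / (l k - l 1) is negative, and 1 / (l 2 - l 1)
  outweighs it since 2 < k. With infinity the two pairs containing it contribute 0, and at least one
  finite gap remains.\<close>

lemma leading_coeff_pos:
  assumes "finite L" "\<And>p. p \<in> L \<Longrightarrow> canonical p" "card L \<ge> 3"
  shows "sum quad_coeff (good_pairs L) > 0"
  using assms
proof (rule canonical_enum)
  fix k l assume k: "k \<ge> (3 :: nat)" and l: "strict_mono_on {1..k} l" and L: "L = finite_pts l ` {1..k}"
  have lm: "l i < l j" if "1 \<le> i" "i < j" "j \<le> k" for i j
    using l that by (auto simp: strict_mono_on_def)
  have t: "quad_coeff (cyc_pair k (finite_pts l) i) = 1 / (l (cyc_next k i) - l i)" for i
    by (simp add: quad_coeff_def cyc_pair_def finite_pts_def wedge_def)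
  have "sum quad_coeff (good_pairs L) = (\<Sum>i=1..k. 1 / (l (cyc_next k i) - l i))"
    unfolding L sum_good_pairs[where f=quad_coeff, OF cyclic_enum_finite[OF l k] coefficient_degenerate(1)] t ..
  also have "{1..k} = insert k (insert 1 {2..<k})" using k by auto
  also have "(\<Sum>i\<in>insert k (insert 1 {2..<k}). 1 / (l (cyc_next k i) - l i))
      = 1 / (l 1 - l k) + (1 / (l 2 - l 1) + (\<Sum>i\<in>{2..<k}. 1 / (l (cyc_next k i) - l i)))"
    using k by (simp add: cyc_next_def numeral_2_eq_2)
  also have "\<dots> > 0"
  proof -
    have "(\<Sum>i\<in>{2..<k}. 1 / (l (cyc_next k i) - l i)) \<ge> 0"
      by (rule sum_nonneg) (use lm in \<open>auto simp: cyc_next_def less_imp_le\<close>)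
    moreover have "1 / (l k - l 1) < 1 / (l 2 - l 1)"
      using lm[of 1 2] lm[of 2 k] k by (intro divide_strict_left_mono) auto
    moreover have "1 / (l 1 - l k) = - (1 / (l k - l 1))" by (metis minus_diff_eq minus_divide_right)
    ultimately show ?thesis by linarith
  qed
  finally show ?thesis .
next
  fix k l assume k: "k \<ge> (3 :: nat)" and l: "strict_mono_on {1..<k} l" and L: "L = infinite_pts k l ` {1..k}"
  have lm: "l i < l j" if "1 \<le> i" "i < j" "j < k" for i j
    using l that by (auto simp: strict_mono_on_def)
  have "sum quad_coeff (good_pairs L) = (\<Sum>i=1..k. quad_coeff (cyc_pair k (infinite_pts k l) i))"
    unfolding L by (rule sum_good_pairs[where f=quad_coeff, OF cyclic_enum_infinite[OF l k] coefficient_degenerate(1)])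
  also have "\<dots> > 0"
  proof (rule sum_pos2[of _ 1])
    show "0 < quad_coeff (cyc_pair k (infinite_pts k l) 1)"
      using k lm[of 1 2] by (simp add: quad_coeff_def cyc_pair_def infinite_pts_def wedge_def cyc_next_def numeral_2_eq_2)
    show "0 \<le> quad_coeff (cyc_pair k (infinite_pts k l) i)" if "i \<in> {1..k}" for i
      using that lm[of i "Suc i"] by (auto simp: quad_coeff_def cyc_pair_def infinite_pts_def wedge_def cyc_next_def)
  qed (use k in auto)
  finally show ?thesis .
qed

lemma form_of_real: "form L (of_real x) (of_real y) = of_real (sum quad_coeff (good_pairs L) * x\<^sup>2
    - sum mid_coeff (good_pairs L) * (x * y) + sum const_coeff (good_pairs L) * y\<^sup>2)"
  by (simp add: form_coeffs)

text \<open>The matrix (x y; -y x) sends (x, y) to (x^2 + y^2, 0). Up to positive factors, the value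
  at (x, y) is therefore the leading coefficient for the transformed set of points.\<close>

lemma form_pos:
  assumes L: "finite L" "\<And>p. p \<in> L \<Longrightarrow> canonical p" "card L \<ge> 3" and xy: "x \<noteq> 0 \<or> y \<noteq> 0"
  shows "sum quad_coeff (good_pairs L) * x\<^sup>2 - sum mid_coeff (good_pairs L) * (x * y) + sum const_coeff (good_pairs L) * y\<^sup>2 > 0" (is "?q > 0")
proof -
  let ?D = "x * x - y * (- y)"
  have D: "?D > 0" using xy by (simp add: sum_squares_gt_zero_iff)
  define L' where "L' = projmap x y (- y) x ` L"
  have L': "finite L'" "\<And>p. p \<in> L' \<Longrightarrow> canonical p" "card L' \<ge> 3"
  proof -
    have "inj_on (projmap x y (- y) x) L" by (rule proj_inj) (use L D in auto)
    then have "card L' = card L" unfolding L'_def by (rule card_image)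
    then show "card L' \<ge> 3" using L(3) by simp
  qed (use L(1) in \<open>auto simp: L'_def projmap_def canon_canonical\<close>)
  have "form L' (of_real x * of_real x + of_real y * of_real y) (of_real (- y) * of_real x + of_real x * of_real y)
    = of_real \<bar>?D\<bar> * form L (of_real x) (of_real y)"
    unfolding L'_def using D by (intro form_proj L) auto
  moreover have "of_real x * of_real x + of_real y * of_real y = (of_real ?D :: complex)"
    "of_real (- y) * of_real x + of_real x * of_real y = (of_real 0 :: complex)" by simp_all
  moreover have "\<bar>?D\<bar> = ?D" using D by simp
  ultimately have "form L' (of_real ?D) (of_real 0) = of_real (?D * ?q)"
    by (simp only: form_of_real of_real_mult)
  then have "sum quad_coeff (good_pairs L') * ?D\<^sup>2 = ?D * ?q"
    unfolding form_of_real of_real_eq_iff by simp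
  moreover have "sum quad_coeff (good_pairs L') * ?D\<^sup>2 > 0" using leading_coeff_pos[OF L'] D by (intro mult_pos_pos zero_less_power)
  ultimately have "?D * ?q > 0" by simp
  then show ?thesis using D by (simp only: zero_less_mult_iff) linarith
qed

section \<open>Roots of the form and their arguments\<close>

definition angle_roots :: "(real \<times> real) set \<Rightarrow> complex set" where
  "angle_roots L = {z. form L z 1 = 0}"

lemma angle_roots_explicit:
  fixes L
  defines "a \<equiv> sum quad_coeff (good_pairs L)" and "b \<equiv> sum mid_coeff (good_pairs L)" and "c \<equiv> sum const_coeff (good_pairs L)"
  assumes L: "finite L" "\<And>p. p \<in> L \<Longrightarrow> canonical p" "card L \<ge> 3"
  shows "0 < a" "0 < c" "b\<^sup>2 < 4 * (a * c)"
    "angle_roots L = {Complex (b / (2 * a)) (sqrt (4 * (a * c) - b\<^sup>2) / (2 * a)), Complex (b / (2 * a)) (- sqrt (4 * (a * c) - b\<^sup>2) / (2 * a))}"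
proof -
  note q = form_pos[OF L, folded a_def b_def c_def]
  show a: "0 < a" using q[of 1 0] by simp
  show c: "0 < c" using q[of 0 1] by simp
  \<comment> \<open>The minimum of the quadratic polynomial, attained at b / (2 a), is positive;
    this bounds the discriminant.\<close>
  have "0 < a * (b / (2 * a))\<^sup>2 - b * (b / (2 * a)) + c" using q[of "b / (2 * a)" 1] by simp
  also have "\<dots> = (4 * (a * c) - b\<^sup>2) / (4 * a)" using a by (simp add: field_simps power2_eq_square)
  finally show disc: "b\<^sup>2 < 4 * (a * c)" using a by (simp add: zero_less_divide_iff)
  define s where "s = sqrt (4 * (a * c) - b\<^sup>2)"
  have s2: "s\<^sup>2 = 4 * (a * c) - b\<^sup>2" using disc by (simp add: s_def)
  let ?r = "Complex (b / (2 * a)) (s / (2 * a))" and ?r' = "Complex (b / (2 * a)) (- s / (2 * a))"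
  have sum: "?r + ?r' = of_real (b / a)" by (simp add: complex_eq_iff)
  have prod: "?r * ?r' = of_real (c / a)"
  proof -
    have "(b / (2 * a)) * (b / (2 * a)) + (s / (2 * a)) * (s / (2 * a)) = (b\<^sup>2 + s\<^sup>2) / (4 * a\<^sup>2)"
      by (simp add: power2_eq_square add_divide_distrib)
    also have "b\<^sup>2 + s\<^sup>2 = 4 * (a * c)" using s2 by simp
    also have "4 * (a * c) / (4 * a\<^sup>2) = c / a" using a by (simp add: power2_eq_square)
    finally show ?thesis by (simp add: complex_eq_iff)
  qed
  have "form L z 1 = of_real a * ((z - ?r) * (z - ?r'))" for z
  proof -
    have "(z - ?r) * (z - ?r') = z\<^sup>2 - (?r + ?r') * z + ?r * ?r'"
      by (simp add: algebra_simps power2_eq_square)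
    also have "\<dots> = z\<^sup>2 - of_real (b / a) * z + of_real (c / a)" by (simp only: sum prod)
    also have "of_real a * \<dots> = of_real a * z\<^sup>2 - of_real b * z + of_real c"
      using a by (simp add: algebra_simps)
    finally show ?thesis by (simp add: form_coeffs a_def b_def c_def)
  qed
  then show "angle_roots L = {Complex (b / (2 * a)) (sqrt (4 * (a * c) - b\<^sup>2) / (2 * a)), Complex (b / (2 * a)) (- sqrt (4 * (a * c) - b\<^sup>2) / (2 * a))}"
    using a unfolding angle_roots_def s_def[symmetric] by auto
qed

text \<open>The roots are conjugate with real part b / (2 a) and squared modulus c / a, which gives
  the cosine. Its strict bounds later ensure continuity of arccos at this point.\<close>

lemma mean_angle_roots:
  fixes L
  defines "a \<equiv> sum quad_coeff (good_pairs L)" and "b \<equiv> sum mid_coeff (good_pairs L)" and "c \<equiv> sum const_coeff (good_pairs L)"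
  assumes L: "finite L" "\<And>p. p \<in> L \<Longrightarrow> canonical p" "card L \<ge> 3"
  shows "mean_angle (angle_roots L) = arccos (b / (2 * sqrt (a * c)))"
    "-1 < b / (2 * sqrt (a * c))" "b / (2 * sqrt (a * c)) < 1"
    "finite (angle_roots L) \<and> angle_roots L \<noteq> {} \<and> angle_roots L \<inter> \<real> = {}"
proof -
  note e = angle_roots_explicit[OF L, folded a_def b_def c_def]
  define s where "s = sqrt (4 * (a * c) - b\<^sup>2)"
  have s: "s > 0" "s\<^sup>2 = 4 * (a * c) - b\<^sup>2" using e(3) by (simp_all add: s_def)
  define r where "r = Complex (b / (2 * a)) (s / (2 * a))"
  have Z: "angle_roots L = {r, cnj r}" using e(4) unfolding r_def s_def by (simp add: complex_cnj)
  have Im: "Im r > 0" using s e(1) by (simp add: r_def)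
  have ne: "r \<noteq> cnj r" using Im by (auto simp: complex_eq_iff)
  have m: "mean_angle (angle_roots L) = \<bar>Arg r\<bar>" using ne by (simp add: Z mean_angle_def abs_Arg_cnj)
  have ac: "sqrt (a * c) > 0" using e by simp
  have "(norm r)\<^sup>2 = (b\<^sup>2 + s\<^sup>2) / (4 * a\<^sup>2)"
    by (simp add: cmod_power2 r_def power_divide add_divide_distrib power_mult_distrib)
  also have "b\<^sup>2 + s\<^sup>2 = 4 * (a * c)" using s(2) by simp
  also have "4 * (a * c) / (4 * a\<^sup>2) = (sqrt (a * c) / a)\<^sup>2" using e by (simp add: power_divide)
  finally have n: "norm r = sqrt (a * c) / a" using e ac by (simp add: power2_eq_iff_nonneg)
  have "Re r = norm r * cos (Arg r)" 
    by (metis Re_rcis rcis_cmod_Arg)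
  then have cosr: "cos \<bar>Arg r\<bar> = b / (2 * sqrt (a * c))"
  proof -
    assume "Re r = norm r * cos (Arg r)"
    moreover have "Re r = b / (2 * a)" by (simp add: r_def)
    ultimately have "b = 2 * sqrt (a * c) * cos (Arg r)" unfolding n using e(1) by (simp add: field_simps)
    then show ?thesis using ac by (metis cos_abs_real mult_eq_0_iff nonzero_mult_div_cancel_left order_less_irrefl zero_neq_numeral)
  qed
  have "r \<notin> \<real>" using Im by (simp add: complex_is_Real_iff)
  note b = abs_Arg_bounds[OF this]
  show "mean_angle (angle_roots L) = arccos (b / (2 * sqrt (a * c)))"
    unfolding m cosr[symmetric] using b by (simp add: arccos_cos del: cos_abs_real)
  have "\<bar>b\<bar> < 2 * sqrt (a * c)"
  proof (rule power2_less_imp_less)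
    show "\<bar>b\<bar>\<^sup>2 < (2 * sqrt (a * c))\<^sup>2" using e ac by (simp add: power_mult_distrib)
  qed (use ac in simp)
  then show "-1 < b / (2 * sqrt (a * c))" "b / (2 * sqrt (a * c)) < 1" using ac
    by (simp_all add: less_divide_eq divide_less_eq abs_less_iff)
  show "finite (angle_roots L) \<and> angle_roots L \<noteq> {} \<and> angle_roots L \<inter> \<real> = {}"
    using Im by (auto simp: Z complex_is_Real_iff)
qed

text \<open>Multiplication by (c z + d)^2 clears the denominator of the Moebius image by
  homogeneity, and \<open>form_proj\<close> returns a nonzero multiple of the original form at
  z.\<close>

lemma angle_roots_moebius:
  assumes L: "finite L" "\<And>p. p \<in> L \<Longrightarrow> canonical p" "card L \<ge> 3" and D: "a * d - b * c \<noteq> 0"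
  shows "angle_roots (projmap a b c d ` L) = moebius a b c d ` angle_roots L"
proof (rule eq_moebius_image[OF _ _ D])
  have L': "finite (projmap a b c d ` L)" "card (projmap a b c d ` L) \<ge> 3"
    "\<And>p. p \<in> projmap a b c d ` L \<Longrightarrow> canonical p"
  proof -
    have "inj_on (projmap a b c d) L" by (rule proj_inj) (use L D in auto)
    then have "card (projmap a b c d ` L) = card L" by (rule card_image)
    then show "card (projmap a b c d ` L) \<ge> 3" using L(3) by simp
  qed (use L(1) in \<open>auto simp: projmap_def canon_canonical\<close>)
  show "angle_roots L \<inter> \<real> = {}" "angle_roots (projmap a b c d ` L) \<inter> \<real> = {}"
    using mean_angle_roots(4)[OF L] mean_angle_roots(4)[OF L'(1,3,2)] by blast+
  fix z :: complex assume z: "z \<notin> \<real>"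
  let ?e = "of_real c * z + of_real d :: complex"
  have e: "?e \<noteq> 0" by (rule moebius_denominator[OF z D])
  have "?e\<^sup>2 * form (projmap a b c d ` L) (moebius a b c d z) 1 = form (projmap a b c d ` L) (?e * moebius a b c d z) (?e * 1)"
    by (simp only: form_scale)
  also have "\<dots> = form (projmap a b c d ` L) (of_real a * z + of_real b * 1) (of_real c * z + of_real d * 1)"
    using e by (simp add: moebius_def)
  also have "\<dots> = of_real \<bar>a * d - b * c\<bar> * form L z 1" by (rule form_proj[OF L(1,2) D])
  finally have eq: "?e\<^sup>2 * form (projmap a b c d ` L) (moebius a b c d z) 1 = of_real \<bar>a * d - b * c\<bar> * form L z 1" .
  have "of_real \<bar>a * d - b * c\<bar> \<noteq> (0 :: complex)" using D by (simp only: of_real_eq_0_iff abs_eq_0 not_False_eq_True)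
  then show "moebius a b c d z \<in> angle_roots (projmap a b c d ` L) \<longleftrightarrow> z \<in> angle_roots L"
    using arg_cong[OF eq, of "\<lambda>x. x = 0"] e unfolding angle_roots_def by (simp only: mult_eq_0_iff power_eq_0_iff mem_Collect_eq) simp
qed

section \<open>Real eigenvalues\<close>

text \<open>Homogeneous encoding of the real and infinite eigenvalues: (x, 1) stands for x and (1,
  0) for infinity, so a change of basis meets no exceptional point.\<close>

definition singular_points :: "real^'n^'n \<Rightarrow> real^'n^'n \<Rightarrow> (real \<times> real) set" where
  "singular_points A B = {p. canonical p \<and> det (snd p *\<^sub>R A - fst p *\<^sub>R B) = 0}"

definition geneig_of_point :: "real \<times> real \<Rightarrow> geneig" where
  "geneig_of_point p = (if snd p = 0 then Infty else Fin (complex_of_real (fst p)))"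

lemma inj_geneig_of_point: "inj_on geneig_of_point {p. canonical p}"
  by (auto simp: inj_on_def geneig_of_point_def canonical_def split: if_splits)

lemma det_uminus_eq_0: "det (- B) = 0 \<longleftrightarrow> det B = 0" for B :: "real^'n^'n"
  using det_scaleR[of "-1" B] by simp

lemma singular_points_iff:
  assumes "canonical p"
  shows "p \<in> singular_points A B \<longleftrightarrow> geneig_of_point p \<in> gen_eigenvalues A B"
  using assms by (auto simp: singular_points_def geneig_of_point_def canonical_def Fin_real_gen_eigenvalues
      Infty_gen_eigenvalues det_uminus_eq_0)

lemma geneig_of_point_image:
  assumes "gen_eigenvalues A B \<subseteq> insert Infty real_eigs"
  shows "geneig_of_point ` singular_points A B = gen_eigenvalues A B"
proof (intro equalityI subsetI)
  fix e assume "e \<in> geneig_of_point ` singular_points A B"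
  then show "e \<in> gen_eigenvalues A B" using singular_points_iff by (auto simp: singular_points_def)
next
  fix e assume e: "e \<in> gen_eigenvalues A B"
  then consider "e = Infty" | x where "e = Fin (complex_of_real x)" using assms by (auto simp: real_eigs_def)
  then obtain p where "canonical p" "e = geneig_of_point p"
  proof cases
    case 1
    then show ?thesis using that[of "(1, 0)"] by (simp add: canonical_def geneig_of_point_def)
  next
    case (2 x)
    then show ?thesis using that[of "(x, 1)"] by (simp add: canonical_def geneig_of_point_def)
  qed
  then show "e \<in> geneig_of_point ` singular_points A B" using e singular_points_iff by blast
qed

lemma singular_points_canonical: "p \<in> singular_points A B \<Longrightarrow> canonical p"
  by (simp add: singular_points_def)

lemma singular_points_eqI:
  assumes "\<And>p. p \<in> L \<Longrightarrow> canonical p" "gen_eigenvalues A B = geneig_of_point ` L"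
  shows "singular_points A B = L"
proof (intro equalityI subsetI)
  fix p assume p: "p \<in> singular_points A B"
  have "geneig_of_point p \<in> geneig_of_point ` L"
    using iffD1[OF singular_points_iff[OF singular_points_canonical[OF p]] p] unfolding assms(2) .
  then obtain q where q: "q \<in> L" "geneig_of_point p = geneig_of_point q" by blast
  then have "p = q"
    using inj_onD[OF inj_geneig_of_point q(2)] singular_points_canonical[OF p] assms(1) by blast
  then show "p \<in> L" using q(1) by simp
next
  fix p assume "p \<in> L"
  then show "p \<in> singular_points A B" using singular_points_iff assms by blast
qed

lemma real_case_singular_points:
  assumes "real_case A B"
  shows "finite (singular_points A B)" "card (singular_points A B) \<ge> 3"
proof -
  have s: "gen_eigenvalues A B \<subseteq> insert Infty real_eigs" and c: "card (gen_eigenvalues A B) \<ge> 3"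
    using assms by (auto simp: real_case_def)
  have inj: "inj_on geneig_of_point (singular_points A B)"
    by (rule inj_on_subset[OF inj_geneig_of_point]) (auto simp: singular_points_def)
  note i = geneig_of_point_image[OF s]
  show "card (singular_points A B) \<ge> 3" using c card_image[OF inj] i by simp
  \<comment> \<open>An infinite set has \<open>card\<close> 0, so the lower bound on the cardinality
    implies finiteness.\<close>
  then show "finite (singular_points A B)" using card.infinite by fastforce
qed

text \<open>For q = s g p, with g the matrix (a b; c d), the matrix of the new pencil at q is s (a d
  - b c) times that of the old pencil at p.\<close>

lemma singular_points_lincomb:
  fixes A B :: "real^'n^'n"
  assumes D: "a * d - b * c \<noteq> 0"
  shows "singular_points (a *\<^sub>R A + b *\<^sub>R B) (c *\<^sub>R A + d *\<^sub>R B) = projmap a b c d ` singular_points A B"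
    (is "singular_points ?A ?B = _")
proof -
  have det: "det (snd q *\<^sub>R ?A - fst q *\<^sub>R ?B) = 0 \<longleftrightarrow> det (snd p *\<^sub>R A - fst p *\<^sub>R B) = 0"
    if "q = s *\<^sub>R linmap a b c d p" "s \<noteq> 0" for p q s
  proof -
    have "snd q *\<^sub>R ?A - fst q *\<^sub>R ?B = (s * (a * d - b * c)) *\<^sub>R (snd p *\<^sub>R A - fst p *\<^sub>R B)"
      unfolding that(1) by (simp add: linmap_def vec_eq_iff algebra_simps)
    then show ?thesis using D that(2) by (simp add: det_scaleR)
  qed
  have D': "d * a - (- b) * (- c) \<noteq> 0" using D by (simp add: mult.commute)
  show ?thesis
  proof (intro equalityI subsetI)
    fix q assume q: "q \<in> singular_points ?A ?B"
    then have cq: "canonical q" by (rule singular_points_canonical)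
    define p where "p = projmap d (- b) (- c) a q"
    have cp: "canonical p" by (simp add: p_def projmap_def canon_canonical)
    have qp: "q = projmap a b c d p"
      using proj_inverse[OF cq D'] by (simp add: p_def)
    obtain s where "s \<noteq> 0" "q = s *\<^sub>R linmap a b c d p" using proj_scale[OF cp D] qp by auto
    with q have "p \<in> singular_points A B" using det cp by (simp add: singular_points_def)
    with qp show "q \<in> projmap a b c d ` singular_points A B" by blast
  next
    fix q assume "q \<in> projmap a b c d ` singular_points A B"
    then obtain p where p: "p \<in> singular_points A B" "q = projmap a b c d p" by blast
    obtain s where s: "s \<noteq> 0" "q = s *\<^sub>R linmap a b c d p"
      using proj_scale[OF singular_points_canonical[OF p(1)] D] p(2) by auto
    have "canonical q" unfolding p(2) projmap_def by (rule canon_canonical)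
    moreover have "det (snd q *\<^sub>R ?A - fst q *\<^sub>R ?B) = 0"
      using det[OF s(2,1)] p(1) unfolding singular_points_def by blast
    ultimately show "q \<in> singular_points ?A ?B" by (simp add: singular_points_def)
  qed
qed

lemma nonreal_eigenvalues_empty_iff:
  "nonreal_eigenvalues A B = {} \<longleftrightarrow> gen_eigenvalues A B \<subseteq> insert Infty real_eigs"
proof -
  have "e \<in> insert Infty real_eigs \<longleftrightarrow> (\<forall>z. e = Fin z \<longrightarrow> z \<in> \<real>)" for e
    by (cases e) (auto simp: real_eigs_def Reals_def)
  then show ?thesis by (auto simp: nonreal_eigenvalues_def)
qed

text \<open>The absence of nonreal eigenvalues is preserved by Moebius maps; the number of
  eigenvalues, with infinity counted, by injectivity of the projective map on singular
  points.\<close>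

lemma real_case_lincomb:
  assumes p: "real_case A B" and D: "a * d - b * c \<noteq> 0"
    and N: "is_normal (a *\<^sub>R A + b *\<^sub>R B)" "is_normal (c *\<^sub>R A + d *\<^sub>R B)"
  shows "real_case (a *\<^sub>R A + b *\<^sub>R B) (c *\<^sub>R A + d *\<^sub>R B)" (is "real_case ?A ?B")
proof -
  have "nonreal_eigenvalues A B = {}"
    using p unfolding real_case_def nonreal_eigenvalues_empty_iff by blast
  then have real: "gen_eigenvalues ?A ?B \<subseteq> insert Infty real_eigs"
    unfolding nonreal_eigenvalues_empty_iff[symmetric] nonreal_eigenvalues_moebius[OF D] by simp
  have "card (singular_points ?A ?B) = card (singular_points A B)"
    unfolding singular_points_lincomb[OF D]
    by (intro card_image proj_inj singular_points_canonical D)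
  moreover have "card (gen_eigenvalues ?A ?B) = card (singular_points ?A ?B)"
    unfolding geneig_of_point_image[OF real, symmetric]
    by (intro card_image inj_on_subset[OF inj_geneig_of_point]) (auto simp: singular_points_def)
  ultimately have "card (gen_eigenvalues ?A ?B) \<ge> 3" using real_case_singular_points(2)[OF p] by simp
  moreover have "regular_pencil ?A ?B"
    using p regular_pencil_lincomb[of A B, OF _ D] by (simp add: real_case_def regular_normals_def)
  ultimately show ?thesis using real N by (simp add: real_case_def regular_normals_def)
qed

lemma real_invariant_angle:
  "\<exists>\<theta>. invariant_angle_function
      {(cohyp A, cohyp B) | (A :: real^'n^'n) (B :: real^'n^'n). real_case A B} \<theta> \<and>
    (\<forall>(A :: real^'n^'n) B. real_case A B \<longrightarrow>
        \<theta> (cohyp A) (cohyp B) = mean_angle (angle_roots (singular_points A B)))"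
proof (rule invariant_angle_function_of_equivariant_set)
  fix A B :: "real^'n^'n" assume p: "real_case A B"
  then have r: "regular_normals A B" and c: "card (gen_eigenvalues A B) \<ge> 3" by (simp_all add: real_case_def)
  have "A \<noteq> c *\<^sub>R B" for c
  proof (rule regular_normals_not_proportional[OF r])
    show "\<not> gen_eigenvalues A B \<subseteq> {Fin (complex_of_real c)}"
    proof
      assume "gen_eigenvalues A B \<subseteq> {Fin (complex_of_real c)}"
      from card_mono[OF _ this] show False using \<open>card (gen_eigenvalues A B) \<ge> 3\<close> by simp
    qed
  qed
  then show "is_normal A \<and> is_normal B \<and> (\<forall>c. A \<noteq> c *\<^sub>R B)" using r by (simp add: regular_normals_def)
  note L = real_case_singular_points(1)[OF p] singular_points_canonical real_case_singular_points(2)[OF p]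
  show "finite (angle_roots (singular_points A B)) \<and> angle_roots (singular_points A B) \<noteq> {} \<and>
      angle_roots (singular_points A B) \<inter> \<real> = {}"
    by (rule mean_angle_roots(4)[OF L])
  show "real_case (act_normal g A) (act_normal g B) \<and>
      angle_roots (singular_points (act_normal g A) (act_normal g B)) = angle_roots (singular_points A B)"
    if g: "g \<in> SL" for g
  proof -
    have "singular_points (act_normal g A) (act_normal g B) = singular_points A B"
      using singular_points_iff[of _ A B] singular_points_iff[of _ "act_normal g A" "act_normal g B"]
        singular_points_canonical unfolding gen_eigenvalues_act_normal[OF g] by blast
    then show ?thesis using p regular_normals_act_normal[OF g]
      by (simp add: real_case_def gen_eigenvalues_act_normal[OF g])
  qed
  show "real_case (a *\<^sub>R A + b *\<^sub>R B) (c *\<^sub>R A + d *\<^sub>R B) \<and>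
      angle_roots (singular_points (a *\<^sub>R A + b *\<^sub>R B) (c *\<^sub>R A + d *\<^sub>R B)) = moebius a b c d ` angle_roots (singular_points A B)"
    if "a * d - b * c \<noteq> 0" "is_normal (a *\<^sub>R A + b *\<^sub>R B)" "is_normal (c *\<^sub>R A + d *\<^sub>R B)" for a b c d
    using real_case_lincomb[OF p that] angle_roots_moebius[OF L that(1)]
    by (simp add: singular_points_lincomb[OF that(1)])
qed

section \<open>The cosine formula and its limit\<close>

lemma sum_cyc_next:
  fixes f :: "nat \<Rightarrow> 'a::comm_monoid_add"
  assumes "k \<ge> 1" shows "(\<Sum>i=1..k. f (cyc_next k i)) = (\<Sum>i=1..k. f i)"
proof -
  have "bij_betw (cyc_next k) {1..k} {1..k}"
    by (rule bij_betw_byWitness[where f' = "\<lambda>i. if i = 1 then k else i - 1"])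
      (use assms in \<open>auto simp: cyc_next_def\<close>)
  then show ?thesis by (rule sum.reindex_bij_betw)
qed

text \<open>The cosine b / (2 sqrt (a c)) of \<open>mean_angle_roots\<close>, in terms of vectors,
  so that it makes sense with infinity among the points.\<close>

definition cyc_cos :: "nat \<Rightarrow> (nat \<Rightarrow> real \<times> real) \<Rightarrow> real" where
  "cyc_cos k v = (\<Sum>i=1..k. mid_coeff (cyc_pair k v i)) /
     (2 * sqrt ((\<Sum>i=1..k. quad_coeff (cyc_pair k v i)) * (\<Sum>i=1..k. const_coeff (cyc_pair k v i))))"

text \<open>(x + y)^2 / (x - y) = 4 x y / (x - y) + (x - y), and the differences sum to 0 around the
  cycle. Hence the second sum under the root is 4 times the constant coefficient.\<close>

lemma cos_formula_eq:
  assumes "k \<ge> 1" shows "cos_formula k l = cyc_cos k (finite_pts l)"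
proof -
  let ?n = "\<lambda>i. l (cyc_next k i)"
  have n: "(if i = k then l 1 else l (i + 1)) = ?n i" for i by (simp add: cyc_next_def)
  have c: "quad_coeff (cyc_pair k (finite_pts l) i) = 1 / (?n i - l i)" "mid_coeff (cyc_pair k (finite_pts l) i) = (?n i + l i) / (?n i - l i)"
    "const_coeff (cyc_pair k (finite_pts l) i) = ?n i * l i / (?n i - l i)" for i
    by (simp_all add: quad_coeff_def mid_coeff_def const_coeff_def cyc_pair_def finite_pts_def wedge_def)
  have sq: "(x + y)\<^sup>2 / (x - y) = 4 * (x * y / (x - y)) + (x - y)" for x y :: real
    by (cases "x = y") (auto simp: field_simps power2_eq_square)
  have "(\<Sum>i=1..k. ?n i - l i) = 0" using sum_cyc_next[OF assms, of l] by (simp add: sum_subtractf)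
  then have "(\<Sum>i=1..k. (?n i + l i)\<^sup>2 / (?n i - l i)) = 4 * (\<Sum>i=1..k. const_coeff (cyc_pair k (finite_pts l) i))"
    unfolding sq c by (simp add: sum.distrib sum_distrib_left)
  then have "cos_formula k l = (\<Sum>i=1..k. mid_coeff (cyc_pair k (finite_pts l) i)) /
      sqrt ((\<Sum>i=1..k. quad_coeff (cyc_pair k (finite_pts l) i)) * (4 * (\<Sum>i=1..k. const_coeff (cyc_pair k (finite_pts l) i))))"
    unfolding cos_formula_def Let_def n by (simp add: c)
  also have "\<dots> = cyc_cos k (finite_pts l)"
    by (simp add: cyc_cos_def real_sqrt_mult mult_ac)
  finally show ?thesis .
qed

lemma mean_angle_cyc:
  assumes v: "cyclic_enum k v" and can: "\<And>i. i \<in> {1..k} \<Longrightarrow> canonical (v i)" and card: "card (v ` {1..k}) \<ge> 3"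
  shows "mean_angle (angle_roots (v ` {1..k})) = arccos (cyc_cos k v)" "-1 < cyc_cos k v" "cyc_cos k v < 1"
proof -
  have L: "finite (v ` {1..k})" "\<And>p. p \<in> v ` {1..k} \<Longrightarrow> canonical p" "card (v ` {1..k}) \<ge> 3"
    using can card by auto
  note s = sum_good_pairs[where f = quad_coeff, OF v coefficient_degenerate(1)]
    sum_good_pairs[where f = mid_coeff, OF v coefficient_degenerate(2)]
    sum_good_pairs[where f = const_coeff, OF v coefficient_degenerate(3)]
  show "mean_angle (angle_roots (v ` {1..k})) = arccos (cyc_cos k v)" "-1 < cyc_cos k v" "cyc_cos k v < 1"
    using mean_angle_roots(1-3)[OF L] unfolding s cyc_cos_def by auto
qed

text \<open>The points \<open>(t, 1)\<close> and \<open>(1, 1 / t)\<close> are projectively equal, and the latter converges for \<open>t \<rightarrow> \<infinity>\<close>.\<close>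

definition approx_pts :: "nat \<Rightarrow> (nat \<Rightarrow> real) \<Rightarrow> real \<Rightarrow> nat \<Rightarrow> real \<times> real" where
  "approx_pts k l t i = (if i = k then (1, 1 / t) else (l i, 1))"

lemma coefficients_scale:
  assumes "s \<noteq> 0" "t \<noteq> 0"
  shows "quad_coeff (s *\<^sub>R p, t *\<^sub>R q) = quad_coeff (p, q)" "mid_coeff (s *\<^sub>R p, t *\<^sub>R q) = mid_coeff (p, q)" "const_coeff (s *\<^sub>R p, t *\<^sub>R q) = const_coeff (p, q)"
proof -
  have d: "(s * t * x) / (s * t * w) = x / w" for x w using assms by simp
  have "quad_coeff (s *\<^sub>R p, t *\<^sub>R q) = (s * t * (snd p * snd q)) / (s * t * wedge p q)"
    "mid_coeff (s *\<^sub>R p, t *\<^sub>R q) = (s * t * (fst p * snd q + snd p * fst q)) / (s * t * wedge p q)"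
    "const_coeff (s *\<^sub>R p, t *\<^sub>R q) = (s * t * (fst p * fst q)) / (s * t * wedge p q)"
    by (simp_all add: quad_coeff_def mid_coeff_def const_coeff_def wedge_scaleR algebra_simps)
  then show "quad_coeff (s *\<^sub>R p, t *\<^sub>R q) = quad_coeff (p, q)" "mid_coeff (s *\<^sub>R p, t *\<^sub>R q) = mid_coeff (p, q)" "const_coeff (s *\<^sub>R p, t *\<^sub>R q) = const_coeff (p, q)"
    unfolding d by (simp_all add: quad_coeff_def mid_coeff_def const_coeff_def)
qed

lemma cyc_cos_approx:
  assumes "t \<noteq> 0" shows "cyc_cos k (finite_pts (l(k := t))) = cyc_cos k (approx_pts k l t)"
proof -
  define s where "s i = (if i = k then t else 1)" for i
  have "finite_pts (l(k := t)) i = s i *\<^sub>R approx_pts k l t i" for i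
    using assms by (simp add: finite_pts_def approx_pts_def s_def)
  moreover have "s i \<noteq> 0" for i using assms by (simp add: s_def)
  ultimately have "quad_coeff (cyc_pair k (finite_pts (l(k := t))) i) = quad_coeff (cyc_pair k (approx_pts k l t) i)"
    "mid_coeff (cyc_pair k (finite_pts (l(k := t))) i) = mid_coeff (cyc_pair k (approx_pts k l t) i)"
    "const_coeff (cyc_pair k (finite_pts (l(k := t))) i) = const_coeff (cyc_pair k (approx_pts k l t) i)" for i
    by (simp_all add: cyc_pair_def coefficients_scale)
  then show ?thesis by (simp add: cyc_cos_def)
qed

text \<open>Every wedge of neighbours has a nonzero limit and the product under the root a positive
  one, so all operations are continuous at the limit.\<close>

lemma cyc_cos_tendsto:
  assumes v: "cyclic_enum k (infinite_pts k l)" and nz: "0 < (\<Sum>i=1..k. quad_coeff (cyc_pair k (infinite_pts k l) i))"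
      "0 < (\<Sum>i=1..k. const_coeff (cyc_pair k (infinite_pts k l) i))"
  shows "((\<lambda>t. cyc_cos k (approx_pts k l t)) \<longlongrightarrow> cyc_cos k (infinite_pts k l)) at_top"
proof -
  have inv: "((\<lambda>t::real. 1 / t) \<longlongrightarrow> 0) at_top"
    using tendsto_inverse_0_at_top[OF filterlim_ident] by (simp add: inverse_eq_divide)
  have f: "((\<lambda>t. fst (approx_pts k l t i)) \<longlongrightarrow> fst (infinite_pts k l i)) at_top"
    and s: "((\<lambda>t. snd (approx_pts k l t i)) \<longlongrightarrow> snd (infinite_pts k l i)) at_top" for i
    using inv by (simp_all add: approx_pts_def infinite_pts_def)
  have w: "wedge (infinite_pts k l (cyc_next k i)) (infinite_pts k l i) \<noteq> 0" if "i \<in> {1..k}" for i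
  proof -
    have k: "3 \<le> k" and w: "\<And>i j. 1 \<le> i \<Longrightarrow> i < j \<Longrightarrow> j \<le> k \<Longrightarrow> wedge (infinite_pts k l j) (infinite_pts k l i) > 0"
      using v by (auto simp: cyclic_enum_def)
    show ?thesis
    proof (cases "i = k")
      case True
      then show ?thesis using w[of 1 k] k wedge_swap[of "infinite_pts k l 1"] by (simp add: cyc_next_def)
    next
      case False
      then show ?thesis using w[of i "Suc i"] that by (simp add: cyc_next_def)
    qed
  qed
  have "((\<lambda>t. quad_coeff (cyc_pair k (approx_pts k l t) i)) \<longlongrightarrow> quad_coeff (cyc_pair k (infinite_pts k l) i)) at_top"
    "((\<lambda>t. mid_coeff (cyc_pair k (approx_pts k l t) i)) \<longlongrightarrow> mid_coeff (cyc_pair k (infinite_pts k l) i)) at_top"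
    "((\<lambda>t. const_coeff (cyc_pair k (approx_pts k l t) i)) \<longlongrightarrow> const_coeff (cyc_pair k (infinite_pts k l) i)) at_top"
    if "i \<in> {1..k}" for i
    using w[OF that] unfolding quad_coeff_def mid_coeff_def const_coeff_def cyc_pair_def wedge_def fst_conv snd_conv
    by (intro tendsto_intros f s; simp)+
  then show ?thesis
    unfolding cyc_cos_def using nz by (intro tendsto_divide tendsto_mult tendsto_const tendsto_real_sqrt tendsto_sum) auto
qed

lemma real_case_finite_formula:
  assumes p: "real_case A B" and l: "strict_mono_on {1..k} l"
    and e: "gen_eigenvalues A B = (\<lambda>i. Fin (complex_of_real (l i))) ` {1..k}"
  shows "mean_angle (angle_roots (singular_points A B)) = arccos (cos_formula k l)"
proof -
  have S: "singular_points A B = finite_pts l ` {1..k}"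
  proof (rule singular_points_eqI)
    show "gen_eigenvalues A B = geneig_of_point ` finite_pts l ` {1..k}"
      unfolding e image_image by (simp add: finite_pts_def geneig_of_point_def)
  qed (auto simp: finite_pts_def canonical_def)
  have c: "card (finite_pts l ` {1..k}) \<ge> 3" using real_case_singular_points(2)[OF p] S by simp
  then have k: "k \<ge> 3" using card_image_le[of "{1..k}" "finite_pts l"] by simp
  have "mean_angle (angle_roots (finite_pts l ` {1..k})) = arccos (cyc_cos k (finite_pts l))"
    by (rule mean_angle_cyc(1)[OF cyclic_enum_finite[OF l k] _ c]) (simp add: finite_pts_def canonical_def)
  then show ?thesis using S cos_formula_eq[of k l] k by simp
qed

text \<open>Infinity occupies position k, so \<open>l(k := t)\<close> leaves all finite eigenvalues
  unchanged. The cosine converges as it depends on projective points only, and arccos is continuous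
  at the limit, which lies strictly between -1 and 1.\<close>

lemma real_case_infinite_formula:
  assumes p: "real_case A B" and l: "strict_mono_on {1..<k} l"
    and e: "gen_eigenvalues A B = insert Infty ((\<lambda>i. Fin (complex_of_real (l i))) ` {1..<k})"
  shows "((\<lambda>t. arccos (cos_formula k (l(k := t)))) \<longlongrightarrow> mean_angle (angle_roots (singular_points A B))) at_top"
proof -
  have "card (gen_eigenvalues A B) \<le> Suc (card ((\<lambda>i. Fin (complex_of_real (l i))) ` {1..<k}))"
    unfolding e by (simp add: card_insert_if)
  also have "\<dots> \<le> Suc (k - 1)"
    using card_image_le[of "{1..<k}" "\<lambda>i. Fin (complex_of_real (l i))"] by simp
  finally have k: "k \<ge> 3" using p unfolding real_case_def by linarith
  then have ins: "{1..k} = insert k {1..<k}" by auto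
  have im: "geneig_of_point ` infinite_pts k l ` {1..k} = insert Infty ((\<lambda>i. Fin (complex_of_real (l i))) ` {1..<k})"
    unfolding ins image_insert image_image
    by (intro arg_cong2[where f = insert] image_cong) (auto simp: infinite_pts_def geneig_of_point_def)
  have can: "canonical (infinite_pts k l i)" for i by (simp add: infinite_pts_def canonical_def)
  have S: "singular_points A B = infinite_pts k l ` {1..k}"
    by (rule singular_points_eqI) (use can im e in auto)
  have c: "card (infinite_pts k l ` {1..k}) \<ge> 3" using real_case_singular_points(2)[OF p] S by simp
  note v = cyclic_enum_infinite[OF l k]
  note m = mean_angle_cyc[OF v can c]
  have L: "finite (infinite_pts k l ` {1..k})" "\<And>p. p \<in> infinite_pts k l ` {1..k} \<Longrightarrow> canonical p" using can by auto
  have "((\<lambda>t. cyc_cos k (approx_pts k l t)) \<longlongrightarrow> cyc_cos k (infinite_pts k l)) at_top"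
    using angle_roots_explicit(1,2)[OF L c]
    unfolding sum_good_pairs[where f = quad_coeff, OF v coefficient_degenerate(1)]
      sum_good_pairs[where f = const_coeff, OF v coefficient_degenerate(3)]
    by (rule cyc_cos_tendsto[OF v])
  moreover have "\<forall>\<^sub>F t in at_top. cyc_cos k (approx_pts k l t) = cos_formula k (l(k := t))"
    using eventually_gt_at_top[of 0]
  proof eventually_elim
    case (elim t)
    then show ?case using cyc_cos_approx[of t k l] cos_formula_eq[of k "l(k := t)"] k by simp
  qed
  ultimately have "((\<lambda>t. cos_formula k (l(k := t))) \<longlongrightarrow> cyc_cos k (infinite_pts k l)) at_top"
    by (rule Lim_transform_eventually)
  then show ?thesis
    unfolding S m(1) by (rule isCont_tendsto_compose[OF isCont_arccos[OF m(2,3)]])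
qed

theorem theorem3p1:
  shows
    "(\<exists>\<theta>. invariant_angle_function
             {(cohyp A, cohyp B) | (A :: real^'n^'n) (B :: real^'n^'n). nonreal_case A B} \<theta> \<and>
           (\<forall>(A :: real^'n^'n) (B :: real^'n^'n) k l.
              nonreal_case A B \<and> enumerates_nonreal A B k l \<longrightarrow>
              \<theta> (cohyp A) (cohyp B) = (1 / real k) * (\<Sum>i=1..k. \<bar>Arg (l i)\<bar>)))
     \<and>
     (\<exists>\<theta>. invariant_angle_function
             {(cohyp A, cohyp B) | (A :: real^'n^'n) (B :: real^'n^'n). real_case A B} \<theta> \<and>
           (\<forall>(A :: real^'n^'n) (B :: real^'n^'n) k l.
              real_case A B \<longrightarrow>
              (strict_mono_on {1..k} l \<and>
                 gen_eigenvalues A B = (\<lambda>i. Fin (complex_of_real (l i))) ` {1..k} \<longrightarrow>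
               \<theta> (cohyp A) (cohyp B) = arccos (cos_formula k l)) \<and>
              (strict_mono_on {1..<k} l \<and>
                 gen_eigenvalues A B =
                   insert Infty ((\<lambda>i. Fin (complex_of_real (l i))) ` {1..<k}) \<longrightarrow>
               ((\<lambda>t. arccos (cos_formula k (l(k := t))))
                  \<longlongrightarrow> \<theta> (cohyp A) (cohyp B)) at_top)))
     \<and>
     (\<forall>(A :: real^'n^'n) (B :: real^'n^'n).
        regular_normals A B \<and> gen_eigenvalues A B \<subseteq> real_eigs \<and>
        card (gen_eigenvalues A B) \<le> 2 \<and>
        cohyp A \<noteq> cohyp B \<and> cohyp A \<noteq> opp (cohyp B) \<longrightarrow>
        \<not> (\<exists>D \<theta>. invariant_angle_function D \<theta> \<and> (cohyp A, cohyp B) \<in> D))"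
  (is "?nonreal \<and> ?real \<and> ?none")
proof (intro conjI)
  obtain \<theta> where \<theta>: "invariant_angle_function
      {(cohyp A, cohyp B) | (A :: real^'n^'n) (B :: real^'n^'n). nonreal_case A B} \<theta>"
    "\<forall>(A :: real^'n^'n) B. nonreal_case A B \<longrightarrow> \<theta> (cohyp A) (cohyp B) = mean_angle (nonreal_eigenvalues A B)"
    using nonreal_invariant_angle by blast
  show ?nonreal
    by (rule exI[of _ \<theta>], rule conjI[OF \<theta>(1)]) (use \<theta>(2) mean_angle_enumerates_nonreal in auto)
next
  obtain \<theta> where \<theta>: "invariant_angle_function
      {(cohyp A, cohyp B) | (A :: real^'n^'n) (B :: real^'n^'n). real_case A B} \<theta>"
    "\<forall>(A :: real^'n^'n) B. real_case A B \<longrightarrow>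
      \<theta> (cohyp A) (cohyp B) = mean_angle (angle_roots (singular_points A B))"
    using real_invariant_angle by blast
  show ?real
    by (rule exI[of _ \<theta>], rule conjI[OF \<theta>(1)])
      (use \<theta>(2) real_case_finite_formula real_case_infinite_formula in auto)
next
  show ?none using no_invariant_angle by blast
qed

end
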